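(* Let $K$ be a number field containing $\mathbb{Q}[i]$, and let $F:=(f_1,\ldots,f_n)$ be polynomials in $\mathbb{Z}[X_1,\ldots,X_n]$ such that $\max\{\deg(f_i):1\le i\le n\}\le2$ and $ht(f_i)\le h$ for $1\le i\le n$. Let $\zeta\in K^n$ be a smooth $K$-rational zero of $F$ (i.e. $F(\zeta)=0$ and $DF(\zeta)\in GL(n,K)$), and let $|\cdot|_\nu:K\to\mathbb{R}_+$, $\nu\in M_K$, be an absolute value on $K$. Then $$\log\gamma_\nu(F,\zeta)\le 3[K:\mathbb{Q}]\,n\left(n^2+4\log n+h+ht(\zeta)+3\right).$$
   Context: $M_K$ is the standard proper set of absolute values on $K$ (one for each place, extending the usual or a $p$-adic absolute value of $\mathbb{Q}$), with multiplicities $n_\nu=[K_\nu:\mathbb{Q}_\nu]$ for which the product formula holds. $K_\nu$ is the completion of $K$ and $\|\cdot\|_\nu$ is the associated norm on $K_\nu^n$: the Hermitian norm if $\nu$ is archimedean, the maximum norm otherwise. $$\gamma_{\nu}(F,\zeta):=\sup_{k\ge 2}\left\|\frac{DF(\zeta)^{-1}D^{(k)}F(\zeta)}{k!}\right\|_{\nu}^{\frac{1}{k-1}},$$ with the operator norm of the $k$-multilinear operator $DF(\zeta)^{-1}D^{(k)}F(\zeta):(K_\nu^n)^k\to K_\nu^n$ (with $\log 0=-\infty$). For $f\in\mathbb{Z}[X_1,\ldots,X_n]$, $ht(f)$ is the logarithm of the maximum of the absolute values of its coefficients. For $\zeta\in K^n$, $ht(\zeta)=\frac{1}{[K:\mathbb{Q}]}\sum_{\nu\in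 M_K}n_\nu\log\max\{1,|\zeta_1|_\nu,\ldots,|\zeta_n|_\nu\}$ is the absolute logarithmic (Weil) height. *)

theory Defs
  imports
    "HOL-Analysis.Analysis"
    "HOL-Algebra.Embedded_Algebras"
    "HOL-Algebra.QuotRing"
    "HOL-Library.Poly_Mapping"
    "HOL-Computational_Algebra.Primes"
begin

section \<open>Number fields\<close>


text \<open>A number field is a type of class \<open>field_char_0\<close> that is finite-dimensional as a vector
  space over its prime field, where \<open>rat_scale\<close> is the scalar multiplication.\<close>

definition rat_scale :: "rat \<Rightarrow> 'k::field_char_0 \<Rightarrow> 'k" where
  "rat_scale q x = of_rat q * x"

definition number_field :: "'k::field_char_0 itself \<Rightarrow> bool" where
  "number_field _ \<longleftrightarrow>
     (\<exists>B :: 'k set. finite B \<and> module.span rat_scale B = UNIV)"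

definition field_degree :: "'k::field_char_0 itself \<Rightarrow> nat" where
  "field_degree _ = vector_space.dim rat_scale (UNIV :: 'k set)"


section \<open>Absolute values and places\<close>

definition absolute_value :: "('k::field \<Rightarrow> real) \<Rightarrow> bool" where
  "absolute_value v \<longleftrightarrow>
     (\<forall>x. 0 \<le> v x) \<and> (\<forall>x. v x = 0 \<longleftrightarrow> x = 0) \<and>
     (\<forall>x y. v (x * y) = v x * v y) \<and> (\<forall>x y. v (x + y) \<le> v x + v y)"

definition archimedean :: "('k::field \<Rightarrow> real) \<Rightarrow> bool" where
  "archimedean v \<longleftrightarrow> \<not> (\<forall>x y. v (x + y) \<le> max (v x) (v y))"

text \<open>The \<open>p\<close>-adic absolute value on the rationals, with \<open>|p| = 1/p\<close>.\<close>

definition padic_abs :: "nat \<Rightarrow> rat \<Rightarrow> real" where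
  "padic_abs p q =
     (if q = 0 then 0
      else case quotient_of q of (a, b) \<Rightarrow>
        real p powi (int (multiplicity (int p) b) - int (multiplicity (int p) a)))"

text \<open>Equivalent absolute values are powers of one another, so two of them with the same
  (nontrivial) restriction to the rationals coincide. Hence the following set contains exactly one
  representative of each place.\<close>

definition standard_absolute_values :: "('k::field_char_0 \<Rightarrow> real) set" where
  "standard_absolute_values =
     {v. absolute_value v \<and>
         ((\<forall>q. v (of_rat q) = \<bar>of_rat q\<bar>) \<or>
          (\<exists>p. prime p \<and> (\<forall>q. v (of_rat q) = padic_abs p q)))}"


section \<open>Completions\<close>

text \<open>The completion of \<open>K\<close> at \<open>v\<close> is the ring of Cauchy sequences modulo the null sequences.
  Since it depends on the term \<open>v\<close>, it is a ring with an explicit carrier and not a type.\<close>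

definition cauchy_seq :: "('k::field \<Rightarrow> real) \<Rightarrow> (nat \<Rightarrow> 'k) \<Rightarrow> bool" where
  "cauchy_seq v s \<longleftrightarrow> (\<forall>e>0. \<exists>N. \<forall>m\<ge>N. \<forall>n\<ge>N. v (s m - s n) < e)"

definition cauchy_seq_ring :: "('k::field \<Rightarrow> real) \<Rightarrow> (nat \<Rightarrow> 'k) ring" where
  "cauchy_seq_ring v =
     \<lparr>carrier = {s. cauchy_seq v s},
      mult = (\<lambda>s t n. s n * t n), one = (\<lambda>n. 1),
      zero = (\<lambda>n. 0), add = (\<lambda>s t n. s n + t n)\<rparr>"

definition null_seqs :: "('k::field \<Rightarrow> real) \<Rightarrow> (nat \<Rightarrow> 'k) set" where
  "null_seqs v = {s. (\<lambda>n. v (s n)) \<longlonglongrightarrow> 0}"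

definition completion :: "('k::field \<Rightarrow> real) \<Rightarrow> (nat \<Rightarrow> 'k) set ring" where
  "completion v = cauchy_seq_ring v Quot null_seqs v"

definition completion_embed :: "('k::field \<Rightarrow> real) \<Rightarrow> 'k \<Rightarrow> (nat \<Rightarrow> 'k) set" where
  "completion_embed v a = null_seqs v +>\<^bsub>cauchy_seq_ring v\<^esub> (\<lambda>n. a)"

definition completion_abs :: "('k::field \<Rightarrow> real) \<Rightarrow> (nat \<Rightarrow> 'k) set \<Rightarrow> real" where
  "completion_abs v X = (THE l. \<forall>s\<in>X. (\<lambda>n. v (s n)) \<longlonglongrightarrow> l)"

text \<open>The completion of the rationals at the restriction of \<open>v\<close>, realised inside \<open>completion v\<close>
  as the set of classes of rational Cauchy sequences.\<close>

definition rat_completion :: "('k::field_char_0 \<Rightarrow> real) \<Rightarrow> (nat \<Rightarrow> 'k) set set" where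
  "rat_completion v = {X \<in> carrier (completion v). \<exists>s\<in>X. \<forall>n. s n \<in> \<rat>}"

definition local_degree :: "('k::field_char_0 \<Rightarrow> real) \<Rightarrow> nat" where
  "local_degree v =
     ring.dim (completion v) (rat_completion v) (carrier (completion v))"


section \<open>Vectors and multilinear operators over a completion\<close>

definition completion_vecs :: "('k::field \<Rightarrow> real) \<Rightarrow> ('n::finite \<Rightarrow> (nat \<Rightarrow> 'k) set) set" where
  "completion_vecs v = {x. \<forall>i. x i \<in> carrier (completion v)}"

definition vec_norm :: "('k::field \<Rightarrow> real) \<Rightarrow> ('n::finite \<Rightarrow> (nat \<Rightarrow> 'k) set) \<Rightarrow> real" where
  "vec_norm v x =
     (if archimedean v then sqrt (\<Sum>i\<in>UNIV. (completion_abs v (x i))\<^sup>2)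
      else (MAX i. completion_abs v (x i)))"

text \<open>A \<open>k\<close>-tuple of vectors is a function on \<open>nat\<close> of which only the values below \<open>k\<close> matter.
  As for \<open>onorm\<close>, tuples containing the zero vector contribute the ratio \<open>0 / 0 = 0\<close>.\<close>

definition multilinear_onorm ::
    "('k::field \<Rightarrow> real) \<Rightarrow> nat \<Rightarrow>
     ((nat \<Rightarrow> 'n::finite \<Rightarrow> (nat \<Rightarrow> 'k) set) \<Rightarrow> 'n \<Rightarrow> (nat \<Rightarrow> 'k) set) \<Rightarrow> real" where
  "multilinear_onorm v k A =
     (SUP u\<in>{u. \<forall>m<k. u m \<in> completion_vecs v}. vec_norm v (A u) / (\<Prod>m<k. vec_norm v (u m)))"

definition completion_scale ::
    "('k::field \<Rightarrow> real) \<Rightarrow> 'k \<Rightarrow> ('n::finite \<Rightarrow> (nat \<Rightarrow> 'k) set) \<Rightarrow> 'n \<Rightarrow> (nat \<Rightarrow> 'k) set" where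
  "completion_scale v c y j = completion_embed v c \<otimes>\<^bsub>completion v\<^esub> y j"

definition completion_matvec ::
    "('k::field \<Rightarrow> real) \<Rightarrow> 'k^'n^'n::finite \<Rightarrow> ('n \<Rightarrow> (nat \<Rightarrow> 'k) set) \<Rightarrow> 'n \<Rightarrow> (nat \<Rightarrow> 'k) set" where
  "completion_matvec v M y j =
     (\<Oplus>\<^bsub>completion v\<^esub>l\<in>UNIV. completion_embed v (M $ j $ l) \<otimes>\<^bsub>completion v\<^esub> y l)"


section \<open>Integer polynomials in several variables\<close>

text \<open>A polynomial in the variables \<open>X\<^sub>i\<close>, \<open>i :: 'n\<close>, maps each exponent vector to its
  coefficient.\<close>

type_synonym 'n int_mpoly = "('n \<Rightarrow>\<^sub>0 nat) \<Rightarrow>\<^sub>0 int"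

definition mpoly_eval :: "'n::finite int_mpoly \<Rightarrow> 'k::comm_ring_1^'n \<Rightarrow> 'k" where
  "mpoly_eval f x =
     (\<Sum>m\<in>Poly_Mapping.keys f.
        of_int (Poly_Mapping.lookup f m) * (\<Prod>i\<in>UNIV. (x $ i) ^ Poly_Mapping.lookup m i))"

definition mpoly_degree :: "'n::finite int_mpoly \<Rightarrow> nat" where
  "mpoly_degree f =
     Max (insert 0 ((\<lambda>m. \<Sum>i\<in>UNIV. Poly_Mapping.lookup m i) ` Poly_Mapping.keys f))"

text \<open>If \<open>X\<^sub>i\<close> does not occur in the monomial \<open>m\<close>, the truncated difference below is
  irrelevant because the coefficient vanishes.\<close>

definition mpoly_pderiv :: "'n \<Rightarrow> 'n::finite int_mpoly \<Rightarrow> 'n int_mpoly" where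
  "mpoly_pderiv i f =
     (\<Sum>m\<in>Poly_Mapping.keys f.
        Poly_Mapping.single (m - Poly_Mapping.single i 1)
          (int (Poly_Mapping.lookup m i) * Poly_Mapping.lookup f m))"

definition mpoly_jacobian :: "'n int_mpoly^'n \<Rightarrow> 'k::comm_ring_1^'n \<Rightarrow> 'k^'n^'n::finite" where
  "mpoly_jacobian F x = (\<chi> j i. mpoly_eval (mpoly_pderiv i (F $ j)) x)"

text \<open>The \<open>k\<close>-th derivative at \<open>x\<close> as a \<open>k\<close>-linear operator over the completion; the sum ranges
  over all \<open>k\<close>-tuples \<open>is\<close> of variable indices.\<close>

definition higher_deriv ::
    "('k::field \<Rightarrow> real) \<Rightarrow> nat \<Rightarrow> 'n int_mpoly^'n \<Rightarrow> 'k^'n \<Rightarrow>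
     (nat \<Rightarrow> 'n::finite \<Rightarrow> (nat \<Rightarrow> 'k) set) \<Rightarrow> 'n \<Rightarrow> (nat \<Rightarrow> 'k) set" where
  "higher_deriv v k F x u j =
     (\<Oplus>\<^bsub>completion v\<^esub>is\<in>{is :: 'n list. length is = k}.
        completion_embed v (mpoly_eval (fold mpoly_pderiv is (F $ j)) x) \<otimes>\<^bsub>completion v\<^esub>
        (\<Otimes>\<^bsub>completion v\<^esub>m\<in>{..<k}. u m (is ! m)))"


section \<open>The gamma number and heights\<close>

definition gamma_number ::
    "('k::field_char_0 \<Rightarrow> real) \<Rightarrow> 'n int_mpoly^'n \<Rightarrow> 'k^'n::finite \<Rightarrow> real" where
  "gamma_number v F x =
     (SUP k\<in>{2::nat..}.
        multilinear_onorm v k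
          (\<lambda>u. completion_scale v (1 / fact k)
                 (completion_matvec v (matrix_inv (mpoly_jacobian F x)) (higher_deriv v k F x u)))
        powr (1 / (real k - 1)))"

definition log_ext :: "real \<Rightarrow> ereal" where
  "log_ext x = (if x = 0 then -\<infinity> else ereal (ln x))"

text \<open>The maximum ranges over all coefficients, including the zero ones, so that it is \<open>0\<close> for
  the zero polynomial; the set of coefficients is finite.\<close>

definition mpoly_height :: "'n::finite int_mpoly \<Rightarrow> ereal" where
  "mpoly_height f = log_ext (of_int (MAX m. \<bar>Poly_Mapping.lookup f m\<bar>))"

text \<open>All summands are nonnegative and only finitely many of them are nonzero.\<close>

definition weil_height :: "'k::field_char_0^'n::finite \<Rightarrow> real" where
  "weil_height x =
     1 / real (field_degree TYPE('k)) *
     (\<Sum>\<^sub>\<infinity>v\<in>standard_absolute_values.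
        real (local_degree v) * ln (Max (insert 1 (range (\<lambda>i. v (x $ i))))))"

end

(* Since deg F \<le> 2, only k = 2 contributes to the supremum defining gamma, and by Cramer's rule
   everything reduces to a lower bound for |d|_\<nu>, where d = det DF(\<zeta>) \<noteq> 0. This is Liouville's
   inequality -log |d|_\<nu> \<le> \<Sum>_w n_w log max(1, |d|_w), which needs the local degrees n_w and the norm
   inequality |N(x)|_u \<le> \<Prod>_{w|u} |x|_w^{n_w} at every place u of the rationals.

   The norm inequality is proved inside K, without a model of the p-adic numbers. Let \<rho> be the spectral
   radius on K of a norm relative to a rational basis. A minimal power-multiplicative seminorm below \<rho>
   is multiplicative, so \<rho> is the maximum of the absolute values extending u. From |N(x)|_u \<le> \<rho>(x)^D,
   applied to j - x for several j and interpolated, one gets |Tr(x)|_u \<le> C \<rho>(x); as the trace form is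
   nondegenerate, \<rho> is equivalent to the norm. By weak approximation, bases of the completions K_w are
   then glued to a basis of K, with respect to which multiplication by x^N has columns of size
   O(|x|_w^N); letting N tend to infinity gives the inequality. *)

theory Submission
  imports Defs "Jordan_Normal_Form.Char_Poly"
begin

section \<open>Absolute values\<close>

text \<open>Bounds up to a constant suffice almost everywhere: a bound for all powers, with a
  constant that does not depend on the exponent, loses the constant on taking roots
  (\<open>real_le_of_power_le\<close>). Hence the norm on K may depend on a basis, determinants may
  be estimated by Leibniz's formula even at p-adic places, and the glued basis may be chosen anew
  for every exponent. An inequality for norms is enough, because the logarithms of a rational norm
  sum to 0 over the rational places. A completion depends on the term \<nu>, hence is a ring with a
  carrier and not a type; topological linear algebra over it is replaced by statements about
  approximation by elements of K, and the lengths of the local bases found in this way are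
  identified with the local degrees in a separate step. The archimedean constants in the final bound
  are multiplied by [K:Q] exactly, since the local degrees over the usual absolute value add up to
  it; the other places contribute only heights, because F has integer coefficients.\<close>

lemma absolute_value_nonneg: "absolute_value v \<Longrightarrow> 0 \<le> v x"
  and absolute_value_eq_0: "absolute_value v \<Longrightarrow> v x = 0 \<longleftrightarrow> x = 0"
  and absolute_value_mult: "absolute_value v \<Longrightarrow> v (x * y) = v x * v y"
  and absolute_value_triangle: "absolute_value v \<Longrightarrow> v (x + y) \<le> v x + v y"
  by (auto simp: absolute_value_def)

lemma absolute_value_0: "absolute_value v \<Longrightarrow> v 0 = 0"
  by (simp add: absolute_value_eq_0)

lemma absolute_value_pos: "absolute_value v \<Longrightarrow> x \<noteq> 0 \<Longrightarrow> 0 < v x"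
  by (metis absolute_value_eq_0 absolute_value_nonneg order_le_less)

lemma absolute_value_1: "absolute_value v \<Longrightarrow> v 1 = 1"
  by (metis absolute_value_eq_0 absolute_value_mult mult_cancel_left2 mult_1 zero_neq_one)

lemma absolute_value_power: "absolute_value v \<Longrightarrow> v (x ^ n) = v x ^ n"
  by (induction n) (auto simp: absolute_value_1 absolute_value_mult)

lemma absolute_value_minus:
  assumes v: "absolute_value v" shows "v (- x) = v x"
proof -
  have "v (-1) ^ 2 = 1"
    using absolute_value_power[OF v, of "-1" 2] absolute_value_1[OF v] by simp
  then have "v (-1) = 1"
    using absolute_value_nonneg[OF v, of "-1"] by (auto simp: power2_eq_1_iff)
  then show ?thesis
    using absolute_value_mult[OF v, of "-1" x] by simp
qed

lemma absolute_value_minus_commute: "absolute_value v \<Longrightarrow> v (x - y) = v (y - x)"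
  by (metis absolute_value_minus minus_diff_eq)

lemma absolute_value_diff_triangle: "absolute_value v \<Longrightarrow> v (x - y) \<le> v x + v y"
  by (metis absolute_value_minus absolute_value_triangle diff_conv_add_uminus)

lemma absolute_value_diff_ge: "absolute_value v \<Longrightarrow> v x - v y \<le> v (x + y)"
  using absolute_value_diff_triangle[of v "x + y" y] by simp

lemma absolute_value_inverse:
  "absolute_value v \<Longrightarrow> v (inverse x) = inverse (v x)"
  by (metis absolute_value_0 absolute_value_1 absolute_value_mult inverse_unique inverse_zero
      right_inverse)

lemma absolute_value_power_int: "absolute_value v \<Longrightarrow> v (x powi k) = v x powi k"
  by (auto simp: power_int_def absolute_value_power absolute_value_inverse)

lemma absolute_value_divide: "absolute_value v \<Longrightarrow> v (x / y) = v x / v y"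
  by (simp add: divide_inverse absolute_value_mult absolute_value_inverse)

lemma absolute_value_prod: "absolute_value v \<Longrightarrow> v (\<Prod>i\<in>A. f i) = (\<Prod>i\<in>A. v (f i))"
  by (induction A rule: infinite_finite_induct) (auto simp: absolute_value_1 absolute_value_mult)

lemma absolute_value_sum: "absolute_value v \<Longrightarrow> v (\<Sum>i\<in>A. f i) \<le> (\<Sum>i\<in>A. v (f i))"
proof (induction A rule: infinite_finite_induct)
  case (insert x F)
  then show ?case
    using absolute_value_triangle[of v "f x" "\<Sum>i\<in>F. f i"] by simp
qed (auto simp: absolute_value_0)

lemma absolute_value_of_nat_le:
  assumes v: "absolute_value v" shows "v (of_nat n) \<le> real n"
  using absolute_value_sum[OF v, of "\<lambda>_. 1" "{..<n}"] by (simp add: absolute_value_1[OF v])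

lemma absolute_value_of_int_le:
  assumes v: "absolute_value v" shows "v (of_int n) \<le> \<bar>of_int n\<bar>"
  using absolute_value_of_nat_le[OF v, of "nat \<bar>n\<bar>"]
  by (cases "0 \<le> n") (auto simp: absolute_value_minus[OF v])

lemma nonarchimedean_le_max:
  "\<not> archimedean v \<Longrightarrow> v (x + y) \<le> max (v x) (v y)"
  by (simp add: archimedean_def)

lemma nonarchimedean_sum_le:
  assumes v: "absolute_value v" "\<not> archimedean v" and "0 \<le> c" "\<And>i. i \<in> A \<Longrightarrow> v (f i) \<le> c"
  shows "v (\<Sum>i\<in>A. f i) \<le> c"
  using assms(4)
proof (induction A rule: infinite_finite_induct)
  case (insert x F)
  then show ?case
    using nonarchimedean_le_max[OF v(2), of "f x" "\<Sum>i\<in>F. f i"] by fastforce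
qed (use assms in \<open>auto simp: absolute_value_0\<close>)

text \<open>Otherwise \<open>a / b\<close> exceeds 1 and its powers outgrow \<open>C\<close>; for
  \<open>b = 0\<close> the exponent 1 suffices. This is the device that discards constants, as long
  as one \<open>C\<close> serves all exponents.\<close>

lemma real_le_of_power_le:
  fixes a b C :: real
  assumes "0 \<le> a" "0 \<le> b" "\<And>n. a ^ n \<le> C * b ^ n"
  shows "a \<le> b"
proof (rule ccontr)
  assume "\<not> a \<le> b"
  then have ab: "b < a" by simp
  show False
  proof (cases "b = 0")
    case True
    then show ?thesis using assms(3)[of 1] ab by simp
  next
    case False
    then have b: "b > 0" using assms(2) by simp
    then have "1 < a / b" using ab by simp
    then obtain n where "C < (a / b) ^ n"
      using real_arch_pow by blast
    then have "C * b ^ n < a ^ n"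
      using b by (simp add: power_divide field_simps)
    then show False using assms(3)[of n] by simp
  qed
qed

text \<open>By the binomial formula \<open>v (x + y) ^ n\<close> is at most \<open>n + 1\<close>
  times \<open>M ^ n\<close>, and the polynomial factor disappears on taking roots.\<close>

lemma nonarchimedeanI:
  assumes v: "absolute_value v" and nat: "\<And>n. v (of_nat n) \<le> 1"
  shows "\<not> archimedean v"
proof -
  have "v (x + y) \<le> max (v x) (v y)" for x y
  proof -
    define M where "M = max (v x) (v y)"
    have M: "0 \<le> M" using absolute_value_nonneg[OF v, of x] by (simp add: M_def)
    have "v (x + y) ^ n \<le> real (Suc n) * M ^ n" for n
    proof -
      have "v (x + y) ^ n = v (\<Sum>k\<le>n. of_nat (n choose k) * x ^ k * y ^ (n - k))"
        by (metis absolute_value_power[OF v] binomial_ring)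
      also have "\<dots> \<le> (\<Sum>k\<le>n. v (of_nat (n choose k) * x ^ k * y ^ (n - k)))"
        by (rule absolute_value_sum[OF v])
      also have "\<dots> \<le> (\<Sum>k\<le>n. 1 * M ^ k * M ^ (n - k))"
        unfolding absolute_value_mult[OF v] absolute_value_power[OF v]
        by (intro sum_mono mult_mono nat power_mono)
          (auto simp: M_def absolute_value_nonneg[OF v] le_max_iff_disj)
      also have "\<dots> = real (Suc n) * M ^ n"
        by (simp flip: power_add)
      finally show ?thesis .
    qed
    note bound = this
    \<comment> \<open>\<open>real_le_of_power_le\<close> absorbs a constant but not the factor
      \<open>Suc n\<close>, which Bernoulli's inequality hides in \<open>(1 + e) ^ n\<close> at the
      price of the margin \<open>e\<close>.\<close>
    have "v (x + y) \<le> M * (1 + e)" if e: "e > 0" for e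
    proof -
      obtain C where C: "real (Suc n) \<le> C * (1 + e) ^ n" for n
      proof
        show "real (Suc n) \<le> (1 + 1 / e) * (1 + e) ^ n" for n
        proof -
          have "real n * e \<le> (1 + e) ^ n" "1 \<le> (1 + e) ^ n"
            using Bernoulli_inequality[of e n] e by (auto simp: one_le_power)
          then have "real n \<le> (1 + e) ^ n / e"
            using e by (simp add: field_simps)
          then show ?thesis using \<open>1 \<le> (1 + e) ^ n\<close> by (simp add: algebra_simps)
        qed
      qed
      show ?thesis
      proof (rule real_le_of_power_le)
        fix n
        have "v (x + y) ^ n \<le> real (Suc n) * M ^ n" by (rule bound)
        also have "\<dots> \<le> C * (1 + e) ^ n * M ^ n"
          by (intro mult_right_mono C) (simp add: M)
        also have "\<dots> = C * (M * (1 + e)) ^ n" by (simp add: power_mult_distrib)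
        finally show "v (x + y) ^ n \<le> C * (M * (1 + e)) ^ n" .
      qed (use M that absolute_value_nonneg[OF v] in auto)
    qed
    note * = this
    have "v (x + y) \<le> M + d" if "d > 0" for d
    proof -
      have "v (x + y) \<le> M * (1 + d / (M + 1))" using *[of "d / (M + 1)"] that M by simp
      also have "\<dots> \<le> M + d" using M that by (simp add: field_simps)
      finally show ?thesis .
    qed
    then show ?thesis unfolding M_def by (meson field_le_epsilon)
  qed
  then show ?thesis by (simp add: archimedean_def)
qed

section \<open>Absolute values of the rationals\<close>

text \<open>\<open>padic_abs\<close> reads off the reduced fraction. By cross-multiplication the
  difference of multiplicities is the same for every fraction representing the number, so common
  denominators may be used.\<close>

lemma padic_abs_Fract:
  assumes p: "prime p" and ab: "a \<noteq> 0" "b \<noteq> 0"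
  shows "padic_abs p (Rat.Fract a b) = real p powi (int (multiplicity (int p) b) - int (multiplicity (int p) a))"
proof -
  obtain c d where cd: "quotient_of (Rat.Fract a b) = (c, d)" by force
  then have d: "d > 0" and eq: "Rat.Fract a b = Rat.Fract c d"
    by (auto simp: quotient_of_denom_pos quotient_of_div Fract_of_int_quotient)
  then have ad: "a * d = c * b" and c: "c \<noteq> 0"
    using ab by (auto simp: eq_rat)
  have "prime_elem (int p)" using p by auto
  then have "multiplicity (int p) a + multiplicity (int p) d = multiplicity (int p) c + multiplicity (int p) b"
    using ad ab c d by (metis prime_elem_multiplicity_mult_distrib less_irrefl)
  moreover have "Rat.Fract a b \<noteq> 0" using ab by (simp add: Fract_of_int_quotient)
  moreover have "int (multiplicity (int p) d) - int (multiplicity (int p) c) =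
      int (multiplicity (int p) b) - int (multiplicity (int p) a)"
    using calculation(1) by linarith
  ultimately show ?thesis by (simp add: padic_abs_def cd)
qed

lemma padic_abs_of_int:
  assumes "prime p" "a \<noteq> 0"
  shows "padic_abs p (of_int a) = real p powi (- int (multiplicity (int p) a))"
  using padic_abs_Fract[OF assms, of 1] by (simp add: Fract_of_int_quotient)

lemma absolute_value_padic_abs:
  assumes p: "prime p" shows "absolute_value (padic_abs p)"
proof -
  have p0: "real p > 1" using prime_gt_1_nat[OF p] by simp
  have pe: "prime_elem (int p)" using p by auto
  have pos: "padic_abs p x > 0" if "x \<noteq> 0" for x
    using that p0 by (auto simp: padic_abs_def split: prod.splits)
  have [simp]: "padic_abs p 0 = 0" by (simp add: padic_abs_def)
  have rep: "\<exists>a b. x = Rat.Fract a b \<and> b \<noteq> 0" for x :: rat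
    by (metis Rat_cases less_irrefl)
  have mult: "padic_abs p (x * y) = padic_abs p x * padic_abs p y" for x y
  proof (cases "x = 0 \<or> y = 0")
    case False
    obtain a b c d where *: "x = Rat.Fract a b" "y = Rat.Fract c d" "b \<noteq> 0" "d \<noteq> 0"
      using rep by meson
    then have "a \<noteq> 0" "c \<noteq> 0" using False by (auto simp: Zero_rat_def eq_rat)
    then have "padic_abs p (x * y) = real p powi (int (multiplicity (int p) (b * d)) - int (multiplicity (int p) (a * c)))"
      using * by (simp add: padic_abs_Fract[OF p])
    also have "int (multiplicity (int p) (b * d)) - int (multiplicity (int p) (a * c)) =
        (int (multiplicity (int p) b) - int (multiplicity (int p) a)) +
        (int (multiplicity (int p) d) - int (multiplicity (int p) c))"
      using * \<open>a \<noteq> 0\<close> \<open>c \<noteq> 0\<close> by (simp add: prime_elem_multiplicity_mult_distrib[OF pe])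
    also have "real p powi \<dots> = padic_abs p x * padic_abs p y"
      using * \<open>a \<noteq> 0\<close> \<open>c \<noteq> 0\<close> p0 by (simp add: padic_abs_Fract[OF p] power_int_add)
    finally show ?thesis .
  qed auto
  have "padic_abs p (x + y) \<le> max (padic_abs p x) (padic_abs p y)" for x y
  proof (cases "x = 0 \<or> y = 0 \<or> x + y = 0")
    case True
    moreover have "0 \<le> padic_abs p x" for x using pos[of x] by (cases "x = 0") auto
    ultimately show ?thesis by (auto simp: le_max_iff_disj)
  next
    case False
    obtain a b c d where *: "x = Rat.Fract a b" "y = Rat.Fract c d" "b \<noteq> 0" "d \<noteq> 0"
      using rep by meson
    then have ac: "a \<noteq> 0" "c \<noteq> 0" using False by (auto simp: Zero_rat_def eq_rat)
    \<comment> \<open>Over a common denominator the ultrametric inequality says that a sum is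
      divisible by the smaller of two prime powers.\<close>
    have xy: "x = Rat.Fract (a * d) (b * d)" "y = Rat.Fract (c * b) (b * d)" "x + y = Rat.Fract (a * d + c * b) (b * d)"
      using * by (auto simp: eq_rat)
    have n0: "a * d + c * b \<noteq> 0" using False * xy(3) by (auto simp: rat_number_collapse)
    have min: "min (multiplicity (int p) (a * d)) (multiplicity (int p) (c * b)) \<le> multiplicity (int p) (a * d + c * b)"
    proof (rule multiplicity_geI[OF n0])
      show "\<not> is_unit (int p)" using p by auto
      show "int p ^ min (multiplicity (int p) (a * d)) (multiplicity (int p) (c * b)) dvd a * d + c * b"
        by (intro dvd_add multiplicity_dvd') auto
    qed
    have px: "padic_abs p x = real p powi (int (multiplicity (int p) (b * d)) - int (multiplicity (int p) (a * d)))"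
      unfolding xy(1) by (rule padic_abs_Fract[OF p]) (use * ac in auto)
    have py: "padic_abs p y = real p powi (int (multiplicity (int p) (b * d)) - int (multiplicity (int p) (c * b)))"
      unfolding xy(2) by (rule padic_abs_Fract[OF p]) (use * ac in auto)
    have pxy: "padic_abs p (x + y) = real p powi (int (multiplicity (int p) (b * d)) - int (multiplicity (int p) (a * d + c * b)))"
      unfolding xy(3) by (rule padic_abs_Fract[OF p]) (use * n0 in auto)
    consider "multiplicity (int p) (a * d) \<le> multiplicity (int p) (a * d + c * b)"
      | "multiplicity (int p) (c * b) \<le> multiplicity (int p) (a * d + c * b)" using min by linarith
    then show ?thesis
    proof cases
      case 1
      have "padic_abs p (x + y) \<le> padic_abs p x"
        unfolding px pxy using 1 p0 by (intro power_int_increasing) auto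
      then show ?thesis by simp
    next
      case 2
      have "padic_abs p (x + y) \<le> padic_abs p y"
        unfolding py pxy using 2 p0 by (intro power_int_increasing) auto
      then show ?thesis by simp
    qed
  qed
  moreover have nn: "0 \<le> padic_abs p x" for x using pos[of x] by (cases "x = 0") auto
  ultimately have "padic_abs p (x + y) \<le> padic_abs p x + padic_abs p y" for x y
    by (smt (verit))
  then show ?thesis using nn mult pos by (force simp: absolute_value_def)
qed

lemma padic_abs_of_int_le_1:
  assumes p: "prime p" shows "padic_abs p (of_int a) \<le> 1"
proof (cases "a = 0")
  case False
  have "real p > 1" using prime_gt_1_nat[OF p] by simp
  then show ?thesis
    using padic_abs_of_int[OF p False] by (simp add: power_int_minus inverse_le_1_iff)
qed (simp add: padic_abs_def)

lemma padic_abs_of_int_coprime: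
  assumes p: "prime p" "\<not> int p dvd a" shows "padic_abs p (of_int a) = 1"
proof -
  have "a \<noteq> 0" using assms by auto
  then show ?thesis using padic_abs_of_int[OF p(1)] p(2) by (simp add: not_dvd_imp_multiplicity_0)
qed

lemma padic_abs_self:
  assumes p: "prime p" shows "padic_abs p (of_nat p) = 1 / real p"
proof -
  have "multiplicity (int p) (int p) = 1"
    using p by (simp add: multiplicity_self prime_gt_1_nat)
  then show ?thesis using padic_abs_of_int[OF p, of "int p"] prime_gt_0_nat[OF p]
    by (simp add: power_int_minus divide_inverse)
qed

text \<open>The logarithm of the prime factorisation. \<open>P\<close> may contain further primes,
  whose summands are \<open>ln 1\<close>.\<close>

lemma ln_int_eq_sum_padic:
  fixes a :: int
  assumes "a \<noteq> 0" "finite P" "\<And>p. p \<in> P \<Longrightarrow> prime p" "\<And>p. prime p \<Longrightarrow> int p dvd a \<Longrightarrow> p \<in> P"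
  shows "ln \<bar>real_of_int a\<bar> + (\<Sum>p\<in>P. ln (padic_abs p (of_int a))) = 0"
proof -
  have sub: "prime_factors a \<subseteq> int ` P"
  proof
    fix p assume p: "p \<in> prime_factors a"
    then have "prime p" "p dvd a" by auto
    moreover obtain n where "p = int n"
      using \<open>prime p\<close> by (metis prime_ge_0_int zero_le_imp_eq_int)
    ultimately show "p \<in> int ` P" using assms(4)[of n] by simp
  qed
  have "\<bar>a\<bar> = (\<Prod>p\<in>prime_factors a. p ^ multiplicity p a)"
    using prod_prime_factors[OF assms(1)] by simp
  also have "\<dots> = (\<Prod>p\<in>int ` P. p ^ multiplicity p a)"
  proof (rule prod.mono_neutral_left)
    show "\<forall>i\<in>int ` P - prime_factors a. i ^ multiplicity i a = 1"
    proof
      fix i assume i: "i \<in> int ` P - prime_factors a"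
      then have "prime i" using assms(3) by auto
      then have "\<not> i dvd a" using i assms(1) by (auto simp: prime_factors_dvd)
      then show "i ^ multiplicity i a = 1" by (simp add: not_dvd_imp_multiplicity_0)
    qed
  qed (use sub assms in auto)
  also have "\<dots> = (\<Prod>p\<in>P. int p ^ multiplicity (int p) a)"
    by (subst prod.reindex) auto
  finally have "real_of_int \<bar>a\<bar> = (\<Prod>p\<in>P. real p ^ multiplicity (int p) a)"
    by simp
  then have "ln (real_of_int \<bar>a\<bar>) = (\<Sum>p\<in>P. ln (real p ^ multiplicity (int p) a))"
    using assms(2,3) by (simp add: ln_prod prime_gt_0_nat)
  moreover have "ln (padic_abs p (of_int a)) = - ln (real p ^ multiplicity (int p) a)" if "p \<in> P" for p
    using padic_abs_of_int[OF assms(3)[OF that] assms(1)] prime_gt_0_nat[OF assms(3)[OF that]]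
    by (simp add: power_int_minus ln_inverse)
  ultimately show ?thesis by (simp add: sum_negf del: of_int_abs flip: of_int_abs)
qed

text \<open>The primes of numerator and denominator suffice, and any finite set of primes can be
  added. The prescribed \<open>P0\<close> lets \<open>liouville_inequality\<close> include the prime
  below \<nu>.\<close>

theorem product_formula_rat:
  fixes q :: rat
  assumes "q \<noteq> 0" "finite P0" and P0: "\<forall>p\<in>P0. prime p"
  shows "\<exists>P. finite P \<and> P0 \<subseteq> P \<and> (\<forall>p\<in>P. prime p) \<and>
    ln \<bar>real_of_rat q\<bar> + (\<Sum>p\<in>P. ln (padic_abs p q)) = 0"
proof -
  obtain a b where ab: "q = of_int a / of_int b" "b \<noteq> 0"
    by (metis Fract_of_int_quotient Rat_cases less_irrefl)
  then have a: "a \<noteq> 0" using assms by auto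
  define P where "P = P0 \<union> {p. prime p \<and> int p dvd a} \<union> {p. prime p \<and> int p dvd b}"
  have fin: "finite {p. prime p \<and> int p dvd c}" if "c \<noteq> 0" for c
  proof (rule finite_subset)
    show "{p. prime p \<and> int p dvd c} \<subseteq> {..nat \<bar>c\<bar>}"
    proof
      fix p assume "p \<in> {p. prime p \<and> int p dvd c}"
      then show "p \<in> {..nat \<bar>c\<bar>}"
        using dvd_imp_le_int[OF that, of "int p"] by (simp add: le_nat_iff)
    qed
  qed auto
  show ?thesis
  proof (intro exI[of _ P] conjI)
    have prime: "prime p" if "p \<in> P" for p using that P0 by (auto simp: P_def)
    have "finite P" using assms fin[OF a] fin[OF ab(2)] by (simp add: P_def)
    then have "ln \<bar>real_of_int a\<bar> + (\<Sum>p\<in>P. ln (padic_abs p (of_int a))) = 0"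
       "ln \<bar>real_of_int b\<bar> + (\<Sum>p\<in>P. ln (padic_abs p (of_int b))) = 0"
      by (intro ln_int_eq_sum_padic a ab(2) prime; simp add: P_def)+
    moreover have "ln (padic_abs p q) = ln (padic_abs p (of_int a)) - ln (padic_abs p (of_int b))" if "p \<in> P" for p
      unfolding ab(1) absolute_value_divide[OF absolute_value_padic_abs[OF prime[OF that]]]
      using a ab(2) by (subst ln_div) (auto simp: absolute_value_eq_0[OF absolute_value_padic_abs[OF prime[OF that]]])
    moreover have "ln \<bar>real_of_rat q\<bar> = ln \<bar>real_of_int a\<bar> - ln \<bar>real_of_int b\<bar>"
      using a ab(2) by (simp add: ab(1) of_rat_divide ln_div)
    ultimately show "ln \<bar>real_of_rat q\<bar> + (\<Sum>p\<in>P. ln (padic_abs p q)) = 0"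
      by (simp add: sum_subtractf)
  qed (use assms fin[OF a] fin[OF ab(2)] in \<open>auto simp: P_def\<close>)
qed

section \<open>Extending absolute values\<close>

definition extensions :: "(rat \<Rightarrow> real) \<Rightarrow> ('k::field_char_0 \<Rightarrow> real) set" where
  "extensions u = {w. absolute_value w \<and> (\<forall>q. w (of_rat q) = u q)}"

text \<open>Multiplicativity is asked for squares only, because squares pass easily through limits
  and infima; general powers (\<open>spectral_seminorm_power\<close>) and rational scalars
  (\<open>spectral_seminorm_scale\<close>) follow.\<close>

definition spectral_seminorm :: "(rat \<Rightarrow> real) \<Rightarrow> ('k::field_char_0 \<Rightarrow> real) \<Rightarrow> bool" where
  "spectral_seminorm u \<sigma> \<longleftrightarrow>
     (\<forall>x. 0 \<le> \<sigma> x) \<and> (\<forall>x y. \<sigma> (x + y) \<le> \<sigma> x + \<sigma> y) \<and> (\<forall>x y. \<sigma> (x * y) \<le> \<sigma> x * \<sigma> y) \<and>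
     (\<forall>x. \<sigma> (x\<^sup>2) = (\<sigma> x)\<^sup>2) \<and> (\<forall>q. \<sigma> (of_rat q) = u q)"

lemma extensionsD:
  assumes "w \<in> extensions u"
  shows "absolute_value w" "w (of_rat q) = u q"
  using assms by (auto simp: extensions_def)

section \<open>Spectral seminorms, their twists, and minimal ones\<close>

context
  fixes u :: "rat \<Rightarrow> real" and \<sigma> :: "'k::field_char_0 \<Rightarrow> real"
  assumes u: "absolute_value u" and \<sigma>: "spectral_seminorm u \<sigma>"
begin

lemma spectral_seminorm_nonneg: "0 \<le> \<sigma> x"
  and spectral_seminorm_add: "\<sigma> (x + y) \<le> \<sigma> x + \<sigma> y"
  and spectral_seminorm_mult: "\<sigma> (x * y) \<le> \<sigma> x * \<sigma> y"
  and spectral_seminorm_square: "\<sigma> (x\<^sup>2) = (\<sigma> x)\<^sup>2"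
  and spectral_seminorm_of_rat: "\<sigma> (of_rat q) = u q"
  using \<sigma> by (auto simp: spectral_seminorm_def)

lemma spectral_seminorm_1: "\<sigma> 1 = 1"
  using spectral_seminorm_of_rat[of 1] absolute_value_1[OF u] by simp

lemma spectral_seminorm_0: "\<sigma> 0 = 0"
  using spectral_seminorm_of_rat[of 0] absolute_value_0[OF u] by simp

lemma spectral_seminorm_pos:
  assumes "x \<noteq> 0" shows "0 < \<sigma> x"
proof -
  have "1 \<le> \<sigma> x * \<sigma> (inverse x)"
    using spectral_seminorm_mult[of x "inverse x"] assms spectral_seminorm_1 by simp
  then show ?thesis
    using spectral_seminorm_nonneg[of x] by (cases "\<sigma> x = 0") auto
qed

text \<open>Repeated squaring settles the exponents \<open>2 ^ k\<close>. For general
  \<open>n\<close>, the power \<open>x ^ n\<close> is completed to \<open>x ^ (2 ^ n)\<close>, and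
  submultiplicativity leaves no room for a loss in the factor \<open>x ^ n\<close>.\<close>

lemma spectral_seminorm_power: "\<sigma> (x ^ n) = \<sigma> x ^ n"
proof (cases "x = 0")
  case True
  then show ?thesis
    by (cases n) (auto simp: spectral_seminorm_1 spectral_seminorm_0)
next
  case False
  have le: "\<sigma> (x ^ n) \<le> \<sigma> x ^ n" for n
  proof (induction n)
    case (Suc n)
    have "\<sigma> (x ^ Suc n) \<le> \<sigma> x * \<sigma> (x ^ n)"
      using spectral_seminorm_mult by simp
    also have "\<dots> \<le> \<sigma> x * \<sigma> x ^ n"
      by (intro mult_left_mono Suc spectral_seminorm_nonneg)
    finally show ?case by simp
  qed (simp add: spectral_seminorm_1)
  have two: "\<sigma> (x ^ (2 ^ k)) = \<sigma> x ^ (2 ^ k)" for k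
  proof (induction k)
    case (Suc k)
    have "\<sigma> (x ^ (2 ^ Suc k)) = \<sigma> ((x ^ (2 ^ k))\<^sup>2)"
      by (simp add: mult.commute flip: power_mult)
    also have "\<dots> = \<sigma> x ^ (2 ^ Suc k)"
      unfolding spectral_seminorm_square Suc by (simp add: mult.commute flip: power_mult)
    finally show ?case .
  qed auto
  have n: "n \<le> 2 ^ n" by (simp add: less_imp_le)
  have "\<sigma> x ^ n * \<sigma> x ^ (2 ^ n - n) = \<sigma> (x ^ n * x ^ (2 ^ n - n))"
    using n two[of n] by (simp flip: power_add)
  also have "\<dots> \<le> \<sigma> (x ^ n) * \<sigma> x ^ (2 ^ n - n)"
    using spectral_seminorm_mult[of "x ^ n"] le[of "2 ^ n - n"]
    by (meson mult_left_mono order_trans spectral_seminorm_nonneg)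
  finally have "\<sigma> x ^ n \<le> \<sigma> (x ^ n)"
    using spectral_seminorm_pos[OF False] by simp
  then show ?thesis using le[of n] by simp
qed

text \<open>Submultiplicativity is applied to \<open>q\<close> and to its inverse, whose values
  under \<open>u\<close> are reciprocal.\<close>

lemma spectral_seminorm_scale: "\<sigma> (of_rat q * x) = u q * \<sigma> x"
proof (cases "q = 0")
  case True
  then show ?thesis by (simp add: spectral_seminorm_0 absolute_value_0[OF u])
next
  case False
  have uq: "u q > 0" using absolute_value_pos[OF u False] .
  have "\<sigma> x = \<sigma> (of_rat (inverse q) * (of_rat q * x))"
    using False by (simp add: of_rat_inverse mult.assoc[symmetric])
  also have "\<dots> \<le> u (inverse q) * \<sigma> (of_rat q * x)"
    by (metis spectral_seminorm_mult spectral_seminorm_of_rat)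
  finally have "u q * \<sigma> x \<le> \<sigma> (of_rat q * x)"
    unfolding absolute_value_inverse[OF u] using uq by (simp add: divide_simps mult.commute)
  moreover have "\<sigma> (of_rat q * x) \<le> u q * \<sigma> x"
    by (metis spectral_seminorm_mult spectral_seminorm_of_rat)
  ultimately show ?thesis by simp
qed

text \<open>The classical smoothing of a power-multiplicative seminorm at \<open>y\<close>: the part
  of \<open>\<sigma> z\<close> that survives multiplication by high powers of \<open>y\<close>. It
  makes \<open>y\<close> a multiplicative element (\<open>spectral_twist_mult_self\<close>).\<close>

definition spectral_twist :: "'k \<Rightarrow> 'k \<Rightarrow> real" where
  "spectral_twist y z = (INF n. \<sigma> (z * y ^ n) / \<sigma> y ^ n)"

context
  fixes y :: 'k
  assumes y: "y \<noteq> 0"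
begin

text \<open>Each further factor \<open>y\<close> multiplies the numerator by at most
  \<open>\<sigma> y\<close>, so the quotients decrease and their infimum is a limit; the term for
  \<open>n = 0\<close> is \<open>\<sigma> z\<close>.\<close>

lemma spectral_twist_LIMSEQ: "(\<lambda>n. \<sigma> (z * y ^ n) / \<sigma> y ^ n) \<longlonglongrightarrow> spectral_twist y z"
  and spectral_twist_le: "spectral_twist y z \<le> \<sigma> z"
proof -
  have bdd: "bdd_below (range (\<lambda>n. \<sigma> (z * y ^ n) / \<sigma> y ^ n))"
    by (intro bdd_belowI[of _ 0]) (auto simp: spectral_seminorm_nonneg)
  have "decseq (\<lambda>n. \<sigma> (z * y ^ n) / \<sigma> y ^ n)"
  proof (rule decseq_SucI)
    fix n
    have "\<sigma> (z * y ^ Suc n) \<le> \<sigma> (z * y ^ n) * \<sigma> y"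
      using spectral_seminorm_mult[of "z * y ^ n" y] by (simp add: mult_ac)
    then show "\<sigma> (z * y ^ Suc n) / \<sigma> y ^ Suc n \<le> \<sigma> (z * y ^ n) / \<sigma> y ^ n"
      using spectral_seminorm_pos[OF y] by (simp add: divide_simps mult_ac)
  qed
  with bdd show "(\<lambda>n. \<sigma> (z * y ^ n) / \<sigma> y ^ n) \<longlonglongrightarrow> spectral_twist y z"
    unfolding spectral_twist_def by (intro LIMSEQ_decseq_INF)
  show "spectral_twist y z \<le> \<sigma> z"
    using cINF_lower[OF bdd, of 0] by (simp add: spectral_twist_def)
qed

text \<open>A factor \<open>y\<close> in the argument shifts the defining sequence by one
  index.\<close>

lemma spectral_twist_mult_self: "spectral_twist y (y * z) = \<sigma> y * spectral_twist y z"
proof -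
  have "(\<lambda>n. \<sigma> y * (\<sigma> (z * y ^ Suc n) / \<sigma> y ^ Suc n)) \<longlonglongrightarrow> \<sigma> y * spectral_twist y z"
    by (intro tendsto_mult LIMSEQ_Suc[OF spectral_twist_LIMSEQ] tendsto_const)
  moreover have "\<sigma> y * (\<sigma> (z * y ^ Suc n) / \<sigma> y ^ Suc n) = \<sigma> (y * z * y ^ n) / \<sigma> y ^ n" for n
    using spectral_seminorm_pos[OF y] by (simp add: mult_ac)
  ultimately show ?thesis
    using spectral_twist_LIMSEQ[of "y * z"] LIMSEQ_unique by auto
qed

text \<open>Products lead to even indices: \<open>x * y ^ n\<close> times \<open>z * y ^ n\<close>
  contains \<open>y\<close> to the power \<open>2 * n\<close>.\<close>

lemma spectral_twist_double:
  "(\<lambda>n. \<sigma> (z * y ^ (2 * n)) / \<sigma> y ^ (2 * n)) \<longlonglongrightarrow> spectral_twist y z"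
  using LIMSEQ_subseq_LIMSEQ[OF spectral_twist_LIMSEQ, of "\<lambda>n. 2 * n" z]
  by (simp add: strict_mono_def comp_def)

lemma spectral_seminorm_twist: "spectral_seminorm u (spectral_twist y)"
  unfolding spectral_seminorm_def
proof (intro conjI allI)
  note [simp] = spectral_seminorm_nonneg
  have pos: "0 < \<sigma> y ^ n" for n using spectral_seminorm_pos[OF y] by simp
  fix x z :: 'k and q :: rat
  show "0 \<le> spectral_twist y x"
    by (rule LIMSEQ_le_const[OF spectral_twist_LIMSEQ]) simp
  show "spectral_twist y (x + z) \<le> spectral_twist y x + spectral_twist y z"
  proof (rule LIMSEQ_le[OF spectral_twist_LIMSEQ tendsto_add[OF spectral_twist_LIMSEQ spectral_twist_LIMSEQ]])
    show "\<exists>N. \<forall>n\<ge>N. \<sigma> ((x + z) * y ^ n) / \<sigma> y ^ n \<le> \<sigma> (x * y ^ n) / \<sigma> y ^ n + \<sigma> (z * y ^ n) / \<sigma> y ^ n"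
      using spectral_seminorm_add pos by (simp add: distrib_right divide_right_mono less_imp_le flip: add_divide_distrib)
  qed
  show "spectral_twist y (x * z) \<le> spectral_twist y x * spectral_twist y z"
  proof (rule LIMSEQ_le[OF spectral_twist_double tendsto_mult[OF spectral_twist_LIMSEQ spectral_twist_LIMSEQ]])
    have "\<sigma> (x * z * y ^ (2 * n)) / \<sigma> y ^ (2 * n) \<le> \<sigma> (x * y ^ n) / \<sigma> y ^ n * (\<sigma> (z * y ^ n) / \<sigma> y ^ n)" for n
    proof -
      have "\<sigma> (x * z * y ^ (2 * n)) / \<sigma> y ^ (2 * n) \<le> (\<sigma> (x * y ^ n) * \<sigma> (z * y ^ n)) / \<sigma> y ^ (2 * n)"
      proof (rule divide_right_mono)
        have eq: "x * y ^ n * (z * y ^ n) = x * z * y ^ (2 * n)"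
          by (simp add: mult_2 power_add)
        show "\<sigma> (x * z * y ^ (2 * n)) \<le> \<sigma> (x * y ^ n) * \<sigma> (z * y ^ n)"
          using spectral_seminorm_mult[of "x * y ^ n" "z * y ^ n"] unfolding eq .
      qed (use pos[of "2 * n"] in simp)
      then show ?thesis by (simp add: mult_2 power_add)
    qed
    then show "\<exists>N. \<forall>n\<ge>N. \<sigma> (x * z * y ^ (2 * n)) / \<sigma> y ^ (2 * n) \<le> \<sigma> (x * y ^ n) / \<sigma> y ^ n * (\<sigma> (z * y ^ n) / \<sigma> y ^ n)"
      by blast
  qed
  show "spectral_twist y (x\<^sup>2) = (spectral_twist y x)\<^sup>2"
  proof (rule LIMSEQ_unique[OF spectral_twist_double])
    have "\<sigma> (x\<^sup>2 * y ^ (2 * n)) / \<sigma> y ^ (2 * n) = (\<sigma> (x * y ^ n) / \<sigma> y ^ n)\<^sup>2" for n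
      using spectral_seminorm_square[of "x * y ^ n"]
      by (simp add: power_mult_distrib power_divide mult.commute[of 2 n] power_mult)
    then show "(\<lambda>n. \<sigma> (x\<^sup>2 * y ^ (2 * n)) / \<sigma> y ^ (2 * n)) \<longlonglongrightarrow> (spectral_twist y x)\<^sup>2"
      using tendsto_power[OF spectral_twist_LIMSEQ, of x 2] by simp
  qed
  show "spectral_twist y (of_rat q) = u q"
  proof (rule LIMSEQ_unique[OF spectral_twist_LIMSEQ])
    show "(\<lambda>n. \<sigma> (of_rat q * y ^ n) / \<sigma> y ^ n) \<longlonglongrightarrow> u q"
      using spectral_seminorm_pos[OF y] by (simp add: spectral_seminorm_scale spectral_seminorm_power)
  qed
qed

end

text \<open>Zorn's lemma: the pointwise infimum of a nonempty chain is again a spectral seminorm,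
  and it cannot degenerate because the values at the rationals are fixed.\<close>

lemma spectral_seminorm_minimal:
  "\<exists>w. spectral_seminorm u w \<and> w \<le> \<sigma> \<and> (\<forall>w'. spectral_seminorm u w' \<and> w' \<le> w \<longrightarrow> w' = w)"
proof -
  define A where "A = {w. spectral_seminorm u w \<and> w \<le> \<sigma>}"
  \<comment> \<open>The order is reversed, so that a maximal element for \<open>P\<close> is a
    minimal seminorm.\<close>
  define P where "P = (\<lambda>v w :: 'k \<Rightarrow> real. w \<le> v)"
  have "\<exists>m\<in>A. \<forall>a\<in>A. P m a \<longrightarrow> a = m"
  proof (rule predicate_Zorn)
    show "partial_order_on A (relation_of P A)"
      by (rule partial_order_on_relation_ofI) (auto simp: P_def)
    fix C assume C: "C \<in> Chains (relation_of P A)"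
    show "\<exists>w\<in>A. \<forall>a\<in>C. P a w"
    proof (cases "C = {}")
      case True
      then show ?thesis using \<sigma> by (auto simp: A_def)
    next
      case False
      have CA: "spectral_seminorm u s" "s \<le> \<sigma>" if "s \<in> C" for s
        using C that by (auto simp: Chains_def relation_of_def A_def)
      have chain: "s \<le> t \<or> t \<le> s" if "s \<in> C" "t \<in> C" for s t
        using C that by (auto simp: Chains_def relation_of_def P_def)
      have nn: "0 \<le> s x" if "s \<in> C" for s x
        using CA(1)[OF that] by (simp add: spectral_seminorm_def)
      define w where "w = (\<lambda>x. INF s\<in>C. s x)"
      have bdd: "bdd_below ((\<lambda>s. s x) ` C)" for x
        using nn by (intro bdd_belowI[of _ 0]) auto
      have w_le: "w x \<le> s x" if "s \<in> C" for s x
        unfolding w_def by (rule cINF_lower[OF bdd that])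
      have w_ge: "c \<le> w x" if "\<And>s. s \<in> C \<Longrightarrow> c \<le> s x" for c x
        unfolding w_def using False that by (intro cINF_greatest) auto
      have w0: "0 \<le> w x" for x using nn by (rule w_ge)
      \<comment> \<open>The infima over \<open>s\<close> and \<open>t\<close> are to be taken
        independently; of two members of a chain, the smaller one serves both arguments.\<close>
      have add: "w (x + y) \<le> s x + t y" and mult: "w (x * y) \<le> s x * t y"
        if st: "s \<in> C" "t \<in> C" for s t x y
      proof -
        obtain r where r: "r \<in> C" "r x \<le> s x" "r y \<le> t y"
          using chain[OF st] st by (auto simp: le_fun_def)
        have "w (x + y) \<le> r (x + y)" "w (x * y) \<le> r (x * y)" using w_le r by auto
        moreover have "r (x + y) \<le> r x + r y" "r (x * y) \<le> r x * r y"
          using CA(1)[OF r(1)] by (auto simp: spectral_seminorm_def)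
        moreover have "r x * r y \<le> s x * t y"
          using r nn st by (intro mult_mono) auto
        ultimately show "w (x + y) \<le> s x + t y" "w (x * y) \<le> s x * t y"
          using r by linarith+
      qed
      have "spectral_seminorm u w"
        unfolding spectral_seminorm_def
      proof (intro conjI allI)
        fix x y :: 'k and q :: rat
        show "0 \<le> w x" by (rule w0)
        have "w (x + y) - s x \<le> w y" if "s \<in> C" for s
          using add[OF that] by (intro w_ge) (simp add: algebra_simps)
        then have "w (x + y) - w y \<le> w x"
          by (intro w_ge) (simp add: algebra_simps)
        then show "w (x + y) \<le> w x + w y" by simp
        have *: "w (x * y) \<le> s x * w y" if s: "s \<in> C" for s
        proof (cases "s x = 0")
          case True
          then show ?thesis using mult[OF s s, of x y] by simp
        next
          case False
          then have "s x > 0" using nn[OF s, of x] by simp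
          then have "w (x * y) / s x \<le> w y"
            using mult[OF s] by (intro w_ge) (simp add: field_simps)
          then show ?thesis using \<open>s x > 0\<close> by (simp add: field_simps)
        qed
        show "w (x * y) \<le> w x * w y"
        proof (cases "w y = 0")
          case True
          then show ?thesis using * False by fastforce
        next
          case False
          then have "w y > 0" using w0[of y] by simp
          then have "w (x * y) / w y \<le> w x"
            using * by (intro w_ge) (simp add: field_simps)
          then show ?thesis using \<open>w y > 0\<close> by (simp add: field_simps)
        qed
        show "w (x\<^sup>2) = (w x)\<^sup>2"
        proof (rule antisym)
          have sq: "s (x\<^sup>2) = (s x)\<^sup>2" if "s \<in> C" for s
            using CA(1)[OF that] by (simp add: spectral_seminorm_def)
          \<comment> \<open>The square root reduces the claim to a lower bound for the values
            \<open>s x\<close> themselves.\<close>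
          have "sqrt (w (x\<^sup>2)) \<le> w x"
          proof (rule w_ge)
            fix s assume s: "s \<in> C"
            show "sqrt (w (x\<^sup>2)) \<le> s x"
              using w_le[OF s, of "x\<^sup>2"] sq[OF s] nn[OF s] by (intro real_le_lsqrt) auto
          qed
          then show "w (x\<^sup>2) \<le> (w x)\<^sup>2" by (simp add: sqrt_le_D)
          show "(w x)\<^sup>2 \<le> w (x\<^sup>2)"
            using w_le w0 by (intro w_ge) (simp add: sq power_mono)
        qed
        have "s (of_rat q) = u q" if "s \<in> C" for s
          using CA(1)[OF that] by (simp add: spectral_seminorm_def)
        then have "(\<lambda>s. s (of_rat q)) ` C = {u q}" using False by auto
        then show "w (of_rat q) = u q" by (simp add: w_def)
      qed
      moreover have "w \<le> \<sigma>" using False w_le CA(2) by (meson all_not_in_conv le_funI le_funD order_trans)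
      ultimately show ?thesis using w_le by (auto simp: A_def P_def le_fun_def)
    qed
  qed
  then show ?thesis unfolding A_def P_def by (metis (no_types, lifting) mem_Collect_eq order_trans)
qed

end

text \<open>A minimal spectral seminorm equals all its twists, hence is multiplicative. Passing first to
  the twist by \<open>x\<close> keeps the value at \<open>x\<close>, since that twist is multiplicative at \<open>x\<close>.\<close>

theorem spectral_seminorm_attained:
  fixes x :: "'k::field_char_0"
  assumes u: "absolute_value u" and \<sigma>: "spectral_seminorm u \<sigma>" and x: "x \<noteq> 0"
  shows "\<exists>w\<in>extensions u. w x = \<sigma> x"
proof -
  define \<tau> where "\<tau> = spectral_twist \<sigma> x"
  have \<tau>: "spectral_seminorm u \<tau>"
    unfolding \<tau>_def by (rule spectral_seminorm_twist[OF u \<sigma> x])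
  obtain w where w: "spectral_seminorm u w" "w \<le> \<tau>"
      and min: "\<And>w'. spectral_seminorm u w' \<Longrightarrow> w' \<le> w \<Longrightarrow> w' = w"
    using spectral_seminorm_minimal[OF u \<tau>] by blast
  have mult: "w (y * z) = w y * w z" for y z
  proof (cases "y = 0")
    case False
    have "spectral_twist w y = w"
      using spectral_seminorm_twist[OF u w(1) False] spectral_twist_le[OF u w(1) False]
      by (intro min) (auto simp: le_fun_def)
    then show ?thesis using spectral_twist_mult_self[OF u w(1) False, of z] by simp
  qed (simp add: spectral_seminorm_0[OF u w(1)])
  have "absolute_value w"
    unfolding absolute_value_def
    using spectral_seminorm_nonneg[OF u w(1)] spectral_seminorm_add[OF u w(1)] mult
      spectral_seminorm_0[OF u w(1)] spectral_seminorm_pos[OF u w(1)] by (metis less_irrefl)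
  then have ext: "w \<in> extensions u"
    using spectral_seminorm_of_rat[OF u w(1)] by (simp add: extensions_def)
  have pos: "\<sigma> x > 0" by (rule spectral_seminorm_pos[OF u \<sigma> x])
  \<comment> \<open>As \<open>w\<close> is multiplicative, an upper bound for it at
    \<open>inverse x\<close> is a lower bound at \<open>x\<close>.\<close>
  have "\<sigma> x * \<tau> (inverse x) = 1"
    using spectral_twist_mult_self[OF u \<sigma> x, of "inverse x"] x spectral_seminorm_1[OF u \<tau>]
    by (simp add: \<tau>_def)
  then have "\<sigma> x * w (inverse x) \<le> 1"
    using w(2) pos by (metis le_fun_def mult_le_cancel_left_pos)
  then have "\<sigma> x / w x \<le> 1"
    unfolding absolute_value_inverse[OF \<open>absolute_value w\<close>] by (simp add: divide_inverse)
  moreover have "w x > 0" using absolute_value_pos[OF \<open>absolute_value w\<close> x] .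
  ultimately have "\<sigma> x \<le> w x" by (simp add: divide_le_eq)
  moreover have "w x \<le> \<sigma> x"
    using w(2) spectral_twist_le[OF u \<sigma> x, of x] by (auto simp: le_fun_def \<tau>_def intro: order_trans)
  ultimately show ?thesis using ext by (intro bexI[of _ w]) auto
qed

section \<open>Weak approximation\<close>

locale nontrivial_absolute_value =
  fixes u :: "rat \<Rightarrow> real"
  assumes u: "absolute_value u" and nontrivial: "\<exists>q. q \<noteq> 0 \<and> u q < 1"
begin

text \<open>If \<open>w z < w' z\<close>, then a product of powers of \<open>z\<close> and of a
  rational \<open>q\<close> lies on different sides of 1 for \<open>w\<close> and \<open>w'\<close>,
  against the hypothesis. Agreement at \<open>q\<close> pins down the exponent, which a comparison
  of unit balls alone leaves open.\<close>

lemma extensions_le: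
  fixes w w' :: "'k::field_char_0 \<Rightarrow> real"
  assumes w: "w \<in> extensions u" "w' \<in> extensions u" and less: "\<And>z. w z < 1 \<Longrightarrow> w' z < 1"
  shows "w' z \<le> w z"
proof (rule ccontr)
  note av = extensionsD(1)[OF w(1)] extensionsD(1)[OF w(2)]
  assume "\<not> w' z \<le> w z"
  then have lt: "w z < w' z" by simp
  obtain q where q: "q \<noteq> 0" "u q < 1" using nontrivial by blast
  have uq: "0 < u q" using absolute_value_pos[OF u q(1)] .
  have z: "z \<noteq> 0" using lt absolute_value_0[OF av(1)] absolute_value_0[OF av(2)] by auto
  have pos: "0 < w z" "0 < w' z" using absolute_value_pos[OF av(1) z] absolute_value_pos[OF av(2) z] by auto
  \<comment> \<open>The element \<open>y\<close> below has logarithm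
    \<open>n * ln (v z) - m * c\<close>; a rational \<open>m / n\<close> strictly between
    \<open>a / c\<close> and \<open>b / c\<close> makes this negative for \<open>w\<close> and
    positive for \<open>w'\<close>.\<close>
  define a b c where "a = ln (w z)" and "b = ln (w' z)" and "c = - ln (u q)"
  have c: "c > 0" using q uq by (simp add: c_def)
  have "a / c < b / c" using lt pos c by (simp add: a_def b_def divide_strict_right_mono)
  then obtain r where r: "a / c < of_rat r" "of_rat r < b / c" using of_rat_dense by blast
  obtain m n where mn: "r = of_int m / of_int n" "n > 0"
    by (metis Fract_of_int_quotient Rat_cases)
  have "of_rat r = real_of_int m / real_of_int n" using mn by (simp add: of_rat_divide)
  then have less1: "real_of_int n * a + real_of_int (- m) * c < 0" and gr: "0 < real_of_int n * b + real_of_int (- m) * c"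
    using r c mn(2) by (simp_all add: pos_divide_less_eq pos_less_divide_eq) (simp_all add: mult.commute)
  define y where "y = z powi n * of_rat (q powi m)"
  have val: "v y = exp (real_of_int n * ln (v z) + real_of_int (- m) * c)"
    if v: "v \<in> extensions u" "v z > 0" for v
  proof -

    have "v y = v z powi n * u q powi m"
      unfolding y_def absolute_value_mult[OF extensionsD(1)[OF v(1)]] extensionsD(2)[OF v(1)]
        absolute_value_power_int[OF extensionsD(1)[OF v(1)]] absolute_value_power_int[OF u] ..
    also have "\<dots> = exp (real_of_int n * ln (v z)) * exp (real_of_int m * ln (u q))"
    proof -
      have "t powi k = exp (real_of_int k * ln t)" if "t > 0" for t k
        using powr_real_of_int'[of t k] that by (simp add: powr_def)
      then show ?thesis using v(2) uq by simp
    qed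
    finally show ?thesis by (simp add: c_def exp_add)
  qed
  have "w y < 1" using val[OF w(1) pos(1)] less1 by (simp add: a_def)
  moreover have "w' y > 1" using val[OF w(2) pos(2)] gr by (simp add: b_def)
  ultimately show False using less[of y] by simp
qed

text \<open>Otherwise \<open>extensions_le\<close> gives \<open>w' \<le> w\<close>, and the same
  inequality at inverses gives \<open>w \<le> w'\<close>.\<close>

lemma extensions_separate:
  fixes w w' :: "'k::field_char_0 \<Rightarrow> real"
  assumes w: "w \<in> extensions u" "w' \<in> extensions u" and neq: "w \<noteq> w'"
  shows "\<exists>z. w z < 1 \<and> 1 \<le> w' z"
proof (rule ccontr)
  assume "\<not> ?thesis"
  then have le: "w' z \<le> w z" for z
    using extensions_le[OF w] by force
  have "w z \<le> w' z" for z
  proof (cases "z = 0")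
    case True
    then show ?thesis using absolute_value_0 extensionsD(1) w by (metis order_refl)
  next
    case False
    note av = extensionsD(1)[OF w(1)] extensionsD(1)[OF w(2)]
    show ?thesis
      using le[of "inverse z"] absolute_value_pos[OF av(1) False] absolute_value_pos[OF av(2) False]
      by (simp add: absolute_value_inverse[OF av(1)] absolute_value_inverse[OF av(2)])
  qed
  then have "w = w'" using le by (intro ext antisym)
  then show False using neq by simp
qed

text \<open>The quotient of two elements that separate in opposite directions.\<close>

lemma extensions_separate_gt_lt:
  fixes w w' :: "'k::field_char_0 \<Rightarrow> real"
  assumes w: "w \<in> extensions u" "w' \<in> extensions u" and neq: "w \<noteq> w'"
  shows "\<exists>z. 1 < w z \<and> w' z < 1"
proof -
  obtain a b where ab: "w a < 1" "1 \<le> w' a" "w' b < 1" "1 \<le> w b"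
    using extensions_separate[OF w neq] extensions_separate[OF w(2,1) neq[symmetric]] by blast
  note av = extensionsD(1)[OF w(1)] extensionsD(1)[OF w(2)]
  have "a \<noteq> 0" using ab(2) absolute_value_0[OF av(2)] by auto
  then have "0 < w a" "0 < w' a" using absolute_value_pos av by auto
  then have "1 < w (b / a)" "w' (b / a) < 1"
    using ab by (auto simp: absolute_value_divide[OF av(1)] absolute_value_divide[OF av(2)] field_simps)
  then show ?thesis by blast
qed

text \<open>\<open>z ^ r / (1 + z ^ r)\<close> is an approximate idempotent: it tends to 1 where
  \<open>z\<close> is large and to 0 where \<open>z\<close> is small.\<close>

lemma LIMSEQ_absolute_value_power_quotient:
  fixes w :: "'k::field_char_0 \<Rightarrow> real"
  assumes w: "absolute_value w"
  shows "1 < w z \<Longrightarrow> (\<lambda>r. w (z ^ r / (1 + z ^ r) - 1)) \<longlonglongrightarrow> 0"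
    and "w z < 1 \<Longrightarrow> (\<lambda>r. w (z ^ r / (1 + z ^ r))) \<longlonglongrightarrow> 0"
proof -
  assume z: "1 < w z"
  have lim: "(\<lambda>r. inverse (w z ^ r - 1)) \<longlonglongrightarrow> 0"
  proof -
    note lim0 = LIMSEQ_inverse_realpow_zero[OF z]
    have "(\<lambda>r. inverse (w z ^ r) / (1 - inverse (w z ^ r))) \<longlonglongrightarrow> 0"
      using tendsto_divide[OF lim0 tendsto_diff[OF tendsto_const[of 1] lim0]] by simp
    moreover have "inverse (w z ^ r) / (1 - inverse (w z ^ r)) = inverse (w z ^ r - 1)" for r
    proof -
      have "w z ^ r \<noteq> 0" using z by simp
      then have "1 - inverse (w z ^ r) = (w z ^ r - 1) / w z ^ r" by (simp add: field_simps)
      then show ?thesis using \<open>w z ^ r \<noteq> 0\<close> by (simp add: divide_simps)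
    qed
    ultimately show ?thesis by simp
  qed
  show "(\<lambda>r. w (z ^ r / (1 + z ^ r) - 1)) \<longlonglongrightarrow> 0"
  proof (rule tendsto_sandwich[OF _ _ tendsto_const lim])
    show "\<forall>\<^sub>F r in sequentially. w (z ^ r / (1 + z ^ r) - 1) \<le> inverse (w z ^ r - 1)"
    proof (rule eventually_sequentiallyI[of 1])
      fix r :: nat assume "1 \<le> r"
      then have gt: "1 < w z ^ r" using z by (simp add: one_less_power)
      have ge: "w z ^ r - 1 \<le> w (1 + z ^ r)"
        using absolute_value_diff_ge[OF w, of "z ^ r" 1]
        by (simp add: absolute_value_power[OF w] absolute_value_1[OF w] add.commute)
      then have "1 + z ^ r \<noteq> 0" using gt absolute_value_0[OF w] by force
      then have "z ^ r / (1 + z ^ r) - 1 = - inverse (1 + z ^ r)"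
        by (simp add: field_simps)
      then have "w (z ^ r / (1 + z ^ r) - 1) = inverse (w (1 + z ^ r))"
        by (simp add: absolute_value_minus[OF w] absolute_value_inverse[OF w])
      also have "\<dots> \<le> inverse (w z ^ r - 1)" using ge gt by (intro le_imp_inverse_le) auto
      finally show "w (z ^ r / (1 + z ^ r) - 1) \<le> inverse (w z ^ r - 1)" .
    qed
  qed (simp add: absolute_value_nonneg[OF w])
next
  assume z: "w z < 1"
  have lim0: "(\<lambda>r. w z ^ r) \<longlonglongrightarrow> 0"
    using z absolute_value_nonneg[OF w] by (intro LIMSEQ_realpow_zero) auto
  then have lim: "(\<lambda>r. w z ^ r / (1 - w z ^ r)) \<longlonglongrightarrow> 0"
    using tendsto_divide[OF lim0 tendsto_diff[OF tendsto_const[of 1] lim0]] by simp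
  show "(\<lambda>r. w (z ^ r / (1 + z ^ r))) \<longlonglongrightarrow> 0"
  proof (rule tendsto_sandwich[OF _ _ tendsto_const lim])
    show "\<forall>\<^sub>F r in sequentially. w (z ^ r / (1 + z ^ r)) \<le> w z ^ r / (1 - w z ^ r)"
    proof (rule eventually_sequentiallyI[of 1])
      fix r :: nat assume "1 \<le> r"
      then have "w z ^ r < 1" using z absolute_value_nonneg[OF w] by (simp add: power_less_one_iff)
      moreover have "1 - w z ^ r \<le> w (1 + z ^ r)"
        using absolute_value_diff_ge[OF w, of 1 "z ^ r"]
        by (simp add: absolute_value_power[OF w] absolute_value_1[OF w])
      ultimately show "w (z ^ r / (1 + z ^ r)) \<le> w z ^ r / (1 - w z ^ r)"
        unfolding absolute_value_divide[OF w] absolute_value_power[OF w]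
        by (intro divide_left_mono) (auto simp: absolute_value_nonneg[OF w])
    qed
  qed (simp add: absolute_value_nonneg[OF w])
qed

text \<open>Induction on the set: \<open>z\<close> treats the old places and \<open>y\<close> the
  new one, and they are combined through a power of \<open>z\<close> or an approximate idempotent
  made from it.\<close>

lemma extensions_separate_finite:
  fixes w :: "'k::field_char_0 \<Rightarrow> real"
  assumes "finite S" "S \<subseteq> extensions u" "w \<in> extensions u" "w \<notin> S"
  shows "\<exists>z. 1 < w z \<and> (\<forall>v\<in>S. v z < 1)"
  using assms
proof (induction S)
  case empty
  obtain q where "q \<noteq> 0" "u q < 1" using nontrivial by blast
  then have "1 < u (inverse q)"
    using absolute_value_pos[OF u] by (simp add: absolute_value_inverse[OF u] one_less_inverse_iff)
  then have "1 < w (of_rat (inverse q))" using empty extensionsD(2)[of w] by metis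
  then show ?case by auto
next
  case (insert w' S)
  then obtain z where z: "1 < w z" "\<And>v. v \<in> S \<Longrightarrow> v z < 1" by auto
  obtain y where y: "1 < w y" "w' y < 1"
    using extensions_separate_gt_lt[of w w'] insert by auto
  have w: "absolute_value w" using insert extensionsD by blast
  have w': "absolute_value w'" using insert extensionsD by blast
  have av: "absolute_value v" if "v \<in> S" for v using insert that extensionsD by blast
  have ynz: "y \<noteq> 0" using y absolute_value_0[OF w] by auto
  show ?case
  proof (cases "w' z \<le> 1")
    case True
    \<comment> \<open>A high power of \<open>z\<close> outweighs \<open>y\<close> on
      \<open>S\<close> and does no harm at \<open>w'\<close>. This includes \<open>w' z = 1\<close>,
      where neither limit of the approximate idempotents is available.\<close>
    have "(\<lambda>r. v (z ^ r * y)) \<longlonglongrightarrow> 0" if "v \<in> S" for v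
      unfolding absolute_value_mult[OF av[OF that]] absolute_value_power[OF av[OF that]]
      using z(2)[OF that] absolute_value_nonneg[OF av[OF that]]
      by (intro tendsto_mult_left_zero LIMSEQ_realpow_zero) auto
    then have "\<forall>v\<in>S. \<forall>\<^sub>F r in sequentially. v (z ^ r * y) < 1"
      by (intro ballI order_tendstoD(2)) auto
    then have "\<forall>\<^sub>F r in sequentially. \<forall>v\<in>S. v (z ^ r * y) < 1"
      using insert(1) by (simp add: eventually_ball_finite)
    then obtain r where r: "\<forall>v\<in>S. v (z ^ r * y) < 1" by (auto simp: eventually_sequentially)
    have "w (z ^ r * y) > 1"
      unfolding absolute_value_mult[OF w] absolute_value_power[OF w]
      using mult_right_mono[of 1 "w z ^ r" "w y"] z(1) y(1) one_le_power[of "w z" r] by linarith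
    moreover have "w' (z ^ r * y) < 1"
    proof -
      have "w' z ^ r * w' y \<le> 1 * w' y"
        using True absolute_value_nonneg[OF w'] by (intro mult_right_mono power_le_one) auto
      then show ?thesis using y(2) by (simp add: absolute_value_mult[OF w'] absolute_value_power[OF w'])
    qed
    ultimately show ?thesis using r by auto
  next
    case False
    \<comment> \<open>\<open>z\<close> is large at \<open>w\<close> and at \<open>w'\<close>, so
      \<open>e r * y\<close> inherits there the sizes of \<open>y\<close>, while on \<open>S\<close>
      it tends to 0.\<close>
    define e where "e = (\<lambda>r. z ^ r / (1 + z ^ r))"
    have near1: "(\<lambda>r. v (e r * y)) \<longlonglongrightarrow> v y" if v: "absolute_value v" "1 < v z" for v
    proof -
      have "(\<lambda>r. v (e r - 1) * v y) \<longlonglongrightarrow> 0"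
        using LIMSEQ_absolute_value_power_quotient(1)[OF v] unfolding e_def by (rule tendsto_mult_left_zero)
      then have "(\<lambda>r. v (e r * y) - v y) \<longlonglongrightarrow> 0"
      proof (rule Lim_null_comparison[rotated])
        have "\<bar>v (e r * y) - v y\<bar> \<le> v (e r - 1) * v y" for r
        proof -
          have eq: "(e r - 1) * y = e r * y - y" by (simp add: algebra_simps)
          have "v (e r * y) \<le> v (e r * y - y) + v y" "v y \<le> v (e r * y - y) + v (e r * y)"
            using absolute_value_triangle[OF v(1), of "e r * y - y" y]
             absolute_value_triangle[OF v(1), of "y - e r * y" "e r * y"]
            by (auto simp: absolute_value_minus_commute[OF v(1), of y])
          then show ?thesis unfolding absolute_value_mult[OF v(1), symmetric] eq by linarith
        qed
        then show "\<forall>\<^sub>F r in sequentially. norm (v (e r * y) - v y) \<le> v (e r - 1) * v y"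
          by simp
      qed
      then show ?thesis by (simp add: LIM_zero_iff)
    qed
    have "(\<lambda>r. v (e r * y)) \<longlonglongrightarrow> 0" if "v \<in> S" for v
      unfolding absolute_value_mult[OF av[OF that]] e_def
      using LIMSEQ_absolute_value_power_quotient(2)[OF av[OF that] z(2)[OF that]]
      by (rule tendsto_mult_left_zero)
    then have "\<forall>v\<in>S. \<forall>\<^sub>F r in sequentially. v (e r * y) < 1"
      by (intro ballI order_tendstoD(2)) auto
    then have "\<forall>\<^sub>F r in sequentially. \<forall>v\<in>S. v (e r * y) < 1"
      using insert(1) by (simp add: eventually_ball_finite)
    moreover have "\<forall>\<^sub>F r in sequentially. 1 < w (e r * y)"
      using near1[OF w z(1)] y(1) by (rule order_tendstoD)
    moreover have "\<forall>\<^sub>F r in sequentially. w' (e r * y) < 1"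
      using near1[OF w'] False y(2) by (intro order_tendstoD) auto
    ultimately have "\<forall>\<^sub>F r in sequentially. (\<forall>v\<in>S. v (e r * y) < 1) \<and> 1 < w (e r * y) \<and> w' (e r * y) < 1"
      by eventually_elim auto
    then show ?thesis by (auto simp: eventually_sequentially)
  qed
qed

text \<open>An approximate idempotent times \<open>y\<close>. A nonzero target is prescribed at one
  place only, since the gluing treats each vector of each local basis separately.\<close>

theorem weak_approximation:
  fixes w :: "'k::field_char_0 \<Rightarrow> real"
  assumes S: "finite S" "S \<subseteq> extensions u" and w: "w \<in> S" and \<epsilon>: "\<epsilon> > 0"
  shows "\<exists>e. w (e - y) < \<epsilon> \<and> (\<forall>v\<in>S - {w}. v e < \<epsilon>)"
proof -
  obtain z where z: "1 < w z" "\<And>v. v \<in> S - {w} \<Longrightarrow> v z < 1"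
    using extensions_separate_finite[of "S - {w}" w] S w by auto
  define e where "e = (\<lambda>r. z ^ r / (1 + z ^ r))"
  have av: "absolute_value v" if "v \<in> S" for v using S that extensionsD by blast
  have "(\<lambda>r. w ((e r - 1) * y)) \<longlonglongrightarrow> 0"
    unfolding absolute_value_mult[OF av[OF w]] e_def
    using LIMSEQ_absolute_value_power_quotient(1)[OF av[OF w] z(1)] by (rule tendsto_mult_left_zero)
  then have 1: "\<forall>\<^sub>F r in sequentially. w ((e r - 1) * y) < \<epsilon>"
    using \<epsilon> by (rule order_tendstoD)
  have "(\<lambda>r. v (e r * y)) \<longlonglongrightarrow> 0" if "v \<in> S - {w}" for v
  proof -
    have v: "absolute_value v" using that av by auto
    show ?thesis
      unfolding absolute_value_mult[OF v] e_def
      using LIMSEQ_absolute_value_power_quotient(2)[OF v z(2)[OF that]] by (rule tendsto_mult_left_zero)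
  qed
  then have "\<forall>v\<in>S - {w}. \<forall>\<^sub>F r in sequentially. v (e r * y) < \<epsilon>"
    using \<epsilon> by (intro ballI order_tendstoD(2)) auto
  then have "\<forall>\<^sub>F r in sequentially. \<forall>v\<in>S - {w}. v (e r * y) < \<epsilon>"
    using S(1) by (simp add: eventually_ball_finite)
  with 1 have "\<forall>\<^sub>F r in sequentially. w ((e r - 1) * y) < \<epsilon> \<and> (\<forall>v\<in>S - {w}. v (e r * y) < \<epsilon>)"
    by eventually_elim auto
  then obtain r where "w ((e r - 1) * y) < \<epsilon> \<and> (\<forall>v\<in>S - {w}. v (e r * y) < \<epsilon>)"
    by (auto simp: eventually_sequentially)
  then show ?thesis by (intro exI[of _ "e r * y"]) (simp add: algebra_simps)
qed

end

section \<open>Number fields as rational vector spaces\<close>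

interpretation rat: vector_space "rat_scale :: rat \<Rightarrow> 'k::field_char_0 \<Rightarrow> 'k"
  by unfold_locales (auto simp: rat_scale_def algebra_simps of_rat_add of_rat_mult)

text \<open>Families instead of sets: a repetition counts as a dependence, and the indices serve as
  matrix indices.\<close>

definition rat_independent :: "nat \<Rightarrow> (nat \<Rightarrow> 'k::field_char_0) \<Rightarrow> bool" where
  "rat_independent n e \<longleftrightarrow> (\<forall>c. (\<Sum>i<n. of_rat (c i) * e i) = 0 \<longrightarrow> (\<forall>i<n. c i = 0))"

lemma rat_independentD:
  assumes "rat_independent n e" "(\<Sum>i<n. of_rat (c i) * e i) = 0" "i < n"
  shows "c i = 0"
  using assms by (auto simp: rat_independent_def)

lemma rat_independent_inj_on:
  assumes e: "rat_independent n e" shows "inj_on e {..<n}"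
proof (rule inj_onI, rule ccontr)
  fix i j assume ij: "i \<in> {..<n}" "j \<in> {..<n}" "e i = e j" "i \<noteq> j"
  define c :: "nat \<Rightarrow> rat" where "c = (\<lambda>k. if k = i then 1 else if k = j then -1 else 0)"
  have "(\<Sum>k<n. of_rat (c k) * e k) = (\<Sum>k\<in>{i, j}. of_rat (c k) * e k)"
    using ij by (intro sum.mono_neutral_right) (auto simp: c_def)
  also have "\<dots> = 0" using ij by (simp add: c_def of_rat_minus)
  finally have "c i = 0" using rat_independentD[OF e] ij by blast
  then show False by (simp add: c_def)
qed

lemma rat_independent_imp_independent:
  assumes e: "rat_independent n e" shows "rat.independent (e ` {..<n})"
proof (rule rat.independent_if_scalars_zero)
  fix f x assume f: "(\<Sum>x\<in>e ` {..<n}. rat_scale (f x) x) = 0" and x: "x \<in> e ` {..<n}"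
  then have "(\<Sum>i<n. of_rat (f (e i)) * e i) = 0"
    by (simp add: sum.reindex[OF rat_independent_inj_on[OF e]] rat_scale_def)
  then show "f x = 0" using rat_independentD[OF e, of "\<lambda>i. f (e i)"] x by auto
qed simp

text \<open>Nothing is assumed about \<open>b i\<close> and \<open>crd i x\<close> for \<open>i \<ge> D\<close>.\<close>

locale rat_basis =
  fixes D :: nat and b :: "nat \<Rightarrow> 'k::field_char_0" and crd :: "nat \<Rightarrow> 'k \<Rightarrow> rat"
  assumes expand: "x = (\<Sum>i<D. of_rat (crd i x) * b i)"
    and crd_combination: "i < D \<Longrightarrow> crd i (\<Sum>j<D. of_rat (c j) * b j) = c i"

lemma rat_basisI:
  fixes e :: "nat \<Rightarrow> 'k::field_char_0"
  assumes e: "rat_independent n e" and span: "\<And>x. \<exists>c. x = (\<Sum>i<n. of_rat (c i) * e i)"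
  shows "\<exists>crd. rat_basis n e crd"
proof -
  obtain g where g: "\<And>x. x = (\<Sum>i<n. of_rat (g x i) * e i)" using span by metis
  have "rat_basis n e (\<lambda>i x. g x i)"
  proof
    fix i c assume i: "i < n"
    define x where "x = (\<Sum>j<n. of_rat (c j) * e j)"
    have "(\<Sum>j<n. of_rat (g x j - c j) * e j) = (\<Sum>j<n. of_rat (g x j) * e j) - (\<Sum>j<n. of_rat (c j) * e j)"
      by (simp add: of_rat_diff algebra_simps sum_subtractf)
    also have "\<dots> = 0" using g[of x] by (simp add: x_def)
    finally have "g x i - c i = 0" by (rule rat_independentD[OF e _ i])
    then show "g (\<Sum>j<n. of_rat (c j) * e j) i = c i" by (simp add: x_def)
  qed (rule g)
  then show ?thesis by blast
qed

context rat_basis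
begin

lemma combination_crd: "(\<Sum>i<D. of_rat (crd i x) * b i) = x"
  by (rule expand[symmetric])

lemma basis_rat_independent: "rat_independent D b"
  unfolding rat_independent_def
proof (intro allI impI)
  fix c i assume c: "(\<Sum>i<D. of_rat (c i) * b i) = 0" and i: "i < D"
  show "c i = 0" using crd_combination[OF i, of c] crd_combination[OF i, of "\<lambda>_. 0"] c by simp
qed

lemma crd_add: "i < D \<Longrightarrow> crd i (x + y) = crd i x + crd i y"
  using crd_combination[of i "\<lambda>j. crd j x + crd j y"]
  by (simp add: of_rat_add distrib_right sum.distrib combination_crd)

lemma crd_scale: "i < D \<Longrightarrow> crd i (of_rat q * x) = q * crd i x"
  using crd_combination[of i "\<lambda>j. q * crd j x"]
  by (simp add: of_rat_mult mult.assoc combination_crd flip: sum_distrib_left)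

lemma crd_0: "i < D \<Longrightarrow> crd i 0 = 0"
  using crd_combination[of i "\<lambda>_. 0"] by simp

lemma crd_sum: "i < D \<Longrightarrow> crd i (\<Sum>j\<in>A. f j) = (\<Sum>j\<in>A. crd i (f j))"
  by (induction A rule: infinite_finite_induct) (auto simp: crd_0 crd_add)

lemma crd_basis: "i < D \<Longrightarrow> j < D \<Longrightarrow> crd i (b j) = (if i = j then 1 else 0)"
  using crd_combination[of i "\<lambda>k. if k = j then 1 else 0"]
  by (simp add: if_distrib[of of_rat] if_distrib[of "\<lambda>r. r * _"] cong: if_cong)

lemma crd_mult: "i < D \<Longrightarrow> crd i (x * z) = (\<Sum>k<D. crd k z * crd i (x * b k))"
proof -
  assume i: "i < D"
  have "x * z = (\<Sum>k<D. of_rat (crd k z) * (x * b k))"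
    using arg_cong[OF expand[of z], of "(*) x"] by (simp add: sum_distrib_left mult_ac)
  then show ?thesis using i by (simp add: crd_sum crd_scale)
qed

lemma span_basis: "rat.span (b ` {..<D}) = UNIV"
proof -
  have "x \<in> rat.span (b ` {..<D})" for x
  proof (subst expand[of x], rule rat.span_sum)
    fix i assume "i \<in> {..<D}"
    then have "rat_scale (crd i x) (b i) \<in> rat.span (b ` {..<D})"
      by (intro rat.span_scale rat.span_base) simp
    then show "of_rat (crd i x) * b i \<in> rat.span (b ` {..<D})" by (simp add: rat_scale_def)
  qed
  then show ?thesis by auto
qed

lemma dimension_eq: "D = field_degree TYPE('k)"
proof -
  have "rat.dim (UNIV :: 'k set) = card (b ` {..<D})"
    by (intro rat.dim_eq_card rat_independent_imp_independent basis_rat_independent) (simp add: span_basis)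
  then show ?thesis
    by (simp add: field_degree_def card_image[OF rat_independent_inj_on[OF basis_rat_independent]])
qed

lemma dimension_pos: "D > 0"
proof (rule ccontr)
  assume "\<not> D > 0"
  then show False using combination_crd[of 1] by simp
qed

lemma rat_independent_le:
  fixes e :: "nat \<Rightarrow> 'k"
  assumes e: "rat_independent m e" shows "m \<le> D"
proof -
  have "card (e ` {..<m}) \<le> card (b ` {..<D})"
    using rat.independent_span_bound[OF _ rat_independent_imp_independent[OF e], of "b ` {..<D}"]
    by (simp add: span_basis)
  also have "\<dots> \<le> D" using card_image_le[of "{..<D}" b] by simp
  finally show ?thesis by (simp add: card_image[OF rat_independent_inj_on[OF e]])
qed

end

lemma rat_basis_exists:
  assumes "number_field TYPE('k::field_char_0)"
  shows "\<exists>b crd. rat_basis (field_degree TYPE('k)) (b :: nat \<Rightarrow> 'k) crd"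
proof -
  obtain B0 :: "'k set" where B0: "finite B0" "rat.span B0 = UNIV"
    using assms by (auto simp: number_field_def)
  obtain B where B: "B \<subseteq> B0" "rat.independent B" "B0 \<subseteq> rat.span B"
    using rat.maximal_independent_subset by blast
  have fin: "finite B" using B B0 finite_subset by blast
  have span: "rat.span B = UNIV"
    using B(3) B0(2) by (metis rat.span_mono rat.span_span top.extremum_uniqueI)
  obtain e where e: "bij_betw e {..<card B} B"
    using ex_bij_betw_nat_finite[OF fin] by (auto simp: atLeast0LessThan)
  have sum: "(\<Sum>i<card B. of_rat (c (e i)) * e i) = (\<Sum>v\<in>B. rat_scale (c v) v)" for c
    unfolding rat_scale_def by (rule sum.reindex_bij_betw[OF e])
  have "rat_independent (card B) e"
    unfolding rat_independent_def
  proof (intro allI impI)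
    fix c i assume c: "(\<Sum>i<card B. of_rat (c i) * e i) = 0" and i: "i < card B"
    define c' where "c' = (\<lambda>v. c (inv_into {..<card B} e v))"
    have c': "c' (e j) = c j" if "j < card B" for j
      using bij_betw_imp_inj_on[OF e] that by (simp add: c'_def)
    have "(\<Sum>v\<in>B. rat_scale (c' v) v) = 0"
      unfolding sum[symmetric] using c by (simp add: c')
    then have "c' (e i) = 0"
      using B(2) fin e i rat.independentD[OF B(2) fin subset_refl] by (auto simp: bij_betw_def)
    then show "c i = 0" using c' i by simp
  qed
  moreover have "\<exists>c. x = (\<Sum>i<card B. of_rat (c i) * e i)" for x
  proof -
    have "x \<in> range (\<lambda>u. \<Sum>v\<in>B. rat_scale (u v) v)"
      using span rat.span_finite[OF fin] by auto
    then obtain c where "x = (\<Sum>v\<in>B. rat_scale (c v) v)" by auto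
    then show ?thesis using sum[of c] by metis
  qed
  ultimately obtain crd where "rat_basis (card B) e crd" using rat_basisI by blast
  then show ?thesis using rat_basis.dimension_eq by metis
qed

text \<open>A coordinate function of a basis that extends \<open>z\<close> together with a basis of
  the span. It serves to show that a family spans: an element outside the span is detected by a
  functional vanishing on the family.\<close>

lemma rat_functional_exists:
  fixes e :: "nat \<Rightarrow> 'k::field_char_0"
  assumes z: "\<nexists>c. z = (\<Sum>i<n. of_rat (c i) * e i)"
  shows "\<exists>\<phi> :: 'k \<Rightarrow> rat. (\<forall>x y. \<phi> (x + y) = \<phi> x + \<phi> y) \<and> (\<forall>q x. \<phi> (of_rat q * x) = q * \<phi> x) \<and>
           (\<forall>i<n. \<phi> (e i) = 0) \<and> \<phi> z = 1"
proof -
  let ?S = "e ` {..<n}"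
  have nz: "z \<notin> rat.span ?S"
  proof
    assume "z \<in> rat.span ?S"
    then obtain c where c: "z = (\<Sum>v\<in>?S. rat_scale (c v) v)"
      using rat.span_finite[of ?S] by auto
    \<comment> \<open>\<open>e\<close> may repeat values, so one index is chosen for each vector and
      the coefficients at the others are set to 0.\<close>
    define g where "g = inv_into {..<n} e"
    have g: "g v < n \<and> e (g v) = v" if "v \<in> ?S" for v
      using inv_into_into[OF that] f_inv_into_f[OF that] by (simp add: g_def)
    have "z = (\<Sum>v\<in>?S. of_rat (c v) * e (g v))"
      using c g by (simp add: rat_scale_def)
    also have "\<dots> = (\<Sum>i\<in>g ` ?S. of_rat (c (e i)) * e i)"
      using g by (subst sum.reindex) (auto intro!: inj_on_inverseI[of _ e] sum.cong)
    also have "\<dots> = (\<Sum>i<n. of_rat (if i \<in> g ` ?S then c (e i) else 0) * e i)"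
      using g by (intro sum.mono_neutral_cong_left) auto
    finally show False using z by metis
  qed
  obtain B where B: "B \<subseteq> ?S" "rat.independent B" "?S \<subseteq> rat.span B"
    using rat.maximal_independent_subset by blast
  have SB: "rat.span ?S = rat.span B"
    using B by (metis rat.span_eq rat.span_superset order_trans)
  have ind: "rat.independent (insert z B)"
    using nz B(2) unfolding SB by (rule rat.independent_insertI)
  define X where "X = rat.extend_basis (insert z B)"
  have X: "rat.independent X" "rat.span X = UNIV" "insert z B \<subseteq> X"
    using rat.extend_basis_superset[OF ind] rat.independent_extend_basis[OF ind] rat.span_extend_basis[OF ind]
    by (auto simp: X_def)
  define \<phi> where "\<phi> = (\<lambda>x. rat.representation X x z)"
  have add: "\<phi> (x + y) = \<phi> x + \<phi> y" for x y
    using X by (simp add: \<phi>_def rat.representation_add)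
  have scale: "\<phi> (of_rat q * x) = q * \<phi> x" for q x
    using X rat.representation_scale[OF X(1), of x q] by (simp add: \<phi>_def rat_scale_def)
  have z1: "\<phi> z = 1"
    using X by (simp add: \<phi>_def rat.representation_basis)
  have "\<phi> v = 0" if "v \<in> rat.span B" for v
    using that
  proof (induction rule: rat.span_induct_alt)
    case base
    show ?case using scale[of 0 0] by simp
  next
    case (step c x y)
    have "x \<noteq> z" using step nz unfolding SB by (auto intro: rat.span_base)
    then have "\<phi> x = 0" using X step by (auto simp: \<phi>_def rat.representation_basis)
    then show ?case using step by (simp add: add rat_scale_def scale)
  qed
  then have "\<forall>i<n. \<phi> (e i) = 0" using B(3) by auto
  then show ?thesis using add scale z1 by blast
qed

section \<open>Determinants, norm and trace\<close>

text \<open>Induction through the derivative, which is the sum of the characteristic polynomials of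
  the matrices with row and column \<open>i\<close> deleted; each diagonal entry is missing from
  exactly one of them.\<close>

lemma coeff_char_poly_trace:
  fixes A :: "'a::field_char_0 mat"
  assumes "A \<in> carrier_mat (Suc n) (Suc n)"
  shows "poly.coeff (char_poly A) n = - (\<Sum>i<Suc n. A $$ (i, i))"
  using assms
proof (induction n arbitrary: A)
  case 0
  have "poly (char_poly A) 0 = - (A $$ (0, 0))"
    using 0 by (simp add: char_poly_matrix[OF 0] char_matrix_def det_def)
  then show ?case by (simp add: poly_0_coeff_0)
next
  case (Suc n)
  have "of_nat (Suc n) * poly.coeff (char_poly A) (Suc n) = poly.coeff (pderiv (char_poly A)) n"
    by (simp add: coeff_pderiv)
  also have "\<dots> = (\<Sum>i<Suc (Suc n). poly.coeff (char_poly (mat_delete A i i)) n)"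
    unfolding pderiv_char_poly[OF Suc(2)] by (rule coeff_sum)
  also have "\<dots> = (\<Sum>i<Suc (Suc n). - ((\<Sum>j<Suc (Suc n). A $$ (j, j)) - A $$ (i, i)))"
  proof (rule sum.cong[OF refl])
    fix i assume i: "i \<in> {..<Suc (Suc n)}"
    have del: "mat_delete A i i \<in> carrier_mat (Suc n) (Suc n)"
      using mat_delete_carrier[OF Suc(2)] by simp
    have "(\<Sum>j<Suc n. mat_delete A i i $$ (j, j)) = (\<Sum>j<Suc n. A $$ (insert_index i j, insert_index i j))"
      using i by (intro sum.cong[OF refl]) (simp add: mat_delete_index[OF Suc(2)])
    also have "\<dots> = (\<Sum>j\<in>insert_index i ` {..<Suc n}. A $$ (j, j))"
      by (subst sum.reindex) (auto simp: insert_index_inj_on)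
    also have "insert_index i ` {..<Suc n} = {..<Suc (Suc n)} - {i}"
      using insert_index_image[of i "Suc n"] i by (auto simp: atLeast0LessThan)
    also have "(\<Sum>j\<in>{..<Suc (Suc n)} - {i}. A $$ (j, j)) = (\<Sum>j<Suc (Suc n). A $$ (j, j)) - A $$ (i, i)"
      using i by (simp only: sum_diff1 finite_lessThan if_True)
    finally show "poly.coeff (char_poly (mat_delete A i i)) n = - ((\<Sum>j<Suc (Suc n). A $$ (j, j)) - A $$ (i, i))"
      by (simp only: Suc.IH[OF del])
  qed
  \<comment> \<open>Each of the \<open>Suc (Suc n)\<close> summands carries the full trace, and the
    deleted entries take it away once.\<close>
  also have "\<dots> = of_nat (Suc n) * (- (\<Sum>i<Suc (Suc n). A $$ (i, i)))"
    by (simp only: sum_negf sum_subtractf sum_constant card_lessThan) (simp add: algebra_simps)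
  finally show ?case by (simp only: mult_cancel_left of_nat_eq_0_iff) simp
qed

text \<open>Lagrange interpolation at the integers from 0 to \<open>n\<close>. The weights do not
  depend on \<open>p\<close>, so a bound on values gives a uniform bound on coefficients.\<close>

lemma coeff_interpolation:
  "\<exists>l :: nat \<Rightarrow> 'a::field_char_0. \<forall>p. degree p \<le> n \<longrightarrow> poly.coeff p m = (\<Sum>j\<le>n. l j * poly p (of_nat j))"
proof -
  define L :: "nat \<Rightarrow> 'a poly" where
    "L = (\<lambda>j. \<Prod>i\<in>{..n} - {j}. Polynomial.smult (1 / (of_nat j - of_nat i)) [:- of_nat i, 1:])"
  have deg: "degree (L j) \<le> n" if "j \<le> n" for j
  proof -
    have "degree (L j) \<le> (\<Sum>i\<in>{..n} - {j}. degree (Polynomial.smult (1 / (of_nat j - of_nat i)) [:- of_nat i, 1:] :: 'a poly))"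
      using degree_prod_sum_le[of "{..n} - {j}" "\<lambda>i. Polynomial.smult (1 / (of_nat j - of_nat i)) [:- of_nat i, 1:] :: 'a poly"]
      by (simp add: L_def comp_def)
    also have "\<dots> \<le> (\<Sum>i\<in>{..n} - {j}. 1)"
      by (intro sum_mono) (simp add: degree_smult_eq)
    also have "\<dots> = n" using that by simp
    finally show ?thesis .
  qed
  have L: "poly (L j) (of_nat k) = (if j = k then 1 else 0)" if "j \<le> n" "k \<le> n" for j k
  proof (cases "j = k")
    case True
    have "poly (Polynomial.smult (1 / (of_nat k - of_nat i)) [:- of_nat i, 1:]) (of_nat k :: 'a) = 1"
      if "i \<noteq> k" for i
      using that by (simp add: diff_divide_distrib[symmetric])
    then show ?thesis using True by (auto simp: L_def poly_prod intro!: prod.neutral)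
  next
    case False
    then show ?thesis using that by (auto simp: L_def poly_prod intro!: prod_zero bexI[of _ k])
  qed
  have "poly.coeff p m = (\<Sum>j\<le>n. poly.coeff (L j) m * poly p (of_nat j))" if p: "degree p \<le> n" for p
  proof -
    define q where "q = (\<Sum>j\<le>n. Polynomial.smult (poly p (of_nat j)) (L j))"
    have "p = q"
    proof (rule poly_eqI_degree[of "of_nat ` {..n}"])
      have "card (of_nat ` {..n} :: 'a set) = Suc n"
        by (simp add: card_image inj_on_def)
      moreover have "degree q \<le> n"
        unfolding q_def by (intro degree_sum_le) (auto intro: order_trans[OF degree_smult_le] deg)
      ultimately show "degree p < card (of_nat ` {..n} :: 'a set)" "degree q < card (of_nat ` {..n} :: 'a set)"
        using p by auto
      fix x :: 'a assume "x \<in> of_nat ` {..n}"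
      then obtain k where k: "k \<le> n" "x = of_nat k" by auto
      have "poly q x = (\<Sum>j\<le>n. poly p (of_nat j) * (if j = k then 1 else 0))"
        unfolding q_def k poly_sum using k by (intro sum.cong) (auto simp: L)
      also have "\<dots> = poly p x" using k by (simp add: if_distrib cong: if_cong)
      finally show "poly p x = poly q x" ..
    qed
    then have "poly.coeff p m = poly.coeff q m" by simp
    then show ?thesis by (simp add: q_def coeff_sum mult.commute)
  qed
  then show ?thesis by (intro exI[of _ "\<lambda>j. poly.coeff (L j) m"] allI impI)
qed

text \<open>Leibniz's formula, with a separate bound for each column because the columns will belong
  to different places. The factorial becomes a constant that vanishes on taking roots.\<close>

lemma absolute_value_det_le:
  assumes u: "absolute_value u" and A: "A \<in> carrier_mat n n"
    and c: "\<And>i j. i < n \<Longrightarrow> j < n \<Longrightarrow> u (A $$ (i, j)) \<le> c j"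
  shows "u (Determinant.det A) \<le> fact n * (\<Prod>j<n. c j)"
proof -
  have sgn: "u (signof p) = 1" for p :: "nat \<Rightarrow> nat"
    using absolute_value_1[OF u] absolute_value_minus[OF u, of 1] by (simp add: sign_def)
  have "u (Determinant.det A) \<le> (\<Sum>p | p permutes {0..<n}. u (signof p * (\<Prod>i=0..<n. A $$ (i, p i))))"
    unfolding det_def'[OF A] by (rule absolute_value_sum[OF u])
  also have "\<dots> \<le> (\<Sum>p | p permutes {0..<n}. \<Prod>j<n. c j)"
  proof (rule sum_mono)
    fix p assume "p \<in> {p. p permutes {0..<n}}"
    then have p: "p permutes {0..<n}" by simp
    have "u (signof p * (\<Prod>i=0..<n. A $$ (i, p i))) = (\<Prod>i=0..<n. u (A $$ (i, p i)))"
      by (simp add: absolute_value_mult[OF u] absolute_value_prod[OF u] sgn)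
    also have "\<dots> \<le> (\<Prod>i=0..<n. c (p i))"
      using p by (intro prod_mono conjI absolute_value_nonneg[OF u] c) (auto dest: permutes_in_image)
    also have "\<dots> = (\<Prod>j=0..<n. c j)"
      using prod.permute[OF p, of c] by (simp add: comp_def)
    finally show "u (signof p * (\<Prod>i=0..<n. A $$ (i, p i))) \<le> (\<Prod>j<n. c j)"
      by (simp add: atLeast0LessThan)
  qed
  also have "\<dots> = fact n * (\<Prod>j<n. c j)"
    by (simp add: card_permutations[OF refl])
  finally show ?thesis .
qed

context rat_basis
begin

definition mult_mat :: "'k \<Rightarrow> rat mat" where
  "mult_mat x = Matrix.mat D D (\<lambda>(i, j). crd i (x * b j))"

definition field_norm :: "'k \<Rightarrow> rat" where
  "field_norm x = Determinant.det (mult_mat x)"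

definition field_trace :: "'k \<Rightarrow> rat" where
  "field_trace x = (\<Sum>i<D. crd i (x * b i))"

lemma mult_mat_carrier [simp]: "mult_mat x \<in> carrier_mat D D"
  by (simp add: mult_mat_def)

lemma field_norm_1: "field_norm 1 = 1"
proof -
  have "mult_mat 1 = 1\<^sub>m D"
    by (rule eq_matI) (auto simp: mult_mat_def crd_basis)
  then show ?thesis by (simp add: field_norm_def)
qed

lemma field_norm_mult: "field_norm (x * y) = field_norm x * field_norm y"
proof -
  have "mult_mat (x * y) = mult_mat x * mult_mat y"
  proof (rule eq_matI)
    fix i j assume "i < dim_row (mult_mat x * mult_mat y)" "j < dim_col (mult_mat x * mult_mat y)"
    then have ij: "i < D" "j < D" by (auto simp: mult_mat_def)
    then show "mult_mat (x * y) $$ (i, j) = (mult_mat x * mult_mat y) $$ (i, j)"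
      using crd_mult[of i x "y * b j"]
      by (simp add: mult_mat_def scalar_prod_def mult_ac atLeast0LessThan)
  qed (auto simp: mult_mat_def)
  then show ?thesis by (simp add: field_norm_def det_mult[of _ D])
qed

lemma field_norm_power: "field_norm (x ^ n) = field_norm x ^ n"
  by (induction n) (auto simp: field_norm_1 field_norm_mult)

lemma field_norm_nonzero: "x \<noteq> 0 \<Longrightarrow> field_norm x \<noteq> 0"
  using field_norm_mult[of x "inverse x"] field_norm_1 by auto

lemma poly_char_poly_mult_mat: "poly (char_poly (mult_mat x)) t = field_norm (of_rat t - x)"
proof -
  have "- char_matrix (mult_mat x) t = mult_mat (of_rat t - x)"
  proof (rule eq_matI)
    fix i j assume "i < dim_row (mult_mat (of_rat t - x))" "j < dim_col (mult_mat (of_rat t - x))"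
    then have ij: "i < D" "j < D" by (auto simp: mult_mat_def)
    have "crd i ((of_rat t - x) * b j) + crd i (x * b j) = t * crd i (b j)"
      using ij by (simp add: crd_add[symmetric] crd_scale algebra_simps)
    then show "(- char_matrix (mult_mat x) t) $$ (i, j) = mult_mat (of_rat t - x) $$ (i, j)"
      using ij by (auto simp: char_matrix_def mult_mat_def crd_basis)
  qed (auto simp: char_matrix_def mult_mat_def)
  then show ?thesis
    by (simp add: char_poly_matrix[of _ D] field_norm_def)
qed

text \<open>Up to sign the trace is a coefficient of the characteristic polynomial, whose values at
  \<open>j\<close> are the norms of \<open>j - x\<close>. In this way bounds for the multiplicative
  norm reach the additive trace.\<close>

lemma field_trace_interpolation:
  "\<exists>l. \<forall>x. field_trace x = (\<Sum>j\<le>D. l j * field_norm (of_nat j - x))"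
proof -
  obtain n where n: "D = Suc n" using dimension_pos gr0_conv_Suc by blast
  obtain l where l: "\<And>p :: rat poly. degree p \<le> D \<Longrightarrow> poly.coeff p n = (\<Sum>j\<le>D. l j * poly p (of_nat j))"
    using coeff_interpolation[of D n] by blast
  have "field_trace x = (\<Sum>j\<le>D. - l j * field_norm (of_nat j - x))" for x
  proof -
    have "field_trace x = - poly.coeff (char_poly (mult_mat x)) n"
      by (subst coeff_char_poly_trace) (auto simp: n[symmetric] field_trace_def, auto simp: mult_mat_def)
    also have "poly.coeff (char_poly (mult_mat x)) n = (\<Sum>j\<le>D. l j * field_norm (of_nat j - x))"
      by (subst l) (auto simp: degree_monic_char_poly[of _ D] poly_char_poly_mult_mat)
    finally show ?thesis by (simp add: sum_negf)
  qed
  then show ?thesis by (intro exI[of _ "\<lambda>j. - l j"] allI)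
qed

lemma field_trace_add: "field_trace (x + y) = field_trace x + field_trace y"
  by (simp add: field_trace_def distrib_right crd_add sum.distrib)

lemma field_trace_scale: "field_trace (of_rat q * x) = q * field_trace x"
  by (simp add: field_trace_def mult.assoc crd_scale sum_distrib_left)

lemma field_trace_1: "field_trace 1 = of_nat D"
  by (simp add: field_trace_def crd_basis)

text \<open>The trace form is nondegenerate because \<open>field_trace (a * inverse a) = D\<close> is not zero in \<open>K\<close>.\<close>

lemma crd_eq_field_trace:
  assumes i: "i < D" shows "\<exists>a. \<forall>x. crd i x = field_trace (a * x)"
proof -
  \<comment> \<open>\<open>L\<close> is injective by nondegeneracy, hence onto by finite dimension;
    a preimage of \<open>b i\<close> is the member of the trace-dual basis that represents
    \<open>crd i\<close>.\<close>
  define L where "L = (\<lambda>a. \<Sum>j<D. of_rat (field_trace (a * b j)) * b j)"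
  have tr_eq: "field_trace (a * x) = (\<Sum>k<D. crd k x * field_trace (a * b k))" for a x
  proof -
    have sum: "field_trace (\<Sum>j\<in>A. f j) = (\<Sum>j\<in>A. field_trace (f j))" for A and f :: "nat \<Rightarrow> 'k"
      using field_trace_scale[of 0 0]
      by (induction A rule: infinite_finite_induct) (auto simp: field_trace_add)
    have "a * x = (\<Sum>k<D. of_rat (crd k x) * (a * b k))"
      using arg_cong[OF expand[of x], of "(*) a"] by (simp add: sum_distrib_left mult_ac)
    then show ?thesis by (simp add: sum field_trace_scale)
  qed
  interpret fin: finite_dimensional_vector_space "rat_scale :: rat \<Rightarrow> 'k \<Rightarrow> 'k" "b ` {..<D}"
    by unfold_locales
      (simp, rule rat_independent_imp_independent[OF basis_rat_independent], rule span_basis)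
  have L_add: "L (x + y) = L x + L y" for x y
    by (simp add: L_def distrib_right field_trace_add of_rat_add sum.distrib)
  have "L (rat_scale q x) = rat_scale q (L x)" for q x
    by (simp add: L_def rat_scale_def mult.assoc field_trace_scale of_rat_mult sum_distrib_left)
  with L_add have "Vector_Spaces.linear rat_scale rat_scale L"
    by unfold_locales
  moreover have "inj L"
  proof -
    have "a = 0" if "L a = 0" for a
    proof (rule ccontr)
      assume a: "a \<noteq> 0"
      have "field_trace (a * b k) = 0" if "k < D" for k
        using crd_combination[OF that, of "\<lambda>j. field_trace (a * b j)"] \<open>L a = 0\<close> crd_0[OF that] by (simp add: L_def)
      then have "field_trace (a * inverse a) = 0" using tr_eq[of a "inverse a"] by simp
      then show False using a field_trace_1 dimension_pos by simp
    qed
    moreover have "L (x - y) = L x - L y" for x y using L_add[of "x - y" y] by simp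
    ultimately show ?thesis by (metis injI right_minus_eq)
  qed
  ultimately have "surj L" by (rule fin.linear_inj_imp_surj)
  then obtain a where a: "L a = b i" by (metis surjD)
  have dual: "field_trace (a * b j) = (if j = i then 1 else 0)" if "j < D" for j
    using crd_combination[OF that, of "\<lambda>j. field_trace (a * b j)"] a crd_basis[OF that i] by (simp add: L_def)
  have "crd i x = field_trace (a * x)" for x
  proof -
    have "field_trace (a * x) = (\<Sum>k<D. if k = i then crd k x else 0)"
      unfolding tr_eq[of a x] by (rule sum.cong) (auto simp: dual)
    then show ?thesis using i by simp
  qed
  then show ?thesis by blast
qed

end

text \<open>The matrices of multiplication by \<open>x\<close> in the two bases are conjugate under
  the change of basis \<open>P\<close>. The comparison is needed because
  \<open>extensions_structure\<close> uses a basis that varies with the exponent.\<close>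

lemma field_norm_basis_independent:
  assumes "rat_basis D b crd" "rat_basis D e crd'"
  shows "rat_basis.field_norm D b crd x = rat_basis.field_norm D e crd' x"
proof -
  interpret b: rat_basis D b crd by fact
  interpret e: rat_basis D e crd' by fact
  define P where "P = Matrix.mat D D (\<lambda>(i, j). crd i (e j))"
  define Q where "Q = Matrix.mat D D (\<lambda>(i, j). crd' i (b j))"
  have carr: "P \<in> carrier_mat D D" "Q \<in> carrier_mat D D" by (auto simp: P_def Q_def)
  have change: "crd i z = (\<Sum>k<D. crd' k z * crd i (e k))" if "i < D" for i z
  proof -
    have "crd i (\<Sum>k<D. of_rat (crd' k z) * e k) = (\<Sum>k<D. crd' k z * crd i (e k))"
      using that by (simp add: b.crd_sum b.crd_scale)
    then show ?thesis by (simp only: e.combination_crd)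
  qed
  have "P * Q = 1\<^sub>m D"
  proof (rule eq_matI)
    fix i j assume "i < dim_row (1\<^sub>m D)" "j < dim_col (1\<^sub>m D)"
    then have ij: "i < D" "j < D" by auto
    then show "(P * Q) $$ (i, j) = 1\<^sub>m D $$ (i, j)"
      using change[of i "b j"] b.crd_basis[of i j]
      by (simp add: P_def Q_def scalar_prod_def atLeast0LessThan mult.commute)
  qed (auto simp: P_def Q_def)
  then have "Determinant.det P * Determinant.det Q = 1" using det_mult[OF carr] by simp
  then have nz: "Determinant.det P \<noteq> 0" by auto
  have eq: "b.mult_mat x * P = P * e.mult_mat x"
  proof (rule eq_matI)
    fix i j assume "i < dim_row (P * e.mult_mat x)" "j < dim_col (P * e.mult_mat x)"
    then have ij: "i < D" "j < D" by (auto simp: P_def e.mult_mat_def)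
    then show "(b.mult_mat x * P) $$ (i, j) = (P * e.mult_mat x) $$ (i, j)"
      using change[of i "x * e j"] b.crd_mult[of i x "e j"]
      by (simp add: P_def b.mult_mat_def e.mult_mat_def scalar_prod_def atLeast0LessThan mult.commute)
  qed (auto simp: P_def b.mult_mat_def e.mult_mat_def)
  have "Determinant.det (b.mult_mat x) * Determinant.det P = Determinant.det P * Determinant.det (e.mult_mat x)"
    using arg_cong[OF eq, of Determinant.det]
    unfolding det_mult[OF b.mult_mat_carrier carr(1)] det_mult[OF carr(1) e.mult_mat_carrier] .
  then show ?thesis using nz by (simp add: b.field_norm_def e.field_norm_def)
qed

section \<open>The spectral radius of a place\<close>

locale number_field_place = rat_basis D b crd + nontrivial_absolute_value u
  for D :: nat and b :: "nat \<Rightarrow> 'k::field_char_0" and crd :: "nat \<Rightarrow> 'k \<Rightarrow> rat" and u :: "rat \<Rightarrow> real"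
begin

definition basis_norm :: "'k \<Rightarrow> real" where
  "basis_norm x = (\<Sum>i<D. u (crd i x))"

lemma basis_norm_nonneg: "0 \<le> basis_norm x"
  by (simp add: basis_norm_def sum_nonneg absolute_value_nonneg[OF u])

lemma crd_le_basis_norm: "i < D \<Longrightarrow> u (crd i x) \<le> basis_norm x"
  unfolding basis_norm_def by (rule member_le_sum) (auto simp: absolute_value_nonneg[OF u])

lemma basis_norm_add: "basis_norm (x + y) \<le> basis_norm x + basis_norm y"
  unfolding basis_norm_def sum.distrib[symmetric]
  by (rule sum_mono) (simp add: crd_add absolute_value_triangle[OF u])

lemma basis_norm_scale: "basis_norm (of_rat q * x) = u q * basis_norm x"
  by (simp add: basis_norm_def crd_scale absolute_value_mult[OF u] sum_distrib_left)

lemma basis_norm_0: "basis_norm 0 = 0"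
  by (simp add: basis_norm_def crd_0 absolute_value_0[OF u])

lemma basis_norm_sum: "basis_norm (\<Sum>i\<in>A. f i) \<le> (\<Sum>i\<in>A. basis_norm (f i))"
proof (induction A rule: infinite_finite_induct)
  case (insert x F)
  then show ?case using basis_norm_add[of "f x" "\<Sum>i\<in>F. f i"] by simp
qed (auto simp: basis_norm_0)

lemma basis_norm_1_pos: "0 < basis_norm 1"
proof (rule ccontr)
  assume "\<not> 0 < basis_norm 1"
  then have "basis_norm 1 = 0" using basis_norm_nonneg[of 1] by simp
  then have "u (crd i 1) = 0" if "i < D" for i
    using crd_le_basis_norm[OF that, of 1] absolute_value_nonneg[OF u, of "crd i 1"] by simp
  then have "(\<Sum>i<D. of_rat (crd i 1) * b i) = 0"
    by (simp add: absolute_value_eq_0[OF u])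
  then show False by (simp add: combination_crd)
qed

text \<open>It dominates the norm of every product of two basis elements, which makes
  \<open>basis_norm\<close> submultiplicative up to this factor.\<close>

definition structure_const :: real where
  "structure_const = (\<Sum>i<D. \<Sum>j<D. basis_norm (b i * b j))"

lemma structure_const_nonneg: "0 \<le> structure_const"
  by (simp add: structure_const_def sum_nonneg basis_norm_nonneg)

lemma basis_norm_mult: "basis_norm (x * y) \<le> structure_const * basis_norm x * basis_norm y"
proof -
  have le: "basis_norm (b i * b j) \<le> structure_const" if "i < D" "j < D" for i j
  proof -
    have "basis_norm (b i * b j) \<le> (\<Sum>j<D. basis_norm (b i * b j))"
      using that by (intro member_le_sum) (auto simp: basis_norm_nonneg)
    also have "\<dots> \<le> structure_const"
      unfolding structure_const_def using that
      by (intro member_le_sum[of i _ "\<lambda>i. \<Sum>j<D. basis_norm (b i * b j)"]) (auto simp: basis_norm_nonneg sum_nonneg)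
    finally show ?thesis .
  qed
  have "x * y = (\<Sum>i<D. of_rat (crd i x) * b i) * (\<Sum>j<D. of_rat (crd j y) * b j)"
    by (simp only: combination_crd)
  also have "\<dots> = (\<Sum>i<D. \<Sum>j<D. of_rat (crd i x * crd j y) * (b i * b j))"
    by (simp add: sum_product of_rat_mult mult_ac)
  also have "basis_norm \<dots> \<le> (\<Sum>i<D. \<Sum>j<D. basis_norm (of_rat (crd i x * crd j y) * (b i * b j)))"
    by (rule order_trans[OF basis_norm_sum sum_mono[OF basis_norm_sum]])
  also have "\<dots> \<le> (\<Sum>i<D. \<Sum>j<D. (u (crd i x) * u (crd j y)) * structure_const)"
    unfolding basis_norm_scale absolute_value_mult[OF u]
    by (intro sum_mono mult_left_mono le) (auto simp: absolute_value_nonneg[OF u])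
  also have "\<dots> = structure_const * basis_norm x * basis_norm y"
    by (simp add: basis_norm_def sum_product sum_distrib_left mult_ac)
  finally show ?thesis .
qed

lemma extension_le_basis_norm:
  assumes w: "w \<in> extensions u"
  shows "w x \<le> (\<Sum>i<D. w (b i)) * basis_norm x"
proof -
  note av = extensionsD(1)[OF w]
  have "w x = w (\<Sum>i<D. of_rat (crd i x) * b i)" by (simp only: combination_crd)
  also have "\<dots> \<le> (\<Sum>i<D. w (of_rat (crd i x) * b i))" by (rule absolute_value_sum[OF av])
  also have "\<dots> \<le> (\<Sum>i<D. w (b i) * basis_norm x)"
    unfolding absolute_value_mult[OF av] extensionsD(2)[OF w]
  proof (rule sum_mono)
    fix i assume "i \<in> {..<D}"
    then show "u (crd i x) * w (b i) \<le> w (b i) * basis_norm x"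
      using mult_left_mono[OF crd_le_basis_norm absolute_value_nonneg[OF av], of i "b i" x]
      by (simp add: mult.commute)
  qed
  finally show ?thesis by (simp add: sum_distrib_right)
qed

text \<open>Exponential rates, whose infimum replaces the limit of the n-th roots of
  \<open>basis_norm (x ^ n)\<close>: no convergence has to be shown, and constants such as
  \<open>structure_const\<close> do not affect it.\<close>

definition growth_rates :: "'k \<Rightarrow> real set" where
  "growth_rates x = {r. 0 < r \<and> (\<exists>C. \<forall>n. basis_norm (x ^ n) \<le> C * r ^ n)}"

definition spectral_radius :: "'k \<Rightarrow> real" where
  "spectral_radius x = Inf (growth_rates x)"

lemma growth_rates_nonempty: "growth_rates x \<noteq> {}"
proof -
  define r where "r = structure_const * basis_norm x + 1"
  have r: "r > 0" "structure_const * basis_norm x \<le> r"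
    using structure_const_nonneg basis_norm_nonneg by (auto simp: r_def add_nonneg_pos)
  have "basis_norm (x ^ n) \<le> basis_norm 1 * r ^ n" for n
  proof (induction n)
    case (Suc n)
    have "basis_norm (x ^ Suc n) \<le> structure_const * basis_norm x * basis_norm (x ^ n)"
      using basis_norm_mult[of x "x ^ n"] by simp
    also have "\<dots> \<le> r * (basis_norm 1 * r ^ n)"
      using r Suc structure_const_nonneg basis_norm_nonneg by (intro mult_mono) auto
    finally show ?case by (simp add: mult_ac)
  qed simp
  then show ?thesis using r(1) by (auto simp: growth_rates_def)
qed

lemma spectral_radius_nonneg: "0 \<le> spectral_radius x"
  unfolding spectral_radius_def using growth_rates_nonempty
  by (intro cInf_greatest) (auto simp: growth_rates_def)

lemma spectral_radius_le: "r \<in> growth_rates x \<Longrightarrow> spectral_radius x \<le> r"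
  unfolding spectral_radius_def by (intro cInf_lower bdd_belowI[of _ 0]) (auto simp: growth_rates_def)

lemma growth_rateE:
  assumes "spectral_radius x < r"
  obtains C where "0 \<le> C" "\<And>n. basis_norm (x ^ n) \<le> C * r ^ n"
proof -
  obtain s where s: "s \<in> growth_rates x" "s < r"
    using assms growth_rates_nonempty cInf_lessD unfolding spectral_radius_def by metis
  then obtain C where C: "0 < s" "\<And>n. basis_norm (x ^ n) \<le> C * s ^ n" by (auto simp: growth_rates_def)
  have C0: "0 \<le> C" using C(2)[of 0] basis_norm_nonneg[of 1] by simp
  have "basis_norm (x ^ n) \<le> C * r ^ n" for n
    using C s C0 by (meson less_imp_le mult_left_mono order_trans power_mono)
  then show ?thesis using C0 that by blast
qed

text \<open>Rates \<open>r\<close> and \<open>s\<close> recombine by the binomial theorem to the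
  rate \<open>r + s\<close>; \<open>structure_const\<close> enters only once in each summand, which
  is a product of two powers.\<close>

lemma spectral_radius_add: "spectral_radius (x + y) \<le> spectral_radius x + spectral_radius y"
proof (rule field_le_epsilon)
  fix e :: real assume e: "e > 0"
  define r s where "r = spectral_radius x + e / 2" and "s = spectral_radius y + e / 2"
  have pos: "r > 0" "s > 0" using e spectral_radius_nonneg by (auto simp: r_def s_def add_nonneg_pos)
  obtain A where A: "0 \<le> A" "\<And>n. basis_norm (x ^ n) \<le> A * r ^ n"
    using growth_rateE[of x r] e by (auto simp: r_def)
  obtain B where B: "0 \<le> B" "\<And>n. basis_norm (y ^ n) \<le> B * s ^ n"
    using growth_rateE[of y s] e by (auto simp: s_def)
  have "basis_norm ((x + y) ^ n) \<le> (structure_const * A * B) * (r + s) ^ n" for n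
  proof -
    \<comment> \<open>The binomial coefficients are written as rational scalars, whose value under
      \<open>u\<close> is at most their size.\<close>
    have "basis_norm ((x + y) ^ n) = basis_norm (\<Sum>k\<le>n. of_rat (of_nat (n choose k)) * (x ^ k * y ^ (n - k)))"
      by (simp add: binomial_ring mult.assoc)
    also have "\<dots> \<le> (\<Sum>k\<le>n. basis_norm (of_rat (of_nat (n choose k)) * (x ^ k * y ^ (n - k))))"
      by (rule basis_norm_sum)
    also have "\<dots> \<le> (\<Sum>k\<le>n. real (n choose k) * (structure_const * (A * r ^ k) * (B * s ^ (n - k))))"
    proof (rule sum_mono)
      fix k
      have "basis_norm (x ^ k * y ^ (n - k)) \<le> structure_const * basis_norm (x ^ k) * basis_norm (y ^ (n - k))"
        by (rule basis_norm_mult)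
      also have "\<dots> \<le> structure_const * (A * r ^ k) * (B * s ^ (n - k))"
        using A B pos structure_const_nonneg basis_norm_nonneg by (intro mult_mono mult_nonneg_nonneg) auto
      finally show "basis_norm (of_rat (of_nat (n choose k)) * (x ^ k * y ^ (n - k)))
          \<le> real (n choose k) * (structure_const * (A * r ^ k) * (B * s ^ (n - k)))"
        unfolding basis_norm_scale
        by (intro mult_mono absolute_value_of_nat_le[OF u] basis_norm_nonneg) auto
    qed
    also have "\<dots> = (structure_const * A * B) * (r + s) ^ n"
      by (simp add: binomial_ring sum_distrib_left mult_ac)
    finally show ?thesis .
  qed
  then have "r + s \<in> growth_rates (x + y)"
    using pos by (auto simp: growth_rates_def)
  then show "spectral_radius (x + y) \<le> spectral_radius x + spectral_radius y + e"
    using spectral_radius_le by (fastforce simp: r_def s_def)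
qed

lemma spectral_radius_mult: "spectral_radius (x * y) \<le> spectral_radius x * spectral_radius y"
proof -
  have le: "spectral_radius (x * y) \<le> (spectral_radius x + e) * (spectral_radius y + e)" if e: "e > 0" for e
  proof -
    define r s where "r = spectral_radius x + e" and "s = spectral_radius y + e"
    have pos: "r > 0" "s > 0" using e spectral_radius_nonneg by (auto simp: r_def s_def add_nonneg_pos)
    obtain A where A: "0 \<le> A" "\<And>n. basis_norm (x ^ n) \<le> A * r ^ n"
      using growth_rateE[of x r] e by (auto simp: r_def)
    obtain B where B: "0 \<le> B" "\<And>n. basis_norm (y ^ n) \<le> B * s ^ n"
      using growth_rateE[of y s] e by (auto simp: s_def)
    have "basis_norm ((x * y) ^ n) \<le> (structure_const * A * B) * (r * s) ^ n" for n
    proof -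
      have "basis_norm ((x * y) ^ n) \<le> structure_const * basis_norm (x ^ n) * basis_norm (y ^ n)"
        unfolding power_mult_distrib by (rule basis_norm_mult)
      also have "\<dots> \<le> structure_const * (A * r ^ n) * (B * s ^ n)"
        using A B pos structure_const_nonneg basis_norm_nonneg by (intro mult_mono mult_nonneg_nonneg) auto
      finally show ?thesis by (simp add: power_mult_distrib mult_ac)
    qed
    then have "r * s \<in> growth_rates (x * y)"
      using pos by (auto simp: growth_rates_def)
    then show ?thesis using spectral_radius_le by (auto simp: r_def s_def)
  qed
  have "((\<lambda>e. (spectral_radius x + e) * (spectral_radius y + e)) \<longlongrightarrow>
      (spectral_radius x + 0) * (spectral_radius y + 0)) (at_right 0)"
    by (intro tendsto_intros)
  then have "((\<lambda>e. (spectral_radius x + e) * (spectral_radius y + e)) \<longlongrightarrow>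
      spectral_radius x * spectral_radius y) (at_right 0)" by simp
  then show ?thesis
    by (rule tendsto_lowerbound) (auto simp: le eventually_at_right_less eventually_at_filter)
qed

text \<open>The lower bound is what goes beyond submultiplicativity: a rate \<open>s\<close> for the
  powers of the square gives the rate \<open>sqrt s\<close> for all powers of \<open>x\<close>, an
  odd power costing one more factor \<open>x\<close>.\<close>

lemma spectral_radius_square: "spectral_radius (x\<^sup>2) = (spectral_radius x)\<^sup>2"
proof (rule antisym)
  show "spectral_radius (x\<^sup>2) \<le> (spectral_radius x)\<^sup>2"
    unfolding power2_eq_square by (rule spectral_radius_mult)
  show "(spectral_radius x)\<^sup>2 \<le> spectral_radius (x\<^sup>2)"
  proof (rule dense_ge)
    fix s assume s: "spectral_radius (x\<^sup>2) < s"
    then have s0: "s > 0" using spectral_radius_nonneg[of "x\<^sup>2"] by simp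
    obtain C where C: "0 \<le> C" "\<And>n. basis_norm ((x\<^sup>2) ^ n) \<le> C * s ^ n"
      using growth_rateE[OF s] by blast
    define t where "t = sqrt s"
    have t: "t > 0" "s = t\<^sup>2" using s0 by (auto simp: t_def)
    \<comment> \<open>One constant for both parities: the second summand pays for the additional
      factor \<open>x\<close>, and its denominator for the additional factor \<open>t\<close> in
      \<open>t ^ n\<close>.\<close>
    define C' where "C' = C + structure_const * basis_norm x * C / t"
    have C': "C \<le> C'" "structure_const * basis_norm x * C / t \<le> C'"
      using C t structure_const_nonneg basis_norm_nonneg by (auto simp: C'_def)
    have "basis_norm (x ^ n) \<le> C' * t ^ n" for n
    proof (cases "even n")
      case True
      then obtain k where k: "n = 2 * k" by blast
      have "basis_norm (x ^ n) \<le> C * t ^ n" using C(2)[of k] by (simp add: k t(2) power_mult)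
      also have "\<dots> \<le> C' * t ^ n" using C' t by (intro mult_right_mono) auto
      finally show ?thesis .
    next
      case False
      then obtain k where k: "n = Suc (2 * k)" by (auto elim!: oddE)
      have "basis_norm (x ^ n) \<le> structure_const * basis_norm x * basis_norm ((x\<^sup>2) ^ k)"
        using basis_norm_mult[of x "(x\<^sup>2) ^ k"] by (simp add: k power_mult)
      also have "\<dots> \<le> structure_const * basis_norm x * (C * s ^ k)"
        using C structure_const_nonneg basis_norm_nonneg by (intro mult_left_mono mult_nonneg_nonneg) auto
      also have "\<dots> = structure_const * basis_norm x * C / t * t ^ n"
        using t by (simp add: k power_mult)
      also have "\<dots> \<le> C' * t ^ n" using C' t by (intro mult_right_mono) auto
      finally show ?thesis .
    qed
    then have "t \<in> growth_rates x" using t by (auto simp: growth_rates_def)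
    then have "spectral_radius x \<le> t" by (rule spectral_radius_le)
    then show "(spectral_radius x)\<^sup>2 \<le> s"
      unfolding t(2) by (intro power_mono spectral_radius_nonneg)
  qed
qed

lemma spectral_radius_of_rat: "spectral_radius (of_rat q) = u q"
proof -
  have norm: "basis_norm (of_rat q ^ n) = u q ^ n * basis_norm 1" for n
    using basis_norm_scale[of "q ^ n" 1] by (simp add: of_rat_power absolute_value_power[OF u])
  have "u q \<le> r" if "r \<in> growth_rates (of_rat q)" for r
  proof -
    obtain C where C: "0 < r" "\<And>n. u q ^ n * basis_norm 1 \<le> C * r ^ n"
      using \<open>r \<in> growth_rates (of_rat q)\<close> by (auto simp: growth_rates_def norm)
    then have "u q ^ n \<le> (C / basis_norm 1) * r ^ n" for n
      using basis_norm_1_pos by (simp add: field_simps)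
    then show ?thesis
      by (rule real_le_of_power_le[OF absolute_value_nonneg[OF u] less_imp_le[OF C(1)]])
  qed
  then have "u q \<le> spectral_radius (of_rat q)"
    unfolding spectral_radius_def using growth_rates_nonempty by (intro cInf_greatest) auto
  moreover have "spectral_radius (of_rat q) \<le> u q"
  proof (rule dense_ge)
    fix r assume "u q < r"
    moreover have "0 \<le> u q" by (rule absolute_value_nonneg[OF u])
    ultimately have "r \<in> growth_rates (of_rat q)"
      using basis_norm_1_pos
      by (auto simp: growth_rates_def norm mult.commute intro!: exI[of _ "basis_norm 1"] power_mono)
    then show "spectral_radius (of_rat q) \<le> r" by (rule spectral_radius_le)
  qed
  ultimately show ?thesis by simp
qed

lemma spectral_seminorm_spectral_radius: "spectral_seminorm u spectral_radius"
  unfolding spectral_seminorm_def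
  using spectral_radius_nonneg spectral_radius_add spectral_radius_mult spectral_radius_square
    spectral_radius_of_rat by blast

text \<open>\<open>w\<close> is at most a constant times \<open>basis_norm\<close>, and for powers
  of \<open>x\<close> the constant disappears.\<close>

lemma extension_le_spectral_radius:
  assumes w: "w \<in> extensions u" shows "w x \<le> spectral_radius x"
proof (rule dense_ge)
  fix r assume r: "spectral_radius x < r"
  then have r0: "0 < r" using spectral_radius_nonneg[of x] by simp
  note av = extensionsD(1)[OF w]
  define K where "K = (\<Sum>i<D. w (b i))"
  have K: "0 \<le> K" by (simp add: K_def sum_nonneg absolute_value_nonneg[OF av])
  obtain C where C: "0 \<le> C" "\<And>n. basis_norm (x ^ n) \<le> C * r ^ n" using growth_rateE[OF r] by blast
  show "w x \<le> r"
  proof (rule real_le_of_power_le)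
    fix n
    have "w x ^ n \<le> K * basis_norm (x ^ n)"
      using extension_le_basis_norm[OF w, of "x ^ n"] by (simp add: K_def absolute_value_power[OF av])
    also have "\<dots> \<le> K * (C * r ^ n)" by (intro mult_left_mono C K)
    finally show "w x ^ n \<le> K * C * r ^ n" by simp
  qed (use r0 absolute_value_nonneg[OF av] in auto)
qed

lemma spectral_radius_attained: "\<exists>w\<in>extensions u. w x = spectral_radius x"
proof (cases "x = 0")
  case True
  obtain w :: "'k \<Rightarrow> real" where w: "w \<in> extensions u"
    using spectral_seminorm_attained[OF u spectral_seminorm_spectral_radius, of 1] by auto
  have "spectral_radius 0 = 0"
    using spectral_seminorm_0[OF u spectral_seminorm_spectral_radius] .
  then show ?thesis using w absolute_value_0[OF extensionsD(1)[OF w]] True by (intro bexI[of _ w]) auto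
next
  case False
  then show ?thesis by (rule spectral_seminorm_attained[OF u spectral_seminorm_spectral_radius])
qed

text \<open>The matrix of \<open>x ^ n\<close> has entries of order \<open>r ^ n\<close>, and roots
  are taken of its determinant. Charging every column with the largest place is crude, but it
  suffices to control the trace.\<close>

lemma field_norm_le_spectral_radius: "u (field_norm x) \<le> spectral_radius x ^ D"
proof -
  have le: "u (field_norm x) \<le> r ^ D" if r: "spectral_radius x < r" for r
  proof -
    have r0: "0 < r" using spectral_radius_nonneg[of x] r by simp
    obtain C where C: "0 \<le> C" "\<And>n. basis_norm (x ^ n) \<le> C * r ^ n" using growth_rateE[OF r] by blast
    define K where "K = structure_const * C * (\<Sum>j<D. basis_norm (b j))"
    show ?thesis
    proof (rule real_le_of_power_le)
      fix n
      have "u (field_norm (x ^ n)) \<le> fact D * (\<Prod>j<D. K * r ^ n)"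
        unfolding field_norm_def
      proof (rule absolute_value_det_le[OF u mult_mat_carrier])
        fix i j assume ij: "i < D" "j < D"
        have "u (crd i (x ^ n * b j)) \<le> structure_const * basis_norm (x ^ n) * basis_norm (b j)"
          using crd_le_basis_norm[OF ij(1)] basis_norm_mult order_trans by blast
        also have "\<dots> \<le> structure_const * (C * r ^ n) * (\<Sum>j<D. basis_norm (b j))"
          using ij C r0 structure_const_nonneg basis_norm_nonneg
          by (intro mult_mono mult_nonneg_nonneg member_le_sum) auto
        finally show "u (mult_mat (x ^ n) $$ (i, j)) \<le> K * r ^ n"
          using ij by (simp add: mult_mat_def K_def mult_ac)
      qed
      then show "u (field_norm x) ^ n \<le> (fact D * K ^ D) * (r ^ D) ^ n"
        by (simp add: field_norm_power absolute_value_power[OF u] power_mult_distrib mult.assoc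
            flip: power_mult) (simp add: mult.commute)
    qed (use r0 absolute_value_nonneg[OF u] in auto)
  qed
  have "((\<lambda>r. r ^ D) \<longlongrightarrow> spectral_radius x ^ D) (at_right (spectral_radius x))"
    by (intro tendsto_intros)
  then show ?thesis
    by (rule tendsto_lowerbound) (auto simp: le eventually_at_filter)
qed

text \<open>Scalars are rational, so elements can be normalised only up to a bounded factor. The
  integral powers of one rational already come within a fixed factor of every positive real.\<close>

lemma rational_scale_exists:
  "\<exists>K. \<forall>r>0. \<exists>s. s \<noteq> 0 \<and> r \<le> u s \<and> u s \<le> K * r"
proof -
  obtain q where q: "q \<noteq> 0" "u q < 1" using nontrivial by blast
  define a where "a = u (inverse q)"
  have a: "a > 1" using q absolute_value_pos[OF u q(1)]
    by (simp add: a_def absolute_value_inverse[OF u] one_less_inverse_iff)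
  have "\<exists>s. s \<noteq> 0 \<and> r \<le> u s \<and> u s \<le> a * r" if r: "r > 0" for r
  proof (intro exI conjI)
    define n where "n = \<lceil>log a r\<rceil>"
    have us: "u (inverse q powi n) = a powr real_of_int n"
      using a by (simp add: absolute_value_power_int[OF u] a_def powr_real_of_int')
    have "r = a powr (log a r)" using a r by simp
    also have "\<dots> \<le> a powr real_of_int n" using a by (intro powr_mono) (auto simp: n_def)
    finally show "r \<le> u (inverse q powi n)" by (simp add: us)
    have "a powr real_of_int n \<le> a powr (log a r + 1)"
      using a by (intro powr_mono) (auto simp: n_def)
    also have "\<dots> = a * r" using a r by (simp add: powr_add)
    finally show "u (inverse q powi n) \<le> a * r" by (simp add: us)
    show "inverse q powi n \<noteq> 0" using q by simp
  qed
  then show ?thesis by blast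
qed

text \<open>The trace is a fixed combination of the norms of the \<open>j - x\<close>, which are bounded by
  \<open>(j + 1) ^ D\<close> when \<open>x\<close> has spectral radius at most 1.\<close>

lemma field_trace_le_spectral_radius: "\<exists>C. \<forall>x. u (field_trace x) \<le> C * spectral_radius x"
proof -
  note ss = spectral_seminorm_spectral_radius
  obtain l where l: "\<And>x. field_trace x = (\<Sum>j\<le>D. l j * field_norm (of_nat j - x))"
    using field_trace_interpolation by blast
  define C where "C = (\<Sum>j\<le>D. u (l j) * (real j + 1) ^ D)"
  have C: "u (field_trace x) \<le> C" if x: "spectral_radius x \<le> 1" for x
  proof -
    have "u (field_trace x) \<le> (\<Sum>j\<le>D. u (l j * field_norm (of_nat j - x)))"
      unfolding l by (rule absolute_value_sum[OF u])
    also have "\<dots> \<le> C"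
      unfolding C_def absolute_value_mult[OF u]
    proof (intro sum_mono mult_left_mono absolute_value_nonneg[OF u])
      fix j
      have "spectral_radius (of_nat j + of_rat (-1) * x) \<le> spectral_radius (of_rat (of_nat j)) + spectral_radius (of_rat (-1) * x)"
        by (metis spectral_radius_add of_rat_of_nat_eq)
      also have "\<dots> = u (of_nat j) + spectral_radius x"
        unfolding spectral_seminorm_scale[OF u ss] spectral_radius_of_rat
        using absolute_value_minus[OF u, of 1] absolute_value_1[OF u] by simp
      also have "\<dots> \<le> real j + 1" using absolute_value_of_nat_le[OF u, of j] x by simp
      finally have "spectral_radius (of_nat j - x) \<le> real j + 1" by (simp add: of_rat_minus)
      then show "u (field_norm (of_nat j - x)) \<le> (real j + 1) ^ D"
        by (intro order_trans[OF field_norm_le_spectral_radius] power_mono spectral_radius_nonneg)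
    qed
    finally show ?thesis .
  qed
  obtain K where K: "\<And>r. r > 0 \<Longrightarrow> \<exists>s. s \<noteq> 0 \<and> r \<le> u s \<and> u s \<le> K * r"
    using rational_scale_exists by blast
  have C0: "0 \<le> C" by (auto simp: C_def intro!: sum_nonneg mult_nonneg_nonneg absolute_value_nonneg[OF u])
  have "u (field_trace x) \<le> (C * K) * spectral_radius x" for x
  proof (cases "x = 0")
    case True
    have "field_trace 0 = 0" using field_trace_scale[of 0 0] by simp
    then show ?thesis using True spectral_seminorm_0[OF u ss] absolute_value_0[OF u] by simp
  next
    case False
    then have "spectral_radius x > 0" by (rule spectral_seminorm_pos[OF u ss])
    then obtain s where s: "s \<noteq> 0" "spectral_radius x \<le> u s" "u s \<le> K * spectral_radius x"
      using K by blast
    have us: "u s > 0" using absolute_value_pos[OF u s(1)] .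
    \<comment> \<open>Scaling by \<open>s\<close> reduces to spectral radius at most 1 with a loss
      of at most the factor \<open>K\<close>.\<close>
    have "spectral_radius (of_rat (inverse s) * x) \<le> 1"
      unfolding spectral_seminorm_scale[OF u ss] absolute_value_inverse[OF u]
      using s us by (simp add: divide_inverse[symmetric] mult.commute[of "inverse _"])
    then have "u (inverse s * field_trace x) \<le> C"
      using C field_trace_scale[of "inverse s" x] by metis
    then have "u (field_trace x) \<le> C * u s"
      using us unfolding absolute_value_mult[OF u] absolute_value_inverse[OF u] by (simp add: field_simps)
    also have "\<dots> \<le> C * (K * spectral_radius x)" by (intro mult_left_mono s C0)
    finally show ?thesis by simp
  qed
  then show ?thesis by blast
qed

text \<open>A functional is a combination of coordinates, and a coordinate is the trace after
  multiplication by a fixed element. This is the harder half of the equivalence of the spectral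
  radius with \<open>basis_norm\<close>.\<close>

lemma functional_le_spectral_radius:
  assumes add: "\<And>x y. \<phi> (x + y) = \<phi> x + \<phi> y" and scale: "\<And>q x. \<phi> (of_rat q * x) = q * \<phi> x"
  shows "\<exists>C. \<forall>x. u (\<phi> x) \<le> C * spectral_radius x"
proof -
  obtain C where C: "\<And>x. u (field_trace x) \<le> C * spectral_radius x"
    using field_trace_le_spectral_radius by blast
  obtain a where a: "\<And>i x. i < D \<Longrightarrow> crd i x = field_trace (a i * x)"
    using crd_eq_field_trace by metis
  have C0: "0 \<le> C"
    using C[of 1] absolute_value_nonneg[OF u, of "field_trace 1"]
      spectral_seminorm_1[OF u spectral_seminorm_spectral_radius] by simp
  have \<phi>: "\<phi> x = (\<Sum>i<D. crd i x * \<phi> (b i))" for x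
  proof -
    have sum: "\<phi> (\<Sum>j\<in>A. f j) = (\<Sum>j\<in>A. \<phi> (f j))" for A and f :: "nat \<Rightarrow> 'k"
      using scale[of 0 0] by (induction A rule: infinite_finite_induct) (auto simp: add)
    have "\<phi> (\<Sum>i<D. of_rat (crd i x) * b i) = (\<Sum>i<D. crd i x * \<phi> (b i))"
      by (simp add: sum scale)
    then show ?thesis by (simp only: combination_crd)
  qed
  have "u (\<phi> x) \<le> (\<Sum>i<D. C * spectral_radius (a i) * u (\<phi> (b i))) * spectral_radius x" for x
  proof -
    have "u (\<phi> x) \<le> (\<Sum>i<D. u (crd i x) * u (\<phi> (b i)))"
      unfolding \<phi>[of x] absolute_value_mult[OF u, symmetric] by (rule absolute_value_sum[OF u])
    also have "\<dots> \<le> (\<Sum>i<D. C * (spectral_radius (a i) * spectral_radius x) * u (\<phi> (b i)))"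
    proof (intro sum_mono mult_right_mono absolute_value_nonneg[OF u])
      fix i assume "i \<in> {..<D}"
      then have "u (crd i x) \<le> C * spectral_radius (a i * x)" using C a by simp
      also have "\<dots> \<le> C * (spectral_radius (a i) * spectral_radius x)"
        by (intro mult_left_mono spectral_radius_mult C0)
      finally show "u (crd i x) \<le> C * (spectral_radius (a i) * spectral_radius x)" .
    qed
    also have "\<dots> = (\<Sum>i<D. C * spectral_radius (a i) * u (\<phi> (b i))) * spectral_radius x"
      by (simp add: sum_distrib_left mult_ac)
    finally show ?thesis .
  qed
  then show ?thesis by blast
qed

end

section \<open>Local bases\<close>

text \<open>The elements \<open>y 0, \<dots>, y (m - 1)\<close> of \<open>K\<close> are a basis of the completion \<open>K\<^sub>w\<close> over the
  completion of the rationals; this is expressed inside \<open>K\<close>.\<close>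

definition local_basis :: "(rat \<Rightarrow> real) \<Rightarrow> ('k::field_char_0 \<Rightarrow> real) \<Rightarrow> nat \<Rightarrow> (nat \<Rightarrow> 'k) \<Rightarrow> bool" where
  "local_basis u w m y \<longleftrightarrow>
     (\<exists>c>0. \<forall>a. \<forall>j<m. c * u (a j) \<le> w (\<Sum>i<m. of_rat (a i) * y i)) \<and>
     (\<forall>z. \<forall>\<epsilon>>0. \<exists>a. w (z - (\<Sum>i<m. of_rat (a i) * y i)) < \<epsilon>)"

context number_field_place
begin

text \<open>One constant \<open>c\<close> for all places of \<open>S\<close>. The local bases form a
  single family indexed by pairs of a place and an index, which will also index the global
  basis.\<close>

definition uniform_bases where
  "uniform_bases S m y c \<longleftrightarrow> c > 0 \<and>
     (\<forall>w\<in>S. \<forall>a. \<forall>j<m w. c * u (a j) \<le> w (\<Sum>i<m w. of_rat (a i) * (y (w, i) :: 'k)))"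

text \<open>In the product of the completions, \<open>e p\<close> approximates the vector with entry
  \<open>y p\<close> at the place of \<open>p\<close> and entry 0 at the other places of
  \<open>S\<close>.\<close>

definition perturbation where
  "perturbation S y \<epsilon> e \<longleftrightarrow>
     (\<forall>p v. fst p \<in> S \<longrightarrow> v \<in> S \<longrightarrow> v (e p - (if v = fst p then (y p :: 'k) else 0)) \<le> \<epsilon>)"

lemma uniform_basesD:
  assumes "uniform_bases S m y c"
  shows "c > 0" "w \<in> S \<Longrightarrow> j < m w \<Longrightarrow> c * u (a j) \<le> w (\<Sum>i<m w. of_rat (a i) * (y (w, i) :: 'k))"
  using assms by (auto simp: uniform_bases_def)

lemma perturbationD:
  "perturbation S y \<epsilon> e \<Longrightarrow> fst p \<in> S \<Longrightarrow> v \<in> S \<Longrightarrow> v (e p - (if v = fst p then (y p :: 'k) else 0)) \<le> \<epsilon>"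
  unfolding perturbation_def by blast

text \<open>A family satisfying the lower bound is independent over the rationals, so its length is
  at most \<open>D\<close>. One of maximal length is dense: an element \<open>z\<close> at positive
  distance from its span could be appended.\<close>

lemma local_basis_exists:
  assumes w: "w \<in> extensions u"
  shows "\<exists>m y. local_basis u (w :: 'k \<Rightarrow> real) m y"
proof -
  note av = extensionsD(1)[OF w]
  define indep where "indep = (\<lambda>m (y :: nat \<Rightarrow> 'k) c. c > (0::real) \<and>
    (\<forall>a. \<forall>j<m. c * u (a j) \<le> w (\<Sum>i<m. of_rat (a i) * y i)))"
  have le: "m \<le> D" if "indep m y c" for m y c
  proof (rule rat_independent_le)
    show "rat_independent m y"
      unfolding rat_independent_def
    proof (intro allI impI)
      fix a j assume a: "(\<Sum>i<m. of_rat (a i) * y i) = 0" and j: "j < m"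
      then have "c * u (a j) \<le> 0" using that absolute_value_0[OF av] by (auto simp: indep_def) metis
      then have "u (a j) \<le> 0" using that by (auto simp: indep_def mult_le_0_iff)
      then show "a j = 0" using absolute_value_pos[OF u, of "a j"] by fastforce
    qed
  qed
  obtain m y c where m: "indep m y c" and max: "\<And>y c. \<not> indep (Suc m) y c"
  proof -
    have "\<not> (\<forall>m. (\<exists>y c. indep m y c) \<longrightarrow> (\<exists>y c. indep (Suc m) y c))"
    proof
      assume step: "\<forall>m. (\<exists>y c. indep m y c) \<longrightarrow> (\<exists>y c. indep (Suc m) y c)"
      have "\<exists>y c. indep m y c" for m
      proof (induction m)
        case 0
        show ?case by (auto simp: indep_def intro: exI[of _ 1])
      qed (use step in blast)
      then obtain y c where "indep (Suc D) y c" by blast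
      then show False using le by fastforce
    qed
    then show ?thesis using that by blast
  qed
  have "\<exists>a. w (z - (\<Sum>i<m. of_rat (a i) * y i)) < \<epsilon>" if \<epsilon>: "\<epsilon> > 0" for z \<epsilon>
  proof (rule ccontr)
    assume "\<not> ?thesis"
    then have far: "\<epsilon> \<le> w (z - (\<Sum>i<m. of_rat (a i) * y i))" for a by (meson not_le)
    \<comment> \<open>\<epsilon> serves the coefficient of \<open>z\<close>; for the others, the sum
      \<open>s\<close> without \<open>z\<close> is at most \<open>1 + w z / \<epsilon>\<close> times
      the whole combination.\<close>
    define c' where "c' = min \<epsilon> (c / (1 + w z / \<epsilon>))"
    have c: "c > 0" using m by (simp add: indep_def)
    have wz: "0 \<le> w z" by (rule absolute_value_nonneg[OF av])
    then have c': "c' > 0" "c' \<le> \<epsilon>" "c' * (1 + w z / \<epsilon>) \<le> c"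
      using \<epsilon> c by (auto simp: c'_def min_le_iff_disj add_pos_nonneg min_mult_distrib_right)
    have "c' * u (a j) \<le> w (\<Sum>i<Suc m. of_rat (a i) * (y(m := z)) i)" if j: "j < Suc m" for a j
    proof -
      define s where "s = (\<Sum>i<m. of_rat (a i) * y i)"
      have sum: "(\<Sum>i<Suc m. of_rat (a i) * (y(m := z)) i) = s + of_rat (a m) * z"
        by (simp add: s_def)
      have last: "\<epsilon> * u (a m) \<le> w (s + of_rat (a m) * z)"
      proof (cases "a m = 0")
        case True
        then show ?thesis by (simp add: absolute_value_0[OF u] absolute_value_nonneg[OF av])
      next
        case False
        \<comment> \<open>Division by \<open>a m\<close> exhibits the combination as a multiple of
          the difference between \<open>z\<close> and an element of the old span.\<close>
        have "s + of_rat (a m) * z = of_rat (a m) * (z - (\<Sum>i<m. of_rat (- a i / a m) * y i))"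
          using False by (simp add: s_def algebra_simps sum_distrib_left of_rat_divide of_rat_minus sum_negf)
        then have "w (s + of_rat (a m) * z) = u (a m) * w (z - (\<Sum>i<m. of_rat (- a i / a m) * y i))"
          by (simp only: absolute_value_mult[OF av] extensionsD(2)[OF w])
        then show ?thesis
          using mult_left_mono[OF far absolute_value_nonneg[OF u, of "a m"]] by (simp add: mult.commute)
      qed
      show ?thesis
      proof (cases "j = m")
        case True
        have "c' * u (a m) \<le> \<epsilon> * u (a m)"
          by (intro mult_right_mono c' absolute_value_nonneg[OF u])
        then show ?thesis using last unfolding sum True by linarith
      next
        case False
        then have j: "j < m" using j by simp
        have "c * u (a j) \<le> w s" using m j by (simp add: indep_def s_def)
        also have "w s \<le> w (s + of_rat (a m) * z) + w (of_rat (a m) * z)"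
          using absolute_value_diff_triangle[OF av, of "s + of_rat (a m) * z" "of_rat (a m) * z"] by simp
        also have "w (of_rat (a m) * z) = u (a m) * w z"
          by (simp add: absolute_value_mult[OF av] extensionsD(2)[OF w])
        also have "\<dots> \<le> w (s + of_rat (a m) * z) / \<epsilon> * w z"
          using last \<epsilon> wz by (intro mult_right_mono) (auto simp: field_simps)
        finally have *: "c * u (a j) \<le> (1 + w z / \<epsilon>) * w (s + of_rat (a m) * z)"
          by (simp add: algebra_simps)
        have "(1 + w z / \<epsilon>) * (c' * u (a j)) \<le> c * u (a j)"
          using mult_right_mono[OF c'(3) absolute_value_nonneg[OF u, of "a j"]] by (simp add: mult_ac)
        also note *
        finally show ?thesis
          unfolding sum using \<epsilon> wz by (simp add: add_pos_nonneg)
      qed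
    qed
    then have "indep (Suc m) (y(m := z)) c'" using c' by (simp add: indep_def)
    then show False using max by blast
  qed
  then have "local_basis u w m y" using m by (auto simp: local_basis_def indep_def)
  then show ?thesis by blast
qed

lemma local_basis_pos:
  assumes w: "w \<in> extensions u" and y: "local_basis u (w :: 'k \<Rightarrow> real) m y"
  shows "0 < m"
proof (rule ccontr)
  assume "\<not> 0 < m"
  then have "w (1 - 0) < 1"
    using y unfolding local_basis_def by (auto dest: spec[of _ 1])
  then show False using absolute_value_1[OF extensionsD(1)[OF w]] by simp
qed

text \<open>A family \<open>e\<close> close to the local bases \<open>y\<close> and small at the other places is, up to a
  perturbation, a basis of the product of the completions.\<close>

lemma perturbed_local_bases:
  fixes S :: "('k \<Rightarrow> real) set" and m :: "('k \<Rightarrow> real) \<Rightarrow> nat" and y e :: "('k \<Rightarrow> real) \<times> nat \<Rightarrow> 'k"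
  defines "I \<equiv> Sigma S (\<lambda>w. {..<m w})"
  assumes S: "finite S" "S \<subseteq> extensions u"
    and ub: "uniform_bases S m y c"
    and \<epsilon>: "real (card I) * \<epsilon> \<le> c / 2"
    and pe: "perturbation S y \<epsilon> e"
  shows "p0 \<in> I \<Longrightarrow> \<exists>w\<in>S. c / 2 * u (a p0) \<le> w (\<Sum>p\<in>I. of_rat (a p) * e p)"
    and "w \<in> S \<Longrightarrow> w (z - (\<Sum>i<m w. of_rat (a (w, i)) * y (w, i))) \<le> \<delta> \<Longrightarrow>
      (\<And>p. p \<in> I \<Longrightarrow> u (a p) \<le> A) \<Longrightarrow> 0 \<le> A \<Longrightarrow>
      w (z - (\<Sum>p\<in>I. of_rat (a p) * e p)) \<le> \<delta> + c / 2 * A"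
proof -
  note c = uniform_basesD[OF ub]
  have e: "v (e p - (if v = fst p then y p else 0)) \<le> \<epsilon>" if "p \<in> I" "v \<in> S" for p v
    using perturbationD[OF pe, of p v] that by (auto simp: I_def)
  have fin: "finite I" using S by (simp add: I_def)
  \<comment> \<open>At the place \<open>w\<close> the sum consists of the block of indices belonging
    to \<open>w\<close>, formed with the exact local basis, and an error.\<close>
  have split: "(\<Sum>p\<in>I. of_rat (a p) * e p) =
      (\<Sum>i<m w. of_rat (a (w, i)) * y (w, i)) + (\<Sum>p\<in>I. of_rat (a p) * (e p - (if w = fst p then y p else 0)))"
    if "w \<in> S" for w and a :: "('k \<Rightarrow> real) \<times> nat \<Rightarrow> rat"
  proof -
    have "(\<Sum>p\<in>I. of_rat (a p) * (if w = fst p then y p else 0)) = (\<Sum>p\<in>Pair w ` {..<m w}. of_rat (a p) * y p)"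
      using fin \<open>w \<in> S\<close> by (intro sum.mono_neutral_cong_right) (auto simp: I_def)
    also have "\<dots> = (\<Sum>i<m w. of_rat (a (w, i)) * y (w, i))"
      by (subst sum.reindex) (auto simp: inj_on_def)
    finally show ?thesis by (simp add: right_diff_distrib sum_subtractf)
  qed
  have small: "w (\<Sum>p\<in>I. of_rat (a p) * (e p - (if w = fst p then y p else 0))) \<le> c / 2 * A"
    if "w \<in> S" "\<And>p. p \<in> I \<Longrightarrow> u (a p) \<le> A" "0 \<le> A" for w a A
  proof -
    have w: "w \<in> extensions u" using that S by auto
    note av = extensionsD(1)[OF w]
    have "w (\<Sum>p\<in>I. of_rat (a p) * (e p - (if w = fst p then y p else 0))) \<le>
        (\<Sum>p\<in>I. w (of_rat (a p) * (e p - (if w = fst p then y p else 0))))"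
      by (rule absolute_value_sum[OF av])
    also have "\<dots> \<le> (\<Sum>p\<in>I. A * \<epsilon>)"
      unfolding absolute_value_mult[OF av] extensionsD(2)[OF w]
      by (intro sum_mono mult_mono that e absolute_value_nonneg[OF av])
    also have "\<dots> \<le> c / 2 * A" using mult_right_mono[OF \<epsilon> that(3)] by (simp add: mult_ac)
    finally show ?thesis .
  qed
  {
    assume p0: "p0 \<in> I"
    \<comment> \<open>The largest coefficient decides: at its own place the block has size at least
      \<open>c * A\<close>, and the error is at most half of that.\<close>
    define A where "A = Max ((\<lambda>p. u (a p)) ` I)"
    have "A \<in> (\<lambda>p. u (a p)) ` I" unfolding A_def using fin p0 by (intro Max_in) auto
    then obtain p where p: "p \<in> I" "A = u (a p)" by auto
    have A: "u (a q) \<le> A" if "q \<in> I" for q using fin that by (simp add: A_def)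
    have A0: "0 \<le> A" using p(2) absolute_value_nonneg[OF u] by simp
    obtain w j where wj: "p = (w, j)" "w \<in> S" "j < m w" using p by (auto simp: I_def)
    have w: "absolute_value w" using wj S extensionsD(1) by auto
    have "c * A \<le> w (\<Sum>i<m w. of_rat (a (w, i)) * y (w, i))"
      using c(2)[of w j "\<lambda>i. a (w, i)"] wj p by simp
    moreover have "w (\<Sum>p\<in>I. of_rat (a p) * (e p - (if w = fst p then y p else 0))) \<le> c / 2 * A"
      using small wj A A0 by blast
    moreover have "w (\<Sum>i<m w. of_rat (a (w, i)) * y (w, i)) -
        w (\<Sum>p\<in>I. of_rat (a p) * (e p - (if w = fst p then y p else 0))) \<le> w (\<Sum>p\<in>I. of_rat (a p) * e p)"
      unfolding split[OF wj(2)] by (rule absolute_value_diff_ge[OF w])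
    ultimately have "c / 2 * A \<le> w (\<Sum>p\<in>I. of_rat (a p) * e p)" by linarith
    moreover have "c / 2 * u (a p0) \<le> c / 2 * A" using A[OF p0] c(1) by simp
    ultimately show "\<exists>w\<in>S. c / 2 * u (a p0) \<le> w (\<Sum>p\<in>I. of_rat (a p) * e p)"
      using wj(2) by (meson order_trans)
  }
  {
    assume w: "w \<in> S" and near: "w (z - (\<Sum>i<m w. of_rat (a (w, i)) * y (w, i))) \<le> \<delta>"
      and A: "\<And>p. p \<in> I \<Longrightarrow> u (a p) \<le> A" "0 \<le> A"
    have av: "absolute_value w" using w S extensionsD(1) by auto
    have "w (\<Sum>p\<in>I. of_rat (a p) * (e p - (if w = fst p then y p else 0))) \<le> c / 2 * A"
      using small w A by blast
    then show "w (z - (\<Sum>p\<in>I. of_rat (a p) * e p)) \<le> \<delta> + c / 2 * A"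
      using near absolute_value_diff_triangle[OF av, of "z - (\<Sum>i<m w. of_rat (a (w, i)) * y (w, i))"
        "\<Sum>p\<in>I. of_rat (a p) * (e p - (if w = fst p then y p else 0))"]
      unfolding split[OF w] diff_diff_eq by linarith
  }
qed

lemma perturbation_exists:
  fixes S :: "('k \<Rightarrow> real) set" and y :: "('k \<Rightarrow> real) \<times> nat \<Rightarrow> 'k"
  assumes S: "finite S" "S \<subseteq> extensions u" and \<epsilon>: "\<epsilon> > 0"
  shows "\<exists>e. perturbation S y \<epsilon> e"
proof -
  have "\<exists>x. \<forall>v\<in>S. v (x - (if v = fst p then y p else 0)) \<le> \<epsilon>" if "fst p \<in> S" for p
  proof -
    obtain x where "fst p (x - y p) < \<epsilon>" "\<forall>v\<in>S - {fst p}. v x < \<epsilon>"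
      using weak_approximation[OF S \<open>fst p \<in> S\<close> \<epsilon>] by blast
    then show ?thesis by (intro exI[of _ x]) (auto simp: less_imp_le)
  qed
  then show ?thesis unfolding perturbation_def by metis
qed

lemma sum_reindex_combination:
  assumes "bij_betw idx {..<n} I"
  shows "(\<Sum>i<n. of_rat (c i) * e (idx i) :: 'k) = (\<Sum>p\<in>I. of_rat (c (inv_into {..<n} idx p)) * e p)"
  using sum.reindex_bij_betw[OF assms, of "\<lambda>p. of_rat (c (inv_into {..<n} idx p)) * e p"] assms
  by (simp add: bij_betw_def inv_into_f_f)

lemma uniform_bases_exist:
  fixes S :: "('k \<Rightarrow> real) set"
  assumes S: "finite S" and y: "\<And>w. w \<in> S \<Longrightarrow> local_basis u w (m w) (\<lambda>i. y (w, i))"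
  shows "\<exists>c. uniform_bases S m y c"
proof -
  have "\<forall>w\<in>S. \<exists>c>0. \<forall>a. \<forall>j<m w. c * u (a j) \<le> w (\<Sum>i<m w. of_rat (a i) * y (w, i))"
    using y unfolding local_basis_def by blast
  then obtain c where c: "\<And>w. w \<in> S \<Longrightarrow> c w > (0::real)"
    "\<And>w a j. w \<in> S \<Longrightarrow> j < m w \<Longrightarrow> c w * u (a j) \<le> w (\<Sum>i<m w. of_rat (a i) * y (w, i))"
    by metis
  \<comment> \<open>The inserted 1 makes the minimum exist for empty \<open>S\<close>.\<close>
  define d where "d = Min (insert 1 (c ` S))"
  have d: "d > 0" "\<And>w. w \<in> S \<Longrightarrow> d \<le> c w" using S c(1) by (auto simp: d_def)
  have "d * u (a j) \<le> w (\<Sum>i<m w. of_rat (a i) * y (w, i))" if "w \<in> S" "j < m w" for w a j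
    using mult_right_mono[OF d(2)[OF that(1)] absolute_value_nonneg[OF u]] c(2)[OF that] order_trans by blast
  then show ?thesis using d(1) unfolding uniform_bases_def by blast
qed

text \<open>The lower bound at some place forces the coefficients of a vanishing combination to be
  0. \<open>S\<close> is an arbitrary finite set of extensions, so that the number of extensions
  itself can be bounded in this way.\<close>

lemma perturbed_rat_independent:
  fixes S :: "('k \<Rightarrow> real) set" and m :: "('k \<Rightarrow> real) \<Rightarrow> nat" and y e :: "('k \<Rightarrow> real) \<times> nat \<Rightarrow> 'k"
  defines "I \<equiv> Sigma S (\<lambda>w. {..<m w})"
  assumes S: "finite S" "S \<subseteq> extensions u"
    and ub: "uniform_bases S m y c"
    and \<epsilon>: "real (card I) * \<epsilon> \<le> c / 2"
    and pe: "perturbation S y \<epsilon> e"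
    and idx: "bij_betw idx {..<card I} I"
  shows "rat_independent (card I) (e \<circ> idx)"
  unfolding rat_independent_def
proof (intro allI impI)
  note c = uniform_basesD[OF ub]
  fix g i assume g: "(\<Sum>i<card I. of_rat (g i) * (e \<circ> idx) i) = 0" and i: "i < card I"
  define a where "a = (\<lambda>p. g (inv_into {..<card I} idx p))"
  have 0: "(\<Sum>p\<in>I. of_rat (a p) * e p) = 0"
    using g sum_reindex_combination[OF idx, of g e] by (simp add: a_def)
  have "idx i \<in> I" using idx i by (auto simp: bij_betw_def)
  then obtain w where w: "w \<in> S" "c / 2 * u (a (idx i)) \<le> w 0"
    using perturbed_local_bases(1)[OF S ub \<epsilon>[unfolded I_def] pe, of "idx i" a] 0 unfolding I_def by auto
  then have "u (a (idx i)) \<le> 0"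
    using c(1) absolute_value_0[of w] extensionsD(1)[of w] S by (auto simp: mult_le_0_iff)
  then have "a (idx i) = 0" using absolute_value_pos[OF u, of "a (idx i)"] by fastforce
  then show "g i = 0" using i idx by (simp add: a_def bij_betw_def inv_into_f_f)
qed

text \<open>With all places over \<open>u\<close> present, the perturbed family also spans. Summing
  a series of corrections would require completeness; instead, a functional that vanishes on the
  family and is bounded by the spectral radius is shown to vanish.\<close>

lemma perturbed_rat_basis:
  fixes m :: "('k \<Rightarrow> real) \<Rightarrow> nat" and y e :: "('k \<Rightarrow> real) \<times> nat \<Rightarrow> 'k"
  defines "I \<equiv> Sigma (extensions u) (\<lambda>w. {..<m w})"
  assumes fin: "finite (extensions u :: ('k \<Rightarrow> real) set)"
    and y: "\<forall>w\<in>extensions u. local_basis u w (m w) (\<lambda>i. y (w, i))"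
    and ub: "uniform_bases (extensions u) m y c"
    and \<epsilon>: "real (card I) * \<epsilon> \<le> c / 2"
    and pe: "perturbation (extensions u) y \<epsilon> e"
    and idx: "bij_betw idx {..<card I} I"
  shows "card I = D \<and> (\<exists>crd'. rat_basis D (e \<circ> idx) crd' \<and>
    (\<forall>z. \<forall>i<D. c / 2 * u (crd' i z) \<le> spectral_radius z))"
proof -
  note c = uniform_basesD[OF ub]
  note pert = perturbed_local_bases[OF fin subset_refl ub \<epsilon>[unfolded I_def] pe, folded I_def]
  have approx: "\<exists>a. spectral_radius (z - (\<Sum>p\<in>I. of_rat (a p) * e p)) \<le> 3 / 4 * spectral_radius z" for z
  proof (cases "z = 0")
    case True
    then show ?thesis
      using spectral_seminorm_0[OF u spectral_seminorm_spectral_radius] by (intro exI[of _ "\<lambda>_. 0"]) simp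
  next
    case False
    define r where "r = spectral_radius z"
    have r: "r > 0" using spectral_seminorm_pos[OF u spectral_seminorm_spectral_radius False] by (simp add: r_def)
    have "\<forall>w\<in>extensions u. \<exists>a. w (z - (\<Sum>i<m w. of_rat (a i) * y (w, i))) < r / 8"
    proof
      fix w :: "'k \<Rightarrow> real" assume "w \<in> extensions u"
      moreover have "r / 8 > 0" using r by simp
      ultimately show "\<exists>a. w (z - (\<Sum>i<m w. of_rat (a i) * y (w, i))) < r / 8"
        using y unfolding local_basis_def by blast
    qed
    then obtain a where a: "\<And>w. w \<in> extensions u \<Longrightarrow> w (z - (\<Sum>i<m w. of_rat (a w i) * y (w, i))) < r / 8"
      by metis
    define a' where "a' = (\<lambda>p. a (fst p) (snd p))"
    have A: "u (a' p) \<le> 9 / 8 * r / c" if "p \<in> I" for p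
    proof -
      obtain w j where p: "p = (w, j)" "w \<in> extensions u" "j < m w" using \<open>p \<in> I\<close> by (auto simp: I_def)
      note av = extensionsD(1)[OF p(2)]
      have "c * u (a w j) \<le> w (\<Sum>i<m w. of_rat (a w i) * y (w, i))" using c(2) p by blast
      also have "\<dots> \<le> w z + w (z - (\<Sum>i<m w. of_rat (a w i) * y (w, i)))"
        using absolute_value_diff_triangle[OF av, of z "z - (\<Sum>i<m w. of_rat (a w i) * y (w, i))"] by simp
      also have "\<dots> \<le> r + r / 8"
        using a[OF p(2)] extension_le_spectral_radius[OF p(2), of z] by (simp add: r_def)
      finally show ?thesis using c(1) by (simp add: a'_def p field_simps)
    qed
    have le: "w (z - (\<Sum>p\<in>I. of_rat (a' p) * e p)) \<le> 3 / 4 * r" if w: "w \<in> extensions u" for w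
    proof -
      \<comment> \<open>Local density costs \<open>r / 8\<close> and the perturbation
        \<open>9 / 16 * r\<close>; the total \<open>11 / 16 * r\<close> is below
        \<open>3 / 4 * r\<close>. Any relative error less than 1 would serve the iteration.\<close>
      have "w (z - (\<Sum>p\<in>I. of_rat (a' p) * e p)) \<le> r / 8 + c / 2 * (9 / 8 * r / c)"
        by (rule pert(2)[OF w]) (use a[OF w] A r c(1) in \<open>auto simp: a'_def less_imp_le\<close>)
      also have "\<dots> \<le> 3 / 4 * r" using r c(1) by simp
      finally show ?thesis .
    qed
    \<comment> \<open>The spectral radius is attained at some place, so bounds at all places bound
      it.\<close>
    obtain w where "w \<in> extensions u"
      "w (z - (\<Sum>p\<in>I. of_rat (a' p) * e p)) = spectral_radius (z - (\<Sum>p\<in>I. of_rat (a' p) * e p))"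
      using spectral_radius_attained by blast
    then have "spectral_radius (z - (\<Sum>p\<in>I. of_rat (a' p) * e p)) \<le> 3 / 4 * spectral_radius z"
      using le[of w] by (simp add: r_def)
    then show ?thesis by blast
  qed
  have ind: "rat_independent (card I) (e \<circ> idx)"
    unfolding I_def
    by (rule perturbed_rat_independent[OF fin subset_refl ub \<epsilon>[unfolded I_def] pe idx[unfolded I_def]])
  have span: "\<exists>g. z = (\<Sum>i<card I. of_rat (g i) * (e \<circ> idx) i)" for z
  proof (rule ccontr)
    assume "\<not> ?thesis"
    then obtain \<phi> :: "'k \<Rightarrow> rat" where \<phi>: "\<And>x y. \<phi> (x + y) = \<phi> x + \<phi> y" "\<And>q x. \<phi> (of_rat q * x) = q * \<phi> x"
        "\<And>i. i < card I \<Longrightarrow> \<phi> ((e \<circ> idx) i) = 0" "\<phi> z = 1"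
      using rat_functional_exists[where z = z and n = "card I" and e = "e \<circ> idx"] by blast
    obtain C where C: "\<And>x. u (\<phi> x) \<le> C * spectral_radius x"
      using functional_le_spectral_radius[of \<phi>] \<phi> by blast
    have \<phi>e: "\<phi> (e p) = 0" if "p \<in> I" for p
    proof -
      have "p \<in> idx ` {..<card I}" using that bij_betw_imp_surj_on[OF idx] by simp
      then obtain i where "i < card I" "p = idx i" by auto
      then show ?thesis using \<phi>(3) by simp
    qed
    have \<phi>diff: "\<phi> (x - (\<Sum>p\<in>I. of_rat (a p) * e p)) = \<phi> x" for x a
    proof -
      have "\<phi> (\<Sum>p\<in>J. of_rat (a p) * e p) = (\<Sum>p\<in>J. a p * \<phi> (e p))" for J
        using \<phi>(2)[of 0 0] by (induction J rule: infinite_finite_induct) (auto simp: \<phi>(1,2))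
      then have "\<phi> (\<Sum>p\<in>I. of_rat (a p) * e p) = 0" using \<phi>e by simp
      then show ?thesis using \<phi>(1)[of "x - (\<Sum>p\<in>I. of_rat (a p) * e p)" "\<Sum>p\<in>I. of_rat (a p) * e p"] by simp
    qed
    \<comment> \<open>Subtracting an approximation of \<open>x\<close> leaves the value of
      \<open>\<phi>\<close> unchanged while the spectral radius shrinks by the factor
      \<open>3 / 4\<close>.\<close>
    have bound: "u (\<phi> x) \<le> \<bar>C\<bar> * ((3 / 4) ^ k * spectral_radius x)" for k x
    proof (induction k arbitrary: x)
      case 0
      have "C * spectral_radius x \<le> \<bar>C\<bar> * spectral_radius x"
        by (intro mult_right_mono spectral_radius_nonneg) simp
      then show ?case using C[of x] by simp
    next
      case (Suc k)
      obtain a where a: "spectral_radius (x - (\<Sum>p\<in>I. of_rat (a p) * e p)) \<le> 3 / 4 * spectral_radius x"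
        using approx by blast
      have "u (\<phi> x) \<le> \<bar>C\<bar> * ((3 / 4) ^ k * spectral_radius (x - (\<Sum>p\<in>I. of_rat (a p) * e p)))"
        using Suc[of "x - (\<Sum>p\<in>I. of_rat (a p) * e p)"] by (simp add: \<phi>diff)
      also have "\<dots> \<le> \<bar>C\<bar> * ((3 / 4) ^ k * (3 / 4 * spectral_radius x))"
        by (intro mult_left_mono a) auto
      finally show ?case by (simp add: mult_ac)
    qed
    have "(\<lambda>k. \<bar>C\<bar> * ((3 / 4) ^ k * spectral_radius z)) \<longlonglongrightarrow> \<bar>C\<bar> * (0 * spectral_radius z)"
      by (intro tendsto_intros LIMSEQ_realpow_zero) auto
    then have "u (\<phi> z) \<le> \<bar>C\<bar> * (0 * spectral_radius z)"
      using bound by (intro LIMSEQ_le_const) auto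
    then show False using \<phi>(4) absolute_value_1[OF u] by simp
  qed
  obtain crd' where crd': "rat_basis (card I) (e \<circ> idx) crd'"
    using rat_basisI[OF ind span] by blast
  then have card: "card I = D" using rat_basis.dimension_eq dimension_eq by metis
  have "c / 2 * u (crd' i z) \<le> spectral_radius z" if i: "i < D" for z i
  proof -
    define a where "a = (\<lambda>p. crd' (inv_into {..<D} idx p) z)"
    have "z = (\<Sum>i<card I. of_rat (crd' i z) * e (idx i))"
      using rat_basis.expand[OF crd', of z] by simp
    also have "\<dots> = (\<Sum>p\<in>I. of_rat (a p) * e p)"
      using sum_reindex_combination[OF idx, of "\<lambda>i. crd' i z" e] by (simp add: a_def card)
    finally have z: "z = (\<Sum>p\<in>I. of_rat (a p) * e p)" .
    have "idx i \<in> I" using idx i card by (auto simp: bij_betw_def)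
    then obtain w where w: "w \<in> extensions u" "c / 2 * u (a (idx i)) \<le> w z"
      using pert(1)[of "idx i" a] z by auto
    moreover have "a (idx i) = crd' i z" using i idx card by (simp add: a_def bij_betw_def inv_into_f_f)
    ultimately show ?thesis using extension_le_spectral_radius[OF w(1), of z] by simp
  qed
  then show ?thesis using crd' card by auto
qed

text \<open>Perturbed local bases over any finite set of places are independent over the rationals,
  and every place contributes at least one vector; hence there are at most \<open>D\<close>
  places.\<close>

lemma finite_extensions: "finite (extensions u :: ('k \<Rightarrow> real) set)"
proof -
  have "\<forall>w\<in>extensions u. \<exists>m y. local_basis u (w :: 'k \<Rightarrow> real) m y"
    using local_basis_exists by blast
  then obtain m y where my: "\<And>w :: 'k \<Rightarrow> real. w \<in> extensions u \<Longrightarrow> local_basis u w (m w) (y w)"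
    by metis
  define y' where "y' = (\<lambda>p. y (fst p) (snd p))"
  have "card S \<le> D" if S: "S \<subseteq> extensions u" "finite S" for S :: "('k \<Rightarrow> real) set"
  proof -
    define I where "I = Sigma S (\<lambda>w. {..<m w})"
    have fin: "finite I" using S by (simp add: I_def)
    have "local_basis u w (m w) (\<lambda>i. y' (w, i))" if "w \<in> S" for w
      using my that S(1) by (auto simp: y'_def)
    then obtain c where ub: "uniform_bases S m y' c"
      using uniform_bases_exist[OF S(2), of m y'] by blast
    note c = uniform_basesD[OF ub]
    define \<epsilon> where "\<epsilon> = c / (2 * (real (card I) + 1))"
    have \<epsilon>: "\<epsilon> > 0" "real (card I) * \<epsilon> \<le> c / 2"
      using c(1) by (auto simp: \<epsilon>_def field_simps)
    obtain e where pe: "perturbation S y' \<epsilon> e"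
      using perturbation_exists[OF S(2,1) \<epsilon>(1), of y'] by blast
    obtain idx where idx: "bij_betw idx {..<card I} I"
      using ex_bij_betw_nat_finite[OF fin] by (auto simp: atLeast0LessThan)
    have "rat_independent (card I) (e \<circ> idx)"
      unfolding I_def
      by (rule perturbed_rat_independent[OF S(2,1) ub \<epsilon>(2)[unfolded I_def] pe idx[unfolded I_def]])
    then have "card I \<le> D" by (rule rat_independent_le)
    moreover have "card I = (\<Sum>w\<in>S. m w)" unfolding I_def using S(2) by simp
    moreover have "(\<Sum>w\<in>S. 1) \<le> (\<Sum>w\<in>S. m w)"
      using local_basis_pos[OF _ my] S(1) by (intro sum_mono) (auto simp: Suc_le_eq)
    ultimately show ?thesis by simp
  qed
  then show ?thesis using finite_if_finite_subsets_card_bdd by metis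
qed

text \<open>For each \<open>N\<close> the basis is chosen so close to the local bases that a vector
  belonging to \<open>w\<close> is dominated by \<open>w\<close> even after multiplication by
  \<open>x ^ N\<close>. The constants \<open>c\<close> and \<open>Y\<close> do not depend on
  \<open>N\<close>, so roots can be taken.\<close>

theorem extensions_structure:
  assumes my: "\<And>w :: 'k \<Rightarrow> real. w \<in> extensions u \<Longrightarrow> local_basis u w (m w) (y w)"
  shows "(\<Sum>w\<in>extensions u. m w) = D"
    and "x \<noteq> 0 \<Longrightarrow> u (field_norm x) \<le> (\<Prod>w\<in>extensions u. w x ^ m w)"
proof -
  let ?E = "extensions u :: ('k \<Rightarrow> real) set"
  define y' where "y' = (\<lambda>p. y (fst p) (snd p))"
  have y': "local_basis u w (m w) (\<lambda>i. y' (w, i))" if "w \<in> ?E" for w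
    using my[OF that] by (simp add: y'_def)
  define I where "I = Sigma ?E (\<lambda>w. {..<m w})"
  have fin: "finite I" using finite_extensions by (simp add: I_def)
  have cardI: "card I = (\<Sum>w\<in>?E. m w)" unfolding I_def using finite_extensions by simp
  obtain c where ub: "uniform_bases ?E m y' c"
    using uniform_bases_exist[OF finite_extensions, of m y'] y' by blast
  note c = uniform_basesD[OF ub]
  obtain idx where idx: "bij_betw idx {..<card I} I"
    using ex_bij_betw_nat_finite[OF fin] by (auto simp: atLeast0LessThan)
  have basis: "card I = D \<and> (\<exists>e crd'. perturbation ?E y' \<epsilon> e \<and>
      rat_basis D (e \<circ> idx) crd' \<and> (\<forall>z. \<forall>i<D. c / 2 * u (crd' i z) \<le> spectral_radius z))"
    if \<epsilon>: "\<epsilon> > 0" "real (card I) * \<epsilon> \<le> c / 2" for \<epsilon>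
  proof -
    obtain e where pe: "perturbation ?E y' \<epsilon> e"
      using perturbation_exists[OF finite_extensions subset_refl \<epsilon>(1), of y'] by blast
    have y'': "\<forall>w\<in>?E. local_basis u w (m w) (\<lambda>i. y' (w, i))" using y' by blast
    show ?thesis
      using perturbed_rat_basis[OF finite_extensions y'' ub \<epsilon>(2)[unfolded I_def] pe idx[unfolded I_def]] pe
      unfolding I_def by blast
  qed
  define \<epsilon>0 where "\<epsilon>0 = c / (2 * (real (card I) + 1))"
  have \<epsilon>0: "\<epsilon>0 > 0" "real (card I) * \<epsilon>0 \<le> c / 2"
    using c(1) by (auto simp: \<epsilon>0_def field_simps)
  have card: "card I = D" using basis[OF \<epsilon>0] by simp
  then show "(\<Sum>w\<in>?E. m w) = D" using cardI by simp
  assume x: "x \<noteq> 0"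
  have pos: "0 < w x" if "w \<in> ?E" for w
    using absolute_value_pos[OF extensionsD(1)[OF that] x] .
  \<comment> \<open>As long as \<epsilon> \<le> 1, this bounds every perturbed vector at its own
    place.\<close>
  define Y where "Y = 1 + (\<Sum>p\<in>I. fst p (y' p))"
  have nn: "0 \<le> fst p z" if "p \<in> I" for p z
    using that absolute_value_nonneg[OF extensionsD(1)] by (auto simp: I_def)
  have Y: "1 + fst p (y' p) \<le> Y" if "p \<in> I" for p
    unfolding Y_def using member_le_sum[of p I "\<lambda>p. fst p (y' p)"] that nn fin by simp
  have Y1: "1 \<le> Y" using nn by (simp add: Y_def sum_nonneg)
  show "u (field_norm x) \<le> (\<Prod>w\<in>?E. w x ^ m w)"
  proof (rule real_le_of_power_le)
    fix N
    \<comment> \<open>The quotients ensure \<open>\<epsilon> * v x ^ N \<le> w x ^ N\<close> for all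
      pairs of places: a vector of \<open>w\<close> has size at most \<epsilon> at another place
      \<open>v\<close>, so its product with \<open>x ^ N\<close> stays below \<open>w x ^ N\<close>
      there.\<close>
    define \<epsilon> where "\<epsilon> = Min ({1, \<epsilon>0} \<union> (\<lambda>(w, v). (w x / v x) ^ N) ` (?E \<times> ?E))"
    have finset: "finite ({1, \<epsilon>0} \<union> (\<lambda>(w, v). (w x / v x) ^ N) ` (?E \<times> ?E))"
      using finite_extensions by simp
    have \<epsilon>_pos: "\<epsilon> > 0" unfolding \<epsilon>_def using finset \<epsilon>0 pos by (subst Min_gr_iff) auto
    have \<epsilon>_le: "\<epsilon> \<le> 1" "\<epsilon> \<le> \<epsilon>0" unfolding \<epsilon>_def by (rule Min_le[OF finset]; simp)+
    have \<epsilon>_quot: "\<epsilon> * v x ^ N \<le> w x ^ N" if "w \<in> ?E" "v \<in> ?E" for w v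
    proof -
      have "\<epsilon> \<le> (w x / v x) ^ N" unfolding \<epsilon>_def using finset that by (intro Min_le) auto
      then show ?thesis using pos[OF that(2)] by (simp add: power_divide field_simps)
    qed
    have "real (card I) * \<epsilon> \<le> c / 2"
      using \<epsilon>0(2) mult_left_mono[OF \<epsilon>_le(2), of "real (card I)"] by linarith
    then obtain e crd' where pe: "perturbation ?E y' \<epsilon> e"
      and crd': "rat_basis D (e \<circ> idx) crd'" and bound: "\<And>z i. i < D \<Longrightarrow> c / 2 * u (crd' i z) \<le> spectral_radius z"
      using basis[OF \<epsilon>_pos] by blast
    interpret E: rat_basis D "e \<circ> idx" crd' by fact
    have e: "v (e p - (if v = fst p then y' p else 0)) \<le> \<epsilon>" if "p \<in> I" "v \<in> ?E" for p v
      using perturbationD[OF pe, of p v] that by (auto simp: I_def)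
    have idxI: "idx j \<in> I" if "j < D" for j using idx card that by (auto simp: bij_betw_def)
    have rad: "spectral_radius (x ^ N * e p) \<le> Y * fst p x ^ N" if p: "p \<in> I" for p
    proof -
      have w: "fst p \<in> ?E" using p by (auto simp: I_def)
      note avw = extensionsD(1)[OF w]
      obtain v where v: "v \<in> ?E" "v (x ^ N * e p) = spectral_radius (x ^ N * e p)"
        using spectral_radius_attained by blast
      note av = extensionsD(1)[OF v(1)]
      have "v x ^ N * v (e p) \<le> Y * fst p x ^ N"
      proof (cases "v = fst p")
        case True
        have "v (e p) \<le> v (e p - y' p) + v (y' p)"
          using absolute_value_triangle[OF av, of "e p - y' p" "y' p"] by simp
        also have "\<dots> \<le> Y" using e[OF p v(1)] \<epsilon>_le(1) Y[OF p] True by simp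
        finally show ?thesis using pos[OF w] True by (simp add: mult.commute mult_right_mono)
      next
        case False
        have "v x ^ N * v (e p) \<le> v x ^ N * \<epsilon>"
          using e[OF p v(1)] False pos[OF v(1)] by (intro mult_left_mono) auto
        also have "\<dots> \<le> 1 * fst p x ^ N" using \<epsilon>_quot[OF w v(1)] by (simp add: mult.commute)
        also have "\<dots> \<le> Y * fst p x ^ N" using Y1 pos[OF w] by (intro mult_right_mono) auto
        finally show ?thesis .
      qed
      then show ?thesis using v(2) by (simp add: absolute_value_mult[OF av] absolute_value_power[OF av])
    qed
    \<comment> \<open>Coordinates are at most \<open>2 / c\<close> times the spectral radius, so
      column \<open>j\<close> is governed by the place to which its basis vector belongs.\<close>
    have "u (E.field_norm (x ^ N)) \<le> fact D * (\<Prod>j<D. 2 / c * Y * fst (idx j) x ^ N)"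
      unfolding E.field_norm_def
    proof (rule absolute_value_det_le[OF u E.mult_mat_carrier])
      fix i j assume ij: "i < D" "j < D"
      have "c / 2 * u (crd' i (x ^ N * e (idx j))) \<le> Y * fst (idx j) x ^ N"
        using bound[OF ij(1)] rad[OF idxI[OF ij(2)]] order_trans by blast
      then have "u (crd' i (x ^ N * e (idx j))) \<le> 2 / c * Y * fst (idx j) x ^ N"
        using c(1) by (simp add: field_simps)
      then show "u (E.mult_mat (x ^ N) $$ (i, j)) \<le> 2 / c * Y * fst (idx j) x ^ N"
        using ij by (simp add: E.mult_mat_def)
    qed
    also have "(\<Prod>j<D. 2 / c * Y * fst (idx j) x ^ N) = (2 / c * Y) ^ D * (\<Prod>j<D. fst (idx j) x) ^ N"
      by (subst prod.distrib) (simp add: prod_power_distrib)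
    \<comment> \<open>Each place occurs as often as its local basis has members.\<close>
    also have "(\<Prod>j<D. fst (idx j) x) = (\<Prod>p\<in>I. fst p x)"
      using prod.reindex_bij_betw[OF idx, of "\<lambda>p. fst p x"] card by simp
    also have "\<dots> = (\<Prod>w\<in>?E. \<Prod>i<m w. w x)"
      unfolding I_def using prod.Sigma[of ?E "\<lambda>w. {..<m w}" "\<lambda>w i. w x"] finite_extensions
      by (simp add: case_prod_unfold)
    also have "\<dots> = (\<Prod>w\<in>?E. w x ^ m w)" by simp
    also have "E.field_norm (x ^ N) = field_norm (x ^ N)"
      by (rule field_norm_basis_independent[OF crd' rat_basis_axioms])
    finally show "u (field_norm x) ^ N \<le> fact D * (2 / c * Y) ^ D * (\<Prod>w\<in>?E. w x ^ m w) ^ N"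
      by (simp add: field_norm_power absolute_value_power[OF u] mult.assoc)
  qed (use pos in \<open>auto intro!: prod_nonneg absolute_value_nonneg[OF u] simp: less_imp_le\<close>)
qed

end

section \<open>Completions\<close>

context
  fixes v :: "'k::field \<Rightarrow> real"
  assumes v: "absolute_value v"
begin

lemma absolute_value_reverse_triangle: "\<bar>v x - v y\<bar> \<le> v (x - y)"
  using absolute_value_diff_ge[OF v, of "x - y" "- y"] absolute_value_triangle[OF v, of "x - y" y]
    absolute_value_triangle[OF v, of "y - x" x] absolute_value_minus_commute[OF v, of x y]
  by (auto simp: absolute_value_minus[OF v])

lemma cauchy_seq_LIMSEQ:
  assumes s: "cauchy_seq v s" shows "\<exists>l. (\<lambda>n. v (s n)) \<longlonglongrightarrow> l"
proof -
  have "Cauchy (\<lambda>n. v (s n))"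
  proof (rule metric_CauchyI)
    fix e :: real assume "e > 0"
    then obtain N where N: "\<And>m n. m \<ge> N \<Longrightarrow> n \<ge> N \<Longrightarrow> v (s m - s n) < e"
      using s unfolding cauchy_seq_def by metis
    show "\<exists>M. \<forall>m\<ge>M. \<forall>n\<ge>M. dist (v (s m)) (v (s n)) < e"
      using N absolute_value_reverse_triangle le_less_trans unfolding dist_real_def by blast
  qed
  then show ?thesis using Cauchy_convergent_iff convergent_def by blast
qed

lemma cauchy_seq_bounded:
  assumes s: "cauchy_seq v s" shows "\<exists>B>0. \<forall>n. v (s n) \<le> B"
proof -
  obtain l where "(\<lambda>n. v (s n)) \<longlonglongrightarrow> l" using cauchy_seq_LIMSEQ[OF s] by blast
  then have "Bseq (\<lambda>n. v (s n))" by (intro convergent_imp_Bseq convergentI)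
  then obtain B where "B > 0" "\<And>n. norm (v (s n)) \<le> B" by (auto simp: Bseq_def)
  then show ?thesis by (auto simp: abs_le_iff)
qed

lemma cauchy_seq_const: "cauchy_seq v (\<lambda>_. a)"
  by (auto simp: cauchy_seq_def absolute_value_0[OF v])

lemma cauchy_seq_add:
  assumes "cauchy_seq v s" "cauchy_seq v t" shows "cauchy_seq v (\<lambda>n. s n + t n)"
  unfolding cauchy_seq_def
proof (intro allI impI)
  fix e :: real assume "e > 0"
  then have "e / 2 > 0" by simp
  then obtain M N where M: "\<And>m n. m \<ge> M \<Longrightarrow> n \<ge> M \<Longrightarrow> v (s m - s n) < e / 2"
    and N: "\<And>m n. m \<ge> N \<Longrightarrow> n \<ge> N \<Longrightarrow> v (t m - t n) < e / 2"
    using assms unfolding cauchy_seq_def by metis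
  have "v (s m + t m - (s n + t n)) < e" if "m \<ge> max M N" "n \<ge> max M N" for m n
  proof -
    have "v (s m + t m - (s n + t n)) \<le> v (s m - s n) + v (t m - t n)"
      using absolute_value_triangle[OF v, of "s m - s n" "t m - t n"] by (simp add: algebra_simps)
    then show ?thesis using M[of m n] N[of m n] that by simp
  qed
  then show "\<exists>N. \<forall>m\<ge>N. \<forall>n\<ge>N. v (s m + t m - (s n + t n)) < e" by blast
qed

lemma cauchy_seq_mult:
  assumes "cauchy_seq v s" "cauchy_seq v t" shows "cauchy_seq v (\<lambda>n. s n * t n)"
  unfolding cauchy_seq_def
proof (intro allI impI)
  fix e :: real assume e: "e > 0"
  obtain A B where A: "A > 0" "\<And>n. v (s n) \<le> A" and B: "B > 0" "\<And>n. v (t n) \<le> B"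
    using cauchy_seq_bounded assms by metis
  have "e / (2 * A) > 0" "e / (2 * B) > 0" using e A B by auto
  then obtain M N where M: "\<And>m n. m \<ge> M \<Longrightarrow> n \<ge> M \<Longrightarrow> v (s m - s n) < e / (2 * B)"
    and N: "\<And>m n. m \<ge> N \<Longrightarrow> n \<ge> N \<Longrightarrow> v (t m - t n) < e / (2 * A)"
    using assms unfolding cauchy_seq_def by metis
  have "v (s m * t m - s n * t n) < e" if mn: "m \<ge> max M N" "n \<ge> max M N" for m n
  proof -
    have "v (s m * t m - s n * t n) \<le> v (s m) * v (t m - t n) + v (s m - s n) * v (t n)"
      using absolute_value_triangle[OF v, of "s m * (t m - t n)" "(s m - s n) * t n"]
      by (simp add: algebra_simps flip: absolute_value_mult[OF v])
    also have "v (s m) * v (t m - t n) \<le> A * v (t m - t n)"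
      by (intro mult_right_mono A absolute_value_nonneg[OF v])
    also have "A * v (t m - t n) < e / 2" using N[of m n] mn A(1) by (simp add: field_simps)
    also have "v (s m - s n) * v (t n) \<le> v (s m - s n) * B"
      by (intro mult_left_mono B absolute_value_nonneg[OF v])
    also have "\<dots> < e / 2" using M[of m n] mn B(1) by (simp add: field_simps)
    finally show ?thesis by simp
  qed
  then show "\<exists>N. \<forall>m\<ge>N. \<forall>n\<ge>N. v (s m * t m - s n * t n) < e" by blast
qed

lemma cauchy_seq_minus: "cauchy_seq v s \<Longrightarrow> cauchy_seq v (\<lambda>n. - s n)"
  using cauchy_seq_mult[OF cauchy_seq_const[of "-1"]] by simp

lemma cauchy_seq_sum: "(\<And>i. i \<in> A \<Longrightarrow> cauchy_seq v (s i)) \<Longrightarrow> cauchy_seq v (\<lambda>n. \<Sum>i\<in>A. s i n)"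
  by (induction A rule: infinite_finite_induct) (auto simp: cauchy_seq_const cauchy_seq_add)

lemma null_seqs_imp_cauchy_seq:
  assumes s: "s \<in> null_seqs v" shows "cauchy_seq v s"
  unfolding cauchy_seq_def
proof (intro allI impI)
  fix e :: real assume "e > 0"
  then have "\<forall>\<^sub>F n in sequentially. v (s n) < e / 2"
    using s by (intro order_tendstoD(2)[of _ 0]) (auto simp: null_seqs_def)
  then obtain N where N: "\<And>n. n \<ge> N \<Longrightarrow> v (s n) < e / 2" by (auto simp: eventually_sequentially)
  have "v (s m - s n) < e" if "m \<ge> N" "n \<ge> N" for m n
    using absolute_value_diff_triangle[OF v, of "s m" "s n"] N[OF that(1)] N[OF that(2)] by simp
  then show "\<exists>N. \<forall>m\<ge>N. \<forall>n\<ge>N. v (s m - s n) < e" by blast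
qed

lemma null_seqsI:
  assumes "\<forall>\<^sub>F n in sequentially. v (s n) \<le> f n" "f \<longlonglongrightarrow> 0"
  shows "s \<in> null_seqs v"
proof -
  have "(\<lambda>n. v (s n)) \<longlonglongrightarrow> 0"
    by (rule tendsto_sandwich[OF _ assms(1) tendsto_const assms(2)]) (simp add: absolute_value_nonneg[OF v])
  then show ?thesis by (simp add: null_seqs_def)
qed

lemma null_seqs_add:
  assumes "s \<in> null_seqs v" "t \<in> null_seqs v" shows "(\<lambda>n. s n + t n) \<in> null_seqs v"
  using assms tendsto_add[of "\<lambda>n. v (s n)" 0 sequentially "\<lambda>n. v (t n)" 0]
  by (intro null_seqsI[where f = "\<lambda>n. v (s n) + v (t n)"])
    (auto simp: null_seqs_def absolute_value_triangle[OF v])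

lemma null_seqs_mult:
  assumes "s \<in> null_seqs v" "cauchy_seq v t" shows "(\<lambda>n. t n * s n) \<in> null_seqs v"
proof -
  obtain B where B: "\<And>n. v (t n) \<le> B" using cauchy_seq_bounded[OF assms(2)] by blast
  show ?thesis
  proof (rule null_seqsI)
    show "\<forall>\<^sub>F n in sequentially. v (t n * s n) \<le> B * v (s n)"
      by (simp add: absolute_value_mult[OF v] mult_right_mono B absolute_value_nonneg[OF v])
    show "(\<lambda>n. B * v (s n)) \<longlonglongrightarrow> 0"
      using assms(1) by (auto simp: null_seqs_def intro: tendsto_mult_right_zero)
  qed
qed

lemma cring_cauchy_seq_ring: "cring (cauchy_seq_ring v)"
proof (rule cringI)
  show "abelian_group (cauchy_seq_ring v)"
  proof (rule abelian_groupI)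
    fix s assume "s \<in> carrier (cauchy_seq_ring v)"
    then show "\<exists>y\<in>carrier (cauchy_seq_ring v). y \<oplus>\<^bsub>cauchy_seq_ring v\<^esub> s = \<zero>\<^bsub>cauchy_seq_ring v\<^esub>"
      by (intro bexI[of _ "\<lambda>n. - s n"]) (auto simp: cauchy_seq_ring_def cauchy_seq_minus)
  qed (auto simp: cauchy_seq_ring_def cauchy_seq_add cauchy_seq_const add_ac)
  show "comm_monoid (cauchy_seq_ring v)"
    by (rule comm_monoidI) (auto simp: cauchy_seq_ring_def cauchy_seq_mult cauchy_seq_const mult_ac)
qed (auto simp: cauchy_seq_ring_def algebra_simps)

interpretation C: cring "cauchy_seq_ring v"
  by (rule cring_cauchy_seq_ring)

lemma a_inv_cauchy_seq_ring:
  assumes "cauchy_seq v s" shows "\<ominus>\<^bsub>cauchy_seq_ring v\<^esub> s = (\<lambda>n. - s n)"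
  by (rule C.minus_equality) (use assms in \<open>auto simp: cauchy_seq_ring_def cauchy_seq_minus\<close>)

lemma ideal_null_seqs: "ideal (null_seqs v) (cauchy_seq_ring v)"
proof (rule idealI[OF C.ring_axioms])
  show "subgroup (null_seqs v) (add_monoid (cauchy_seq_ring v))"
  proof (rule C.add.subgroupI)
    show "null_seqs v \<subseteq> carrier (cauchy_seq_ring v)"
      using null_seqs_imp_cauchy_seq by (auto simp: cauchy_seq_ring_def)
    have "(\<lambda>_. 0) \<in> null_seqs v" by (simp add: null_seqs_def absolute_value_0[OF v])
    then show "null_seqs v \<noteq> {}" by blast
    show "\<ominus>\<^bsub>cauchy_seq_ring v\<^esub> s \<in> null_seqs v" if "s \<in> null_seqs v" for s
      using that by (simp add: a_inv_cauchy_seq_ring null_seqs_imp_cauchy_seq) (simp add: null_seqs_def absolute_value_minus[OF v])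
    show "s \<oplus>\<^bsub>cauchy_seq_ring v\<^esub> t \<in> null_seqs v" if "s \<in> null_seqs v" "t \<in> null_seqs v" for s t
      using null_seqs_add[OF that] by (simp add: cauchy_seq_ring_def)
  qed
  fix s t assume "s \<in> null_seqs v" "t \<in> carrier (cauchy_seq_ring v)"
  then show "t \<otimes>\<^bsub>cauchy_seq_ring v\<^esub> s \<in> null_seqs v" "s \<otimes>\<^bsub>cauchy_seq_ring v\<^esub> t \<in> null_seqs v"
    using null_seqs_mult[of s t] by (auto simp: cauchy_seq_ring_def mult.commute)
qed

interpretation N: ideal "null_seqs v" "cauchy_seq_ring v"
  by (rule ideal_null_seqs)

lemma cring_completion: "cring (completion v)"
  unfolding completion_def by (rule N.quotient_is_cring[OF cring_cauchy_seq_ring])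

interpretation R: cring "completion v"
  by (rule cring_completion)

text \<open>Cosets are named by a representative, so that computations in the quotient ring are
  carried out on sequences.\<close>

definition seq_class :: "(nat \<Rightarrow> 'k) \<Rightarrow> (nat \<Rightarrow> 'k) set" where
  "seq_class s = null_seqs v +>\<^bsub>cauchy_seq_ring v\<^esub> s"

lemma mem_seq_class: "t \<in> seq_class s \<longleftrightarrow> (\<lambda>n. t n - s n) \<in> null_seqs v"
proof -
  have "t \<in> seq_class s \<longleftrightarrow> (\<exists>h\<in>null_seqs v. t = (\<lambda>n. h n + s n))"
    by (auto simp: seq_class_def a_r_coset_def r_coset_def cauchy_seq_ring_def)
  also have "\<dots> \<longleftrightarrow> (\<lambda>n. t n - s n) \<in> null_seqs v"
    by (auto intro!: bexI[of _ "\<lambda>n. t n - s n"])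
  finally show ?thesis .
qed

lemma self_mem_seq_class: "s \<in> seq_class s"
  by (simp add: mem_seq_class null_seqs_def absolute_value_0[OF v])

lemma seq_class_eqI:
  assumes "(\<lambda>n. s n - t n) \<in> null_seqs v" shows "seq_class s = seq_class t"
proof -
  have sym: "(\<lambda>n. t n - s n) \<in> null_seqs v"
    using assms by (simp add: null_seqs_def absolute_value_minus_commute[OF v])
  have "r \<in> seq_class s \<longleftrightarrow> r \<in> seq_class t" for r
    using null_seqs_add[of "\<lambda>n. r n - s n" "\<lambda>n. s n - t n"] null_seqs_add[of "\<lambda>n. r n - t n" "\<lambda>n. t n - s n"]
      assms sym by (auto simp: mem_seq_class)
  then show ?thesis by blast
qed

lemma carrier_completion: "carrier (completion v) = {seq_class s | s. cauchy_seq v s}"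
  by (auto simp: completion_def FactRing_def A_RCOSETS_def RCOSETS_def seq_class_def a_r_coset_def cauchy_seq_ring_def)

lemma seq_class_in_carrier: "cauchy_seq v s \<Longrightarrow> seq_class s \<in> carrier (completion v)"
  by (auto simp: carrier_completion)

lemma seq_class_add: "cauchy_seq v s \<Longrightarrow> cauchy_seq v t \<Longrightarrow> seq_class s \<oplus>\<^bsub>completion v\<^esub> seq_class t = seq_class (\<lambda>n. s n + t n)"
  using ring_hom_add[OF N.rcos_ring_hom, of s t] by (simp add: seq_class_def completion_def cauchy_seq_ring_def)

lemma seq_class_mult: "cauchy_seq v s \<Longrightarrow> cauchy_seq v t \<Longrightarrow> seq_class s \<otimes>\<^bsub>completion v\<^esub> seq_class t = seq_class (\<lambda>n. s n * t n)"
  using ring_hom_mult[OF N.rcos_ring_hom, of s t] by (simp add: seq_class_def completion_def cauchy_seq_ring_def)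

lemma seq_class_one: "\<one>\<^bsub>completion v\<^esub> = seq_class (\<lambda>_. 1)"
  using ring_hom_one[OF N.rcos_ring_hom] by (simp add: seq_class_def completion_def cauchy_seq_ring_def)

lemma seq_class_zero: "\<zero>\<^bsub>completion v\<^esub> = seq_class (\<lambda>_. 0)"
proof -
  have "seq_class (\<lambda>_. 0) = null_seqs v" by (auto simp: mem_seq_class)
  then show ?thesis by (simp add: completion_def FactRing_def)
qed

lemma completion_embed_eq_seq_class: "completion_embed v a = seq_class (\<lambda>_. a)"
  by (simp add: completion_embed_def seq_class_def)

text \<open>This gives sense to the definite description in \<open>completion_abs\<close>: members
  of one class differ by a null sequence, so their absolute values have the same limit.\<close>

lemma completion_abs_seq_class:
  assumes s: "cauchy_seq v s" shows "(\<lambda>n. v (s n)) \<longlonglongrightarrow> completion_abs v (seq_class s)"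
proof -
  obtain l where l: "(\<lambda>n. v (s n)) \<longlonglongrightarrow> l" using cauchy_seq_LIMSEQ[OF s] by blast
  have "(\<lambda>n. v (t n)) \<longlonglongrightarrow> l" if "t \<in> seq_class s" for t
  proof -
    have "(\<lambda>n. v (t n) - v (s n)) \<longlonglongrightarrow> 0"
    proof (rule Lim_null_comparison)
      show "\<forall>\<^sub>F n in sequentially. norm (v (t n) - v (s n)) \<le> v (t n - s n)"
        by (simp add: absolute_value_reverse_triangle)
      show "(\<lambda>n. v (t n - s n)) \<longlonglongrightarrow> 0" using that by (simp add: mem_seq_class null_seqs_def)
    qed
    from tendsto_add[OF this l] show ?thesis by simp
  qed
  then have "completion_abs v (seq_class s) = l"
    unfolding completion_abs_def using self_mem_seq_class[of s] l LIMSEQ_unique by (intro the_equality) blast+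
  then show ?thesis using l by simp
qed

lemma completion_abs_embed: "completion_abs v (completion_embed v a) = v a"
  using completion_abs_seq_class[OF cauchy_seq_const[of a]] LIMSEQ_unique[OF _ tendsto_const]
  by (auto simp: completion_embed_eq_seq_class)

lemma completion_embed_closed: "completion_embed v a \<in> carrier (completion v)"
  by (simp add: completion_embed_eq_seq_class seq_class_in_carrier cauchy_seq_const)

lemma completion_embed_0: "completion_embed v 0 = \<zero>\<^bsub>completion v\<^esub>"
  by (simp add: completion_embed_eq_seq_class seq_class_zero)

lemma completion_abs_nonneg:
  "X \<in> carrier (completion v) \<Longrightarrow> 0 \<le> completion_abs v X"
  by (auto simp: carrier_completion intro: LIMSEQ_le_const[OF completion_abs_seq_class] absolute_value_nonneg[OF v])

lemma completion_abs_zero: "completion_abs v \<zero>\<^bsub>completion v\<^esub> = 0"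
  using completion_abs_embed[of 0] by (simp add: completion_embed_0 absolute_value_0[OF v])

lemma completion_abs_one: "completion_abs v \<one>\<^bsub>completion v\<^esub> = 1"
  using completion_abs_embed[of 1] by (simp add: completion_embed_eq_seq_class seq_class_one absolute_value_1[OF v])

lemma completion_abs_add:
  assumes "X \<in> carrier (completion v)" "Y \<in> carrier (completion v)"
  shows "completion_abs v (X \<oplus>\<^bsub>completion v\<^esub> Y) \<le> completion_abs v X + completion_abs v Y"
proof -
  obtain s t where st: "X = seq_class s" "Y = seq_class t" "cauchy_seq v s" "cauchy_seq v t"
    using assms by (auto simp: carrier_completion)
  show ?thesis
    unfolding st(1,2) seq_class_add[OF st(3,4)]
    by (rule LIMSEQ_le[OF completion_abs_seq_class[OF cauchy_seq_add[OF st(3,4)]]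
          tendsto_add[OF completion_abs_seq_class[OF st(3)] completion_abs_seq_class[OF st(4)]]])
      (simp add: absolute_value_triangle[OF v])
qed

lemma completion_abs_mult:
  assumes "X \<in> carrier (completion v)" "Y \<in> carrier (completion v)"
  shows "completion_abs v (X \<otimes>\<^bsub>completion v\<^esub> Y) = completion_abs v X * completion_abs v Y"
proof -
  obtain s t where st: "X = seq_class s" "Y = seq_class t" "cauchy_seq v s" "cauchy_seq v t"
    using assms by (auto simp: carrier_completion)
  show ?thesis
    unfolding st(1,2) seq_class_mult[OF st(3,4)]
    using completion_abs_seq_class[OF cauchy_seq_mult[OF st(3,4)]]
      tendsto_mult[OF completion_abs_seq_class[OF st(3)] completion_abs_seq_class[OF st(4)]]
    by (intro LIMSEQ_unique) (auto simp: absolute_value_mult[OF v])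
qed

lemma completion_abs_finsum:
  assumes "\<And>i. i \<in> A \<Longrightarrow> f i \<in> carrier (completion v)"
  shows "completion_abs v (\<Oplus>\<^bsub>completion v\<^esub>i\<in>A. f i) \<le> (\<Sum>i\<in>A. completion_abs v (f i))"
  using assms
proof (induction A rule: infinite_finite_induct)
  case (insert x F)
  have "completion_abs v (\<Oplus>\<^bsub>completion v\<^esub>i\<in>insert x F. f i) =
      completion_abs v (f x \<oplus>\<^bsub>completion v\<^esub> (\<Oplus>\<^bsub>completion v\<^esub>i\<in>F. f i))"
    using insert by (subst R.finsum_insert) auto
  also have "\<dots> \<le> completion_abs v (f x) + completion_abs v (\<Oplus>\<^bsub>completion v\<^esub>i\<in>F. f i)"
    using insert by (intro completion_abs_add R.finsum_closed) auto
  finally show ?case using insert by fastforce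
qed (auto simp: completion_abs_zero R.finsum_infinite)

lemma completion_abs_finprod:
  assumes "finite A" "\<And>i. i \<in> A \<Longrightarrow> f i \<in> carrier (completion v)"
  shows "completion_abs v (\<Otimes>\<^bsub>completion v\<^esub>i\<in>A. f i) = (\<Prod>i\<in>A. completion_abs v (f i))"
  using assms
proof (induction A rule: finite_induct)
  case (insert x F)
  have "completion_abs v (\<Otimes>\<^bsub>completion v\<^esub>i\<in>insert x F. f i) =
      completion_abs v (f x \<otimes>\<^bsub>completion v\<^esub> (\<Otimes>\<^bsub>completion v\<^esub>i\<in>F. f i))"
    using insert by (subst R.finprod_insert) auto
  also have "\<dots> = completion_abs v (f x) * completion_abs v (\<Otimes>\<^bsub>completion v\<^esub>i\<in>F. f i)"
    using insert by (intro completion_abs_mult R.finprod_closed) auto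
  finally show ?case using insert by simp
qed (auto simp: completion_abs_one)

text \<open>A Cauchy sequence that is not null is bounded away from 0 from some index on. Earlier
  terms may vanish, where \<open>inverse 0 = 0\<close>; finitely many terms affect neither the
  Cauchy property nor the class.\<close>

lemma seq_class_inverse:
  assumes s: "cauchy_seq v s" and nz: "seq_class s \<noteq> \<zero>\<^bsub>completion v\<^esub>"
  shows "cauchy_seq v (\<lambda>n. inverse (s n))" "seq_class s \<otimes>\<^bsub>completion v\<^esub> seq_class (\<lambda>n. inverse (s n)) = \<one>\<^bsub>completion v\<^esub>"
proof -
  obtain l where l: "(\<lambda>n. v (s n)) \<longlonglongrightarrow> l" using cauchy_seq_LIMSEQ[OF s] by blast
  have "l \<noteq> 0"
  proof
    assume "l = 0"
    then have "seq_class s = seq_class (\<lambda>_. 0)" using l by (intro seq_class_eqI) (simp add: null_seqs_def)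
    then show False using nz by (simp add: seq_class_zero)
  qed
  moreover have "0 \<le> l" using l by (rule LIMSEQ_le_const) (auto simp: absolute_value_nonneg[OF v])
  ultimately have l0: "l > 0" by simp
  then have "\<forall>\<^sub>F n in sequentially. l / 2 < v (s n)" using l by (intro order_tendstoD) auto
  then obtain N where N: "\<And>n. n \<ge> N \<Longrightarrow> l / 2 < v (s n)" by (auto simp: eventually_sequentially)
  then have snz: "s n \<noteq> 0" if "n \<ge> N" for n using absolute_value_0[OF v] l0 that by fastforce
  show t: "cauchy_seq v (\<lambda>n. inverse (s n))"
    unfolding cauchy_seq_def
  proof (intro allI impI)
    fix e :: real assume "e > 0"
    \<comment> \<open>The square accounts for the two denominators \<open>s m\<close> and
      \<open>s n\<close>, both at least \<open>l / 2\<close>.\<close>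
    then have "e * (l / 2) ^ 2 > 0" using l0 by simp
    then obtain M where M: "\<And>m n. m \<ge> M \<Longrightarrow> n \<ge> M \<Longrightarrow> v (s m - s n) < e * (l / 2) ^ 2"
      using s unfolding cauchy_seq_def by metis
    have "v (inverse (s m) - inverse (s n)) < e" if mn: "m \<ge> max M N" "n \<ge> max M N" for m n
    proof -
      have nz: "s m \<noteq> 0" "s n \<noteq> 0" using snz mn by auto
      then have "inverse (s m) - inverse (s n) = (s n - s m) / (s m * s n)" by (simp add: field_simps)
      then have "v (inverse (s m) - inverse (s n)) = v (s n - s m) / (v (s m) * v (s n))"
        by (simp add: absolute_value_divide[OF v] absolute_value_mult[OF v])
      also have "\<dots> < e"
      proof -
        have "(l / 2) ^ 2 \<le> v (s m) * v (s n)"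
          unfolding power2_eq_square using N[of m] N[of n] mn l0 by (intro mult_mono) auto
        then have "e * (l / 2) ^ 2 \<le> e * (v (s m) * v (s n))" using \<open>e > 0\<close> by simp
        then have "v (s n - s m) < e * (v (s m) * v (s n))" using M[of n m] mn by simp
        moreover have "v (s m) * v (s n) > 0" using absolute_value_pos[OF v] nz by simp
        ultimately show ?thesis by (simp add: divide_less_eq)
      qed
      finally show ?thesis .
    qed
    then show "\<exists>N. \<forall>m\<ge>N. \<forall>n\<ge>N. v (inverse (s m) - inverse (s n)) < e" by blast
  qed
  have "(\<lambda>n. s n * inverse (s n) - 1) \<in> null_seqs v"
  proof (rule null_seqsI)
    show "\<forall>\<^sub>F n in sequentially. v (s n * inverse (s n) - 1) \<le> 0"
      using snz by (auto simp: eventually_sequentially absolute_value_0[OF v] intro!: exI[of _ N])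
  qed simp
  then show "seq_class s \<otimes>\<^bsub>completion v\<^esub> seq_class (\<lambda>n. inverse (s n)) = \<one>\<^bsub>completion v\<^esub>"
    unfolding seq_class_mult[OF s t] seq_class_one by (rule seq_class_eqI)
qed

lemma field_completion: "field (completion v)"
proof (rule R.cring_fieldI2)
  show "\<zero>\<^bsub>completion v\<^esub> \<noteq> \<one>\<^bsub>completion v\<^esub>"
    using completion_abs_zero completion_abs_one by auto
  fix X assume X: "X \<in> carrier (completion v)" "X \<noteq> \<zero>\<^bsub>completion v\<^esub>"
  then obtain s where s: "X = seq_class s" "cauchy_seq v s" by (auto simp: carrier_completion)
  then show "\<exists>Y\<in>carrier (completion v). X \<otimes>\<^bsub>completion v\<^esub> Y = \<one>\<^bsub>completion v\<^esub>"
    using seq_class_inverse[OF s(2)] X(2) seq_class_in_carrier by blast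
qed

end

section \<open>The local degree as the length of a local basis\<close>

context
  fixes v :: "'k::field_char_0 \<Rightarrow> real"
  assumes v: "absolute_value v"
begin

interpretation R: field "completion v"
  by (rule field_completion[OF v])

lemma rat_completion_eq: "rat_completion v = {seq_class v s | s. cauchy_seq v s \<and> (\<forall>n. s n \<in> \<rat>)}"
proof (intro equalityI subsetI)
  fix X assume "X \<in> rat_completion v"
  then obtain s t where st: "X = seq_class v s" "cauchy_seq v s" "t \<in> X" "\<forall>n. t n \<in> \<rat>"
    by (auto simp: rat_completion_def carrier_completion[OF v])
  then have diff: "(\<lambda>n. t n - s n) \<in> null_seqs v" by (simp add: mem_seq_class[OF v])
  then have "seq_class v t = X" using seq_class_eqI[OF v] st(1) by blast
  moreover have "cauchy_seq v t"
    using cauchy_seq_add[OF v null_seqs_imp_cauchy_seq[OF v diff] st(2)] by simp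
  ultimately show "X \<in> {seq_class v s | s. cauchy_seq v s \<and> (\<forall>n. s n \<in> \<rat>)}" using st(4) by blast
next
  fix X assume "X \<in> {seq_class v s | s. cauchy_seq v s \<and> (\<forall>n. s n \<in> \<rat>)}"
  then show "X \<in> rat_completion v"
    using self_mem_seq_class[OF v] by (auto simp: rat_completion_def seq_class_in_carrier[OF v])
qed

lemma subfield_rat_completion: "subfield (rat_completion v) (completion v)"
proof (rule R.subfieldI')
  show "subring (rat_completion v) (completion v)"
  proof (rule R.subringI)
    show "rat_completion v \<subseteq> carrier (completion v)" by (auto simp: rat_completion_def)
    show "\<one>\<^bsub>completion v\<^esub> \<in> rat_completion v"
      by (auto simp: rat_completion_eq seq_class_one[OF v] intro!: exI[of _ "\<lambda>_. 1"] cauchy_seq_const[OF v])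
    fix X assume "X \<in> rat_completion v"
    then obtain s where s: "X = seq_class v s" "cauchy_seq v s" "\<And>n. s n \<in> \<rat>" by (auto simp: rat_completion_eq)
    have "\<ominus>\<^bsub>completion v\<^esub> X = seq_class v (\<lambda>n. - s n)"
      by (rule R.minus_equality)
        (auto simp: s seq_class_in_carrier[OF v] cauchy_seq_minus[OF v] seq_class_add[OF v] seq_class_zero[OF v])
    then show "\<ominus>\<^bsub>completion v\<^esub> X \<in> rat_completion v"
      using s cauchy_seq_minus[OF v s(2)] by (auto simp: rat_completion_eq)
    fix Y assume "Y \<in> rat_completion v"
    then obtain t where t: "Y = seq_class v t" "cauchy_seq v t" "\<And>n. t n \<in> \<rat>" by (auto simp: rat_completion_eq)
    have "\<forall>n. s n * t n \<in> \<rat>" "\<forall>n. s n + t n \<in> \<rat>" using s(3) t(3) by auto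
    then have "seq_class v (\<lambda>n. s n * t n) \<in> rat_completion v" "seq_class v (\<lambda>n. s n + t n) \<in> rat_completion v"
      unfolding rat_completion_eq
      using cauchy_seq_mult[OF v s(2) t(2)] cauchy_seq_add[OF v s(2) t(2)] by blast+
    then show "X \<otimes>\<^bsub>completion v\<^esub> Y \<in> rat_completion v" "X \<oplus>\<^bsub>completion v\<^esub> Y \<in> rat_completion v"
      unfolding s(1) t(1) seq_class_mult[OF v s(2) t(2)] seq_class_add[OF v s(2) t(2)] .
  qed
  fix X assume X: "X \<in> rat_completion v - {\<zero>\<^bsub>completion v\<^esub>}"
  then obtain s where s: "X = seq_class v s" "cauchy_seq v s" "\<And>n. s n \<in> \<rat>" by (auto simp: rat_completion_eq)
  have inv: "cauchy_seq v (\<lambda>n. inverse (s n))" "X \<otimes>\<^bsub>completion v\<^esub> seq_class v (\<lambda>n. inverse (s n)) = \<one>\<^bsub>completion v\<^esub>"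
    using seq_class_inverse[OF v s(2)] X s(1) by auto
  then have "inv\<^bsub>completion v\<^esub> X = seq_class v (\<lambda>n. inverse (s n))"
    using s by (intro R.comm_inv_char) (auto simp: seq_class_in_carrier[OF v])
  then show "inv\<^bsub>completion v\<^esub> X \<in> rat_completion v"
    using inv(1) s(3) by (auto simp: rat_completion_eq)
qed

text \<open>Combinations over the completion are computed termwise on representing sequences; this
  turns linear algebra over the completion into estimates in the field.\<close>

lemma combine_completion:
  assumes "length Ks = length ys" "\<And>i. i < length ys \<Longrightarrow> cauchy_seq v (a i) \<and> Ks ! i = seq_class v (a i)"
  shows "R.combine Ks (map (completion_embed v) ys) = seq_class v (\<lambda>n. \<Sum>i<length ys. a i n * ys ! i)"
  using assms
proof (induction ys arbitrary: Ks a)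
  case Nil
  then show ?case by (simp add: seq_class_zero[OF v])
next
  case (Cons y ys)
  then obtain K Ks' where Ks: "Ks = K # Ks'" by (cases Ks) auto
  have "R.combine Ks' (map (completion_embed v) ys) = seq_class v (\<lambda>n. \<Sum>i<length ys. a (Suc i) n * ys ! i)"
    using Cons.prems(1) Cons.prems(2)[of "Suc _"] by (intro Cons.IH) (auto simp: Ks)
  moreover have K: "K = seq_class v (a 0)" "cauchy_seq v (a 0)" using Cons.prems(2)[of 0] by (auto simp: Ks)
  moreover have "cauchy_seq v (\<lambda>n. a (Suc i) n * ys ! i)" if "i < length ys" for i
    using Cons.prems(2)[of "Suc i"] that by (intro cauchy_seq_mult[OF v] cauchy_seq_const[OF v]) auto
  moreover from this have "cauchy_seq v (\<lambda>n. \<Sum>i<length ys. a (Suc i) n * ys ! i)"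
    by (intro cauchy_seq_sum[OF v]) simp
  ultimately show ?case
    by (simp add: Ks completion_embed_eq_seq_class[OF v, of y] seq_class_mult[OF v] seq_class_add[OF v] cauchy_seq_const[OF v]
        cauchy_seq_mult[OF v] cauchy_seq_sum[OF v] sum.lessThan_Suc_shift del: sum.lessThan_Suc)
qed

text \<open>The lower bound in \<open>local_basis\<close> gives independence over the completed
  rationals. Density gives spanning, the lower bound being used again to see that the coefficients
  of the approximations converge. In particular \<open>m\<close> does not depend on the local
  basis.\<close>

theorem local_degree_eq:
  assumes y: "local_basis u v m y" and ext: "v \<in> extensions u"
  shows "local_degree v = m"
proof -
  note sub = subfield_rat_completion
  obtain c where c: "c > 0" "\<And>a j. j < m \<Longrightarrow> c * u (a j) \<le> v (\<Sum>i<m. of_rat (a i) * y i)"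
    and dense: "\<And>z \<epsilon>. \<epsilon> > 0 \<Longrightarrow> \<exists>a. v (z - (\<Sum>i<m. of_rat (a i) * y i)) < \<epsilon>"
    using y unfolding local_basis_def by blast
  define ys where "ys = map y [0..<m]"
  define Us where "Us = map (completion_embed v) ys"
  have len: "length ys = m" "length Us = m" by (auto simp: ys_def Us_def)
  have Us: "set Us \<subseteq> carrier (completion v)"
    by (auto simp: Us_def completion_embed_closed[OF v])
  have comb: "R.combine Ks Us = seq_class v (\<lambda>n. \<Sum>i<m. a i n * y i)"
    if "length Ks = m" "\<And>i. i < m \<Longrightarrow> cauchy_seq v (a i) \<and> Ks ! i = seq_class v (a i)" for Ks a
    using combine_completion[of Ks ys a] that by (simp add: Us_def ys_def)
  have "R.independent (rat_completion v) Us"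
  proof (rule ccontr)
    assume dep: "\<not> R.independent (rat_completion v) Us"
    obtain Ks where Ks: "length Ks = length Us" "R.combine Ks Us = \<zero>\<^bsub>completion v\<^esub>"
        "set Ks \<subseteq> rat_completion v" "set Ks \<noteq> {\<zero>\<^bsub>completion v\<^esub>}"
      using R.dependent_imp_non_trivial_combine[OF sub Us dep] by blast
    have "Us \<noteq> []" using dep by auto
    have "\<exists>s. cauchy_seq v (\<lambda>n. of_rat (s n)) \<and> Ks ! i = seq_class v (\<lambda>n. of_rat (s n))" if "i < m" for i
    proof -
      have "Ks ! i \<in> rat_completion v" using Ks(1,3) that len by auto
      then obtain s where s: "Ks ! i = seq_class v s" "cauchy_seq v s" "\<And>n. s n \<in> \<rat>" by (auto simp: rat_completion_eq)
      have "\<forall>n. \<exists>q. s n = of_rat q" using s(3) by (auto simp: Rats_def)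
      then obtain q where "\<And>n. s n = of_rat (q n)" by metis
      then have "s = (\<lambda>n. of_rat (q n))" by auto
      then show ?thesis using s(1,2) by auto
    qed
    then obtain s where s: "\<And>i. i < m \<Longrightarrow> cauchy_seq v (\<lambda>n. of_rat (s i n)) \<and> Ks ! i = seq_class v (\<lambda>n. of_rat (s i n))"
      by metis
    have "seq_class v (\<lambda>n. \<Sum>i<m. of_rat (s i n) * y i) = \<zero>\<^bsub>completion v\<^esub>"
      using comb[of Ks "\<lambda>i n. of_rat (s i n)"] s Ks len by simp
    then have null: "(\<lambda>n. v (\<Sum>i<m. of_rat (s i n) * y i)) \<longlonglongrightarrow> 0"
      using self_mem_seq_class[OF v, of "\<lambda>n. \<Sum>i<m. of_rat (s i n) * y i"]
      by (simp add: seq_class_zero[OF v] mem_seq_class[OF v] null_seqs_def)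
    have "Ks ! i = \<zero>\<^bsub>completion v\<^esub>" if i: "i < m" for i
    proof -
      \<comment> \<open>The combination is a null sequence, and each coefficient is at most
        \<open>1 / c\<close> times its size.\<close>
      have "(\<lambda>n. of_rat (s i n) - 0) \<in> null_seqs v"
      proof (rule null_seqsI[OF v])
        show "\<forall>\<^sub>F n in sequentially. v (of_rat (s i n) - 0) \<le> v (\<Sum>i<m. of_rat (s i n) * y i) / c"
          using c(1) c(2)[OF i, of "\<lambda>i. s i _"] by (simp add: extensionsD(2)[OF ext] field_simps)
        show "(\<lambda>n. v (\<Sum>i<m. of_rat (s i n) * y i) / c) \<longlonglongrightarrow> 0"
          using tendsto_divide[OF null tendsto_const[of c]] c(1) by simp
      qed
      then have "seq_class v (\<lambda>n. of_rat (s i n)) = seq_class v (\<lambda>_. 0)" by (rule seq_class_eqI[OF v])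
      then show ?thesis using s[OF i] by (simp add: seq_class_zero[OF v])
    qed
    then have "set Ks \<subseteq> {\<zero>\<^bsub>completion v\<^esub>}" using Ks(1) len by (auto simp: in_set_conv_nth)
    then show False using Ks(1,4) \<open>Us \<noteq> []\<close> by (cases Ks) auto
  qed
  moreover have "R.Span (rat_completion v) Us = carrier (completion v)"
  proof
    show "R.Span (rat_completion v) Us \<subseteq> carrier (completion v)"
      by (rule R.Span_in_carrier[OF _ Us]) (auto simp: rat_completion_def)
    show "carrier (completion v) \<subseteq> R.Span (rat_completion v) Us"
    proof
      fix X assume "X \<in> carrier (completion v)"
      then obtain s where s: "X = seq_class v s" "cauchy_seq v s" by (auto simp: carrier_completion[OF v])
      have "\<exists>a. v (s n - (\<Sum>i<m. of_rat (a i) * y i)) < inverse (real (Suc n))" for n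
        by (rule dense) simp
      then obtain a where a: "\<And>n. v (s n - (\<Sum>i<m. of_rat (a n i) * y i)) < inverse (real (Suc n))" by metis
      have cauchy: "cauchy_seq v (\<lambda>n. of_rat (a n i))" if i: "i < m" for i
        unfolding cauchy_seq_def
      proof (intro allI impI)
        fix e :: real assume "e > 0"
        \<comment> \<open>One third each for the two approximation errors and for the distance
          between two terms of \<open>s\<close>; the factor \<open>c\<close> is lost on passing to
          the coefficients.\<close>
        then have ec: "c * e / 3 > 0" using c(1) by simp
        obtain M where M: "\<And>m n. m \<ge> M \<Longrightarrow> n \<ge> M \<Longrightarrow> v (s m - s n) < c * e / 3"
          using s(2) ec unfolding cauchy_seq_def by metis
        obtain N where N: "inverse (real (Suc N)) < c * e / 3" using reals_Archimedean[OF ec] by blast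
        have N': "v (s n - (\<Sum>i<m. of_rat (a n i) * y i)) < c * e / 3" if "n \<ge> N" for n
        proof -
          have "inverse (real (Suc n)) \<le> inverse (real (Suc N))" using that by (simp add: field_simps)
          then show ?thesis using a[of n] N by linarith
        qed
        have "v (of_rat (a k i) - of_rat (a n i)) < e" if kn: "k \<ge> max M N" "n \<ge> max M N" for k n
        proof -
          define A where "A = (\<lambda>n. \<Sum>i<m. of_rat (a n i) * y i)"
          have "(\<Sum>i<m. of_rat (a k i - a n i) * y i) = A k - A n"
            by (simp add: A_def of_rat_diff left_diff_distrib sum_subtractf)
          then have "c * v (of_rat (a k i) - of_rat (a n i)) \<le> v (A k - A n)"
            using c(2)[OF i, of "\<lambda>i. a k i - a n i"] extensionsD(2)[OF ext, of "a k i - a n i"] by (simp add: of_rat_diff)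
          also have "A k - A n = (s n - A n) - (s k - A k) + (s k - s n)" by simp
          also have "v \<dots> \<le> v (s n - A n) + v (s k - A k) + v (s k - s n)"
            using absolute_value_triangle[OF v, of "(s n - A n) - (s k - A k)" "s k - s n"]
              absolute_value_diff_triangle[OF v, of "s n - A n" "s k - A k"] by linarith
          also have "\<dots> < c * e" using N'[of n] N'[of k] M[of k n] kn unfolding A_def[symmetric] by (simp add: A_def)
          finally show ?thesis using c(1) by simp
        qed
        then show "\<exists>N. \<forall>k\<ge>N. \<forall>n\<ge>N. v (of_rat (a k i) - of_rat (a n i)) < e" by blast
      qed
      define Ks where "Ks = map (\<lambda>i. seq_class v (\<lambda>n. of_rat (a n i))) [0..<m]"
      have "R.combine Ks Us = seq_class v (\<lambda>n. \<Sum>i<m. of_rat (a n i) * y i)"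
        using comb[of Ks "\<lambda>i n. of_rat (a n i)"] cauchy by (simp add: Ks_def)
      also have "\<dots> = X"
        unfolding s(1)
      proof (rule seq_class_eqI[OF v], rule null_seqsI[OF v])
        show "\<forall>\<^sub>F n in sequentially. v ((\<Sum>i<m. of_rat (a n i) * y i) - s n) \<le> inverse (real (Suc n))"
          using a by (simp add: absolute_value_minus_commute[OF v, of _ "s _"] less_imp_le)
        show "(\<lambda>n. inverse (real (Suc n))) \<longlonglongrightarrow> 0" by (rule LIMSEQ_inverse_real_of_nat)
      qed
      finally have "X = R.combine Ks Us" ..
      moreover have "set Ks \<subseteq> rat_completion v" using cauchy by (auto simp: Ks_def rat_completion_eq)
      moreover have "length Ks = length Us" by (simp add: Ks_def len)
      ultimately show "X \<in> R.Span (rat_completion v) Us"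
        using R.Span_mem_iff_length_version[OF sub Us] by blast
    qed
  qed
  ultimately have "R.dimension (length Us) (rat_completion v) (carrier (completion v))"
    by (rule R.dimensionI[OF sub])
  then show ?thesis
    using R.dimI[OF sub] by (simp add: local_degree_def over_def len)
qed

end

section \<open>The Liouville inequality\<close>

definition rat_abs :: "rat \<Rightarrow> real" where
  "rat_abs q = \<bar>of_rat q\<bar>"

lemma nontrivial_rat_abs: "nontrivial_absolute_value rat_abs"
proof
  show "absolute_value rat_abs"
    unfolding absolute_value_def rat_abs_def of_rat_mult of_rat_add
    using abs_triangle_ineq by (auto simp: abs_mult simp del: abs_of_rat)
  show "\<exists>q. q \<noteq> 0 \<and> rat_abs q < 1"
    by (intro exI[of _ "1 / 2"]) (simp add: rat_abs_def of_rat_divide)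
qed

lemma nontrivial_padic_abs:
  assumes p: "prime p" shows "nontrivial_absolute_value (padic_abs p)"
proof
  show "absolute_value (padic_abs p)" by (rule absolute_value_padic_abs[OF p])
  show "\<exists>q. q \<noteq> 0 \<and> padic_abs p q < 1"
    using padic_abs_self[OF p] prime_gt_1_nat[OF p] by (intro exI[of _ "of_nat p"]) auto
qed

lemma standard_absolute_values_eq:
  "standard_absolute_values = extensions rat_abs \<union> (\<Union>p\<in>{p. prime p}. extensions (padic_abs p))"
  by (auto simp: standard_absolute_values_def extensions_def rat_abs_def)

lemma standard_absolute_value_is_absolute_value:
  "w \<in> standard_absolute_values \<Longrightarrow> absolute_value w"
  by (simp add: standard_absolute_values_def)

lemma extensions_disjoint: "w \<in> extensions u \<Longrightarrow> w \<in> extensions u' \<Longrightarrow> u = u'"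
  by (auto simp: extensions_def)

lemma padic_abs_neq_rat_abs: "prime p \<Longrightarrow> padic_abs p \<noteq> rat_abs"
proof
  assume p: "prime p" and eq: "padic_abs p = rat_abs"
  have "padic_abs p (of_nat p) = rat_abs (of_nat p)" by (simp add: eq)
  moreover have "1 / real p < 1" using prime_gt_1_nat[OF p] by simp
  ultimately show False using prime_gt_1_nat[OF p] unfolding padic_abs_self[OF p]
    by (simp add: rat_abs_def)
qed

text \<open>At \<open>p\<close> the value of \<open>padic_abs p\<close> is less than 1 and every
  other p-adic absolute value is 1. This keeps the places apart when sums over primes become sums
  over absolute values.\<close>

lemma inj_on_padic_abs: "inj_on padic_abs {p. prime p}"
proof (rule inj_onI, rule ccontr)
  fix p q assume pq: "p \<in> {p. prime p}" "q \<in> {p. prime p}" "padic_abs p = padic_abs q" "p \<noteq> q"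
  have "\<not> q dvd p" using pq primes_dvd_imp_eq by blast
  then have "padic_abs q (of_int (int p)) = 1" using pq by (intro padic_abs_of_int_coprime) auto
  moreover have "padic_abs p (of_int (int p)) = 1 / real p" using padic_abs_self[of p] pq by simp
  ultimately show False using pq prime_gt_1_nat[of p] by simp
qed

lemma nonarchimedean_padic_abs: "prime p \<Longrightarrow> \<not> archimedean (padic_abs p)"
  using padic_abs_of_int_le_1[of p "int _"] by (intro nonarchimedeanI absolute_value_padic_abs) auto

lemma nonarchimedean_padic_extension:
  fixes w :: "'k::field_char_0 \<Rightarrow> real"
  assumes p: "prime p" and w: "w \<in> extensions (padic_abs p)" shows "\<not> archimedean w"
proof (rule nonarchimedeanI[OF extensionsD(1)[OF w]])
  fix n
  show "w (of_nat n) \<le> 1"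
    using extensionsD(2)[OF w, of "of_nat n"] padic_abs_of_int_le_1[OF p, of "int n"] by simp
qed

text \<open>Such a prime divides the denominator.\<close>

lemma finite_padic_abs_gt_1: "finite {p. prime p \<and> padic_abs p q > 1}"
proof -
  obtain a c where ac: "q = of_int a / of_int c" "c \<noteq> 0"
    by (metis Fract_of_int_quotient Rat_cases less_irrefl)
  have "p \<le> nat \<bar>c\<bar>" if p: "prime p" "padic_abs p q > 1" for p
  proof -
    have "int p dvd c"
    proof (rule ccontr)
      assume "\<not> int p dvd c"
      then have "padic_abs p q = padic_abs p (of_int a)"
        using p by (simp add: ac(1) absolute_value_divide[OF absolute_value_padic_abs[OF p(1)]] padic_abs_of_int_coprime)
      then show False using padic_abs_of_int_le_1[OF p(1), of a] p(2) by simp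
    qed
    then show ?thesis using dvd_imp_le_int[OF ac(2), of "int p"] by (simp add: le_nat_iff)
  qed
  then have "{p. prime p \<and> padic_abs p q > 1} \<subseteq> {..nat \<bar>c\<bar>}" by auto
  then show ?thesis using finite_subset by blast
qed

context rat_basis
begin

text \<open>By \<open>local_degree_eq\<close> the lengths of the local bases are the local degrees,
  so the choice of local bases no longer appears.\<close>

lemma place_structure:
  assumes "nontrivial_absolute_value u"
  shows "finite (extensions u :: ('k \<Rightarrow> real) set)"
    and "(\<Sum>w\<in>extensions u. local_degree (w :: 'k \<Rightarrow> real)) = D"
    and "(w :: 'k \<Rightarrow> real) \<in> extensions u \<Longrightarrow> 0 < local_degree w"
    and "x \<noteq> 0 \<Longrightarrow> u (field_norm x) \<le> (\<Prod>w\<in>extensions u. w x ^ local_degree w)"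
proof -
  interpret nontrivial_absolute_value u by fact
  interpret number_field_place D b crd u ..
  have "\<exists>y. local_basis u w (local_degree w) y" if w: "w \<in> extensions u" for w :: "'k \<Rightarrow> real"
  proof -
    obtain m y where my: "local_basis u w m y" using local_basis_exists[OF w] by blast
    then show ?thesis using local_degree_eq[OF extensionsD(1)[OF w] my w] by blast
  qed
  then obtain y where y: "\<And>w :: 'k \<Rightarrow> real. w \<in> extensions u \<Longrightarrow> local_basis u w (local_degree w) (y w)"
    by metis
  show "finite (extensions u :: ('k \<Rightarrow> real) set)" by (rule finite_extensions)
  show "(\<Sum>w\<in>extensions u. local_degree (w :: 'k \<Rightarrow> real)) = D"
    by (rule extensions_structure(1)[OF y])
  show "(w :: 'k \<Rightarrow> real) \<in> extensions u \<Longrightarrow> 0 < local_degree w"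
    using local_basis_pos y by blast
  show "x \<noteq> 0 \<Longrightarrow> u (field_norm x) \<le> (\<Prod>w\<in>extensions u. w x ^ local_degree w)"
    by (rule extensions_structure(2)[OF y])
qed

lemma local_degree_pos:
  assumes "(w :: 'k \<Rightarrow> real) \<in> standard_absolute_values" shows "0 < local_degree w"
  using assms place_structure(3)[OF nontrivial_rat_abs] place_structure(3)[OF nontrivial_padic_abs]
  by (auto simp: standard_absolute_values_eq)

lemma ln_field_norm_le:
  assumes u: "nontrivial_absolute_value u" and x: "x \<noteq> 0"
  shows "ln (u (field_norm x)) \<le> (\<Sum>w\<in>extensions u. real (local_degree w) * ln (w x))"
proof -
  have pos: "0 < w x" if "w \<in> extensions u" for w :: "'k \<Rightarrow> real"
    using absolute_value_pos[OF extensionsD(1)[OF that] x] .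
  have "0 < u (field_norm x)"
    using absolute_value_pos[OF nontrivial_absolute_value.u[OF u] field_norm_nonzero[OF x]] .
  then have "ln (u (field_norm x)) \<le> ln (\<Prod>w\<in>extensions u. w x ^ local_degree w)"
    using place_structure(4)[OF u x] by simp
  also have "\<dots> = (\<Sum>w\<in>extensions u. ln (w x ^ local_degree w))"
  proof (rule ln_prod)
    fix w :: "'k \<Rightarrow> real" assume "w \<in> extensions u"
    then show "w x ^ local_degree w \<noteq> 0" using pos[of w] by simp
  qed (rule place_structure(1)[OF u])
  also have "\<dots> = (\<Sum>w\<in>extensions u. real (local_degree w) * ln (w x))"
    using pos by (intro sum.cong) (auto simp: ln_realpow)
  finally show ?thesis .
qed

text \<open>Outside the finite set \<open>Bad\<close> of primes, the matrix of multiplication by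
  \<open>x\<close> is p-integral, so the powers of \<open>x\<close> have bounded coordinates and no
  absolute value over \<open>p\<close> exceeds 1 at \<open>x\<close>.\<close>

lemma finite_standard_gt_1: "finite {w :: 'k \<Rightarrow> real. w \<in> standard_absolute_values \<and> 1 < w x}"
proof -
  define Bad where "Bad = (\<Union>i\<in>{..<D}. \<Union>j\<in>{..<D}. {p. prime p \<and> padic_abs p (crd i (x * b j)) > 1})"
  have "finite Bad" unfolding Bad_def by (intro finite_UN_I finite_padic_abs_gt_1) auto
  moreover have "w x \<le> 1" if p: "prime p" "p \<notin> Bad" and w: "w \<in> extensions (padic_abs p)" for p and w :: "'k \<Rightarrow> real"
  proof -
    interpret nontrivial_absolute_value "padic_abs p" by (rule nontrivial_padic_abs[OF p(1)])
    interpret number_field_place D b crd "padic_abs p" ..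
    note av = extensionsD(1)[OF w]
    define M where "M = (\<Sum>i<D. padic_abs p (crd i 1))"
    have M: "0 \<le> M" by (simp add: M_def sum_nonneg absolute_value_nonneg[OF u])
    have entries: "padic_abs p (crd i (x * b j)) \<le> 1" if "i < D" "j < D" for i j
    proof -
      have "p \<notin> {p. prime p \<and> padic_abs p (crd i (x * b j)) > 1}" using p(2) that unfolding Bad_def by blast
      then show ?thesis using p(1) by simp
    qed
    \<comment> \<open>The coordinates of 1 need not be p-integral; their size \<open>M\<close>
      persists for all powers, since the matrix is integral and the absolute value
      nonarchimedean.\<close>
    have crd: "padic_abs p (crd i (x ^ n)) \<le> M" if "i < D" for i n
      using that
    proof (induction n arbitrary: i)
      case 0
      then show ?case
        unfolding M_def using member_le_sum[of i "{..<D}" "\<lambda>i. padic_abs p (crd i 1)"] absolute_value_nonneg[OF u] by simp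
    next
      case (Suc n)
      have "crd i (x ^ Suc n) = (\<Sum>k<D. crd k (x ^ n) * crd i (x * b k))"
        using crd_mult[OF Suc.prems, of x "x ^ n"] by simp
      also have "padic_abs p \<dots> \<le> M"
      proof (rule nonarchimedean_sum_le[OF u nonarchimedean_padic_abs[OF p(1)] M])
        fix k assume "k \<in> {..<D}"
        then have "padic_abs p (crd k (x ^ n)) * padic_abs p (crd i (x * b k)) \<le> M * 1"
          using Suc M by (intro mult_mono entries absolute_value_nonneg[OF u]) auto
        then show "padic_abs p (crd k (x ^ n) * crd i (x * b k)) \<le> M"
          by (simp add: absolute_value_mult[OF u])
      qed
      finally show ?case .
    qed
    show ?thesis
    proof (rule real_le_of_power_le)
      fix n
      have "w x ^ n \<le> (\<Sum>i<D. w (b i)) * basis_norm (x ^ n)"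
        using extension_le_basis_norm[OF w, of "x ^ n"] by (simp add: absolute_value_power[OF av])
      also have "\<dots> \<le> (\<Sum>i<D. w (b i)) * (\<Sum>i<D. M)"
        unfolding basis_norm_def
        by (intro mult_left_mono sum_mono crd sum_nonneg absolute_value_nonneg[OF av]) auto
      finally show "w x ^ n \<le> (\<Sum>i<D. w (b i)) * (\<Sum>i<D. M) * 1 ^ n" by simp
    qed (auto simp: absolute_value_nonneg[OF av])
  qed
  then have "{w :: 'k \<Rightarrow> real. w \<in> standard_absolute_values \<and> 1 < w x} \<subseteq>
      extensions rat_abs \<union> (\<Union>p\<in>{p \<in> Bad. prime p}. extensions (padic_abs p))"
    unfolding standard_absolute_values_eq using not_le by blast
  moreover have "finite (extensions rat_abs \<union> (\<Union>p\<in>{p \<in> Bad. prime p}. extensions (padic_abs p)) :: ('k \<Rightarrow> real) set)"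
    using \<open>finite Bad\<close> by (intro finite_UnI finite_UN_I place_structure(1) nontrivial_rat_abs nontrivial_padic_abs) auto
  ultimately show ?thesis using finite_subset by blast
qed

text \<open>Multiplying the local inequalities \<open>|N x|\<^sub>u \<le> \<Prod>\<^sub>w |x|\<^sub>w ^ n\<^sub>w\<close> over the places \<open>u\<close> of the rationals
  and using the product formula for \<open>N x\<close>.\<close>

theorem liouville_inequality:
  assumes \<nu>: "\<nu> \<in> standard_absolute_values" and x: "x \<noteq> 0"
    and T: "finite T" "{w :: 'k \<Rightarrow> real. w \<in> standard_absolute_values \<and> 1 < w x} \<subseteq> T" "T \<subseteq> standard_absolute_values"
  shows "- ln (\<nu> x) \<le> (\<Sum>w\<in>T. real (local_degree w) * ln (max 1 (w x)))"
proof (cases "1 \<le> \<nu> x")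
  case True
  have "0 \<le> (\<Sum>w\<in>T. real (local_degree w) * ln (max 1 (w x)))" by (intro sum_nonneg) auto
  then show ?thesis using True by (smt (verit) ln_ge_zero)
next
  case False
  have pos: "0 < w x" if "w \<in> standard_absolute_values" for w
    using absolute_value_pos[OF standard_absolute_value_is_absolute_value[OF that] x] .
  \<comment> \<open>The prime below \<nu>, if there is one; distinct primes have no common
    extension.\<close>
  define P0 where "P0 = {p. prime p \<and> \<nu> \<in> extensions (padic_abs p)}"
  have "p = q" if "p \<in> P0" "q \<in> P0" for p q
    using that extensions_disjoint[of \<nu>] inj_on_padic_abs unfolding P0_def inj_on_def by blast
  then have "P0 \<subseteq> {p}" if "p \<in> P0" for p using that by blast
  then have "finite P0" by (metis all_not_in_conv finite.emptyI finite.insertI finite_subset)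
  then obtain P where P: "finite P" "P0 \<subseteq> P" "\<forall>p\<in>P. prime p"
      "ln \<bar>real_of_rat (field_norm x)\<bar> + (\<Sum>p\<in>P. ln (padic_abs p (field_norm x))) = 0"
    using product_formula_rat[OF field_norm_nonzero[OF x], of P0] unfolding P0_def by blast
  define V where "V = insert rat_abs (padic_abs ` P)"
  have V: "finite V" using P by (simp add: V_def)
  have Vnt: "nontrivial_absolute_value u" if "u \<in> V" for u
    using that P nontrivial_rat_abs nontrivial_padic_abs by (auto simp: V_def)
  define S :: "('k \<Rightarrow> real) set" where "S = (\<Union>u\<in>V. extensions u)"
  have S: "finite S" unfolding S_def using V place_structure(1)[OF Vnt] by blast
  have Sstd: "S \<subseteq> standard_absolute_values"
    using P by (auto simp: S_def V_def standard_absolute_values_eq)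
  have \<nu>S: "\<nu> \<in> S"
    using \<nu> P by (auto simp: S_def V_def standard_absolute_values_eq P0_def)
  have "rat_abs \<notin> padic_abs ` P"
  proof
    assume "rat_abs \<in> padic_abs ` P"
    then obtain p where "p \<in> P" "rat_abs = padic_abs p" by blast
    then show False using padic_abs_neq_rat_abs[of p] P(3) by simp
  qed
  moreover have "inj_on padic_abs P" using inj_on_padic_abs P(3) by (auto simp: inj_on_def)
  ultimately have "0 = (\<Sum>u\<in>V. ln (u (field_norm x)))"
    using P by (simp add: V_def sum.reindex rat_abs_def)
  also have "\<dots> \<le> (\<Sum>u\<in>V. \<Sum>w\<in>extensions u. real (local_degree w) * ln ((w :: 'k \<Rightarrow> real) x))"
    by (intro sum_mono ln_field_norm_le Vnt x)
  also have "\<dots> = (\<Sum>w\<in>S. real (local_degree w) * ln (w x))"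
    unfolding S_def
    by (rule sum.UNION_disjoint[symmetric])
      (use V place_structure(1)[OF Vnt] extensions_disjoint in blast)+
  \<comment> \<open>At \<nu> the logarithm is negative and the local degree is at least 1, so one
    copy of \<open>ln (\<nu> x)\<close> can be split off.\<close>
  also have "\<dots> \<le> (\<Sum>w\<in>S. (if w = \<nu> then ln (\<nu> x) else 0) + real (local_degree w) * ln (max 1 (w x)))"
  proof (rule sum_mono)
    fix w assume w: "w \<in> S"
    show "real (local_degree w) * ln (w x) \<le> (if w = \<nu> then ln (\<nu> x) else 0) + real (local_degree w) * ln (max 1 (w x))"
    proof (cases "w = \<nu>")
      case True
      have "1 \<le> real (local_degree \<nu>)" using local_degree_pos[OF \<nu>] by simp
      moreover have "ln (\<nu> x) \<le> 0" using False pos[OF \<nu>] by simp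
      ultimately have "real (local_degree \<nu>) * ln (\<nu> x) \<le> 1 * ln (\<nu> x)"
        by (rule mult_right_mono_neg)
      then show ?thesis using True False by simp
    next
      case False
      have "ln (w x) \<le> ln (max 1 (w x))" using pos w Sstd by (intro ln_mono) auto
      then show ?thesis using False by (simp add: mult_left_mono)
    qed
  qed
  also have "\<dots> = ln (\<nu> x) + (\<Sum>w\<in>S. real (local_degree w) * ln (max 1 (w x)))"
    using S \<nu>S by (simp add: sum.distrib)
  \<comment> \<open>A place outside \<open>T\<close> has \<open>w x \<le> 1\<close>, so its summand
    is \<open>ln 1\<close>.\<close>
  also have "(\<Sum>w\<in>S. real (local_degree w) * ln (max 1 (w x))) = (\<Sum>w\<in>S \<inter> T. real (local_degree w) * ln (max 1 (w x)))"
    using S Sstd T(2) by (intro sum.mono_neutral_right) (auto simp: max_def not_le)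
  also have "\<dots> \<le> (\<Sum>w\<in>T. real (local_degree w) * ln (max 1 (w x)))"
    using T(1) by (intro sum_mono2) auto
  finally show ?thesis by simp
qed

end

no_notation Matrix.vec_index (infixl \<open>$\<close> 100)

section \<open>Integer polynomials of degree at most 2\<close>

text \<open>The derivative is an exact shift of coefficients in spite of the truncated subtraction:
  a monomial without the variable carries the factor 0.\<close>

lemma lookup_mpoly_pderiv:
  "Poly_Mapping.lookup (mpoly_pderiv i f) m =
     int (Poly_Mapping.lookup m i + 1) * Poly_Mapping.lookup f (m + Poly_Mapping.single i 1)"
proof -
  let ?e = "Poly_Mapping.single i 1 :: 'a \<Rightarrow>\<^sub>0 nat"
  define g where "g = (\<lambda>m'. int (Poly_Mapping.lookup m' i) * Poly_Mapping.lookup f m')"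
  have "Poly_Mapping.lookup (Poly_Mapping.single (m' - ?e) (g m')) m = (if m' = m + ?e then g m' else 0)" for m'
  proof (cases "Poly_Mapping.lookup m' i = 0")
    case True
    then have "m' \<noteq> m + ?e" by (auto simp: lookup_add)
    then show ?thesis using True by (simp add: g_def)
  next
    case False
    have "m' - ?e = m \<longleftrightarrow> m' = m + ?e"
    proof
      assume "m' - ?e = m"
      then have m: "Poly_Mapping.lookup m k = Poly_Mapping.lookup m' k - Poly_Mapping.lookup ?e k" for k
        by (auto simp: lookup_minus)
      show "m' = m + ?e"
        using False by (intro poly_mapping_eqI) (auto simp: lookup_add m lookup_single when_def)
    qed simp
    then show ?thesis by (simp add: lookup_single when_def)
  qed
  then have "Poly_Mapping.lookup (mpoly_pderiv i f) m = (\<Sum>m'\<in>Poly_Mapping.keys f. if m' = m + ?e then g m' else 0)"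
    by (simp add: mpoly_pderiv_def lookup_sum g_def)
  also have "\<dots> = g (m + ?e)"
    by (simp add: sum.delta' in_keys_iff g_def)
  finally show ?thesis by (simp add: g_def lookup_add)
qed

text \<open>\<open>k\<close> is the number of derivatives that have been taken of a quadratic polynomial.\<close>

definition derived_quadratic :: "nat \<Rightarrow> real \<Rightarrow> 'n::finite int_mpoly \<Rightarrow> bool" where
  "derived_quadratic k c f \<longleftrightarrow> (\<forall>m. \<bar>of_int (Poly_Mapping.lookup f m)\<bar> \<le> c) \<and>
     (\<forall>m\<in>Poly_Mapping.keys f. (\<Sum>i\<in>UNIV. Poly_Mapping.lookup m i) + k \<le> 2)"

text \<open>The new factor is an exponent, at most the remaining degree \<open>2 - k\<close>. Thus a
  first derivative doubles the bound \<open>c\<close>, and a second one leaves it at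
  \<open>2 * c\<close>.\<close>

lemma derived_quadratic_pderiv:
  assumes f: "derived_quadratic k c f"
  shows "derived_quadratic (Suc k) (real (2 - k) * c) (mpoly_pderiv i f)"
proof -
  have c: "0 \<le> c" using f unfolding derived_quadratic_def by (meson abs_ge_zero order_trans)
  have deg: "(\<Sum>j\<in>UNIV. Poly_Mapping.lookup m j) + Suc k \<le> 2"
    if "Poly_Mapping.lookup f (m + Poly_Mapping.single i 1) \<noteq> 0" for m
  proof -
    have "(\<Sum>j\<in>UNIV. Poly_Mapping.lookup (m + Poly_Mapping.single i 1) j) + k \<le> 2"
      using f that by (auto simp: derived_quadratic_def in_keys_iff)
    moreover have "(\<Sum>j\<in>UNIV. Poly_Mapping.lookup (m + Poly_Mapping.single i 1) j) =
        (\<Sum>j\<in>UNIV. Poly_Mapping.lookup m j) + 1"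
      by (simp add: lookup_add lookup_single when_def sum.distrib)
    ultimately show ?thesis by simp
  qed
  show ?thesis
    unfolding derived_quadratic_def
  proof (intro conjI allI ballI)
    fix m
    show "\<bar>real_of_int (Poly_Mapping.lookup (mpoly_pderiv i f) m)\<bar> \<le> real (2 - k) * c"
    proof (cases "Poly_Mapping.lookup f (m + Poly_Mapping.single i 1) = 0")
      case True
      then show ?thesis using c by (simp add: lookup_mpoly_pderiv)
    next
      case False
      have "Poly_Mapping.lookup m i \<le> (\<Sum>j\<in>UNIV. Poly_Mapping.lookup m j)"
        by (rule member_le_sum) auto
      then have "Poly_Mapping.lookup m i + 1 \<le> 2 - k" using deg[OF False] by simp
      then have "real (Poly_Mapping.lookup m i + 1) * \<bar>real_of_int (Poly_Mapping.lookup f (m + Poly_Mapping.single i 1))\<bar>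
          \<le> real (2 - k) * c"
        using f c by (intro mult_mono) (auto simp: derived_quadratic_def simp del: of_nat_add)
      then show ?thesis by (simp add: lookup_mpoly_pderiv abs_mult)
    qed
  next
    fix m assume "m \<in> Poly_Mapping.keys (mpoly_pderiv i f)"
    then show "(\<Sum>j\<in>UNIV. Poly_Mapping.lookup m j) + Suc k \<le> 2"
      by (intro deg) (auto simp: in_keys_iff lookup_mpoly_pderiv)
  qed
qed

lemma derived_quadratic_eq_0: "derived_quadratic (Suc (Suc (Suc k))) c f \<Longrightarrow> f = 0"
  by (auto simp: derived_quadratic_def simp flip: keys_eq_empty)

text \<open>The possible monomials are 1 and the variables.\<close>

lemma card_keys_derived_quadratic_1:
  fixes f :: "'n::finite int_mpoly"
  assumes f: "derived_quadratic 1 c f" shows "card (Poly_Mapping.keys f) \<le> CARD('n) + 1"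
proof -
  have "m \<in> insert 0 (range (\<lambda>i. Poly_Mapping.single i 1))" if m: "m \<in> Poly_Mapping.keys f" for m
  proof (cases "m = 0")
    case False
    then obtain i where i: "Poly_Mapping.lookup m i \<noteq> 0" by (metis poly_mapping_eqI lookup_zero)
    have "(\<Sum>j\<in>UNIV. Poly_Mapping.lookup m j) \<le> 1" using f m by (force simp: derived_quadratic_def)
    moreover have "(\<Sum>j\<in>UNIV. Poly_Mapping.lookup m j) = Poly_Mapping.lookup m i + (\<Sum>j\<in>UNIV - {i}. Poly_Mapping.lookup m j)"
      by (rule sum.remove) auto
    ultimately have "Poly_Mapping.lookup m i = 1" "(\<Sum>j\<in>UNIV - {i}. Poly_Mapping.lookup m j) = 0"
      using i by linarith+
    moreover from this have "Poly_Mapping.lookup m j = 0" if "j \<noteq> i" for j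
      using that sum_eq_0_iff[of "UNIV - {i}" "Poly_Mapping.lookup m"] by simp
    ultimately have "m = Poly_Mapping.single i 1"
      by (intro poly_mapping_eqI) (auto simp: lookup_single when_def)
    then show ?thesis by simp
  qed simp
  then have "card (Poly_Mapping.keys f) \<le> card (insert 0 (range (\<lambda>i::'n. Poly_Mapping.single i (1::nat))))"
    by (intro card_mono) auto
  also have "\<dots> \<le> Suc (card (range (\<lambda>i::'n. Poly_Mapping.single i (1::nat))))"
    by (rule card_insert_le_m1) auto
  also have "\<dots> \<le> CARD('n) + 1" using card_image_le[of UNIV "\<lambda>i::'n. Poly_Mapping.single i (1::nat)"] by simp
  finally show ?thesis .
qed

lemma card_keys_derived_quadratic_2:
  assumes f: "derived_quadratic 2 c f" shows "card (Poly_Mapping.keys f) \<le> 1"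
proof -
  have "Poly_Mapping.keys f \<subseteq> {0}"
    using f by (auto simp: derived_quadratic_def intro!: poly_mapping_eqI)
  then show ?thesis using card_mono[of "{0}" "Poly_Mapping.keys f"] by simp
qed

lemma nonarchimedean_of_int_le_1:
  assumes v: "absolute_value v" "\<not> archimedean v" shows "v (of_int a) \<le> 1"
proof -
  have "v (of_nat n) \<le> 1" for n
    using nonarchimedean_sum_le[OF v, of 1 "{..<n}" "\<lambda>_. 1"] by (simp add: absolute_value_1[OF v(1)])
  from this[of "nat \<bar>a\<bar>"] show ?thesis
    by (cases "0 \<le> a") (auto simp: absolute_value_minus[OF v(1)])
qed

context
  fixes v :: "'k::field_char_0 \<Rightarrow> real" and x :: "'k^'n::finite" and H :: real
  assumes v: "absolute_value v" and H: "1 \<le> H" "\<And>i. v (x $ i) \<le> H"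
begin

lemma absolute_value_monomial_le:
  assumes "derived_quadratic k c f" "m \<in> Poly_Mapping.keys f"
  shows "v (\<Prod>i\<in>UNIV. (x $ i) ^ Poly_Mapping.lookup m i) \<le> H ^ (2 - k)"
proof -
  have "v (\<Prod>i\<in>UNIV. (x $ i) ^ Poly_Mapping.lookup m i) \<le> (\<Prod>i\<in>UNIV. H ^ Poly_Mapping.lookup m i)"
    unfolding absolute_value_prod[OF v] absolute_value_power[OF v]
    using H by (intro prod_mono conjI power_mono zero_le_power absolute_value_nonneg[OF v])
  also have "\<dots> = H ^ (\<Sum>i\<in>UNIV. Poly_Mapping.lookup m i)" by (simp add: power_sum)
  also have "\<dots> \<le> H ^ (2 - k)"
    using assms H by (intro power_increasing) (auto simp: derived_quadratic_def)
  finally show ?thesis .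
qed

lemma absolute_value_mpoly_eval_le:
  assumes f: "derived_quadratic k c f"
  shows "v (mpoly_eval f x) \<le> real (card (Poly_Mapping.keys f)) * (c * H ^ (2 - k))"
proof -
  have "v (mpoly_eval f x) \<le> (\<Sum>m\<in>Poly_Mapping.keys f. v (of_int (Poly_Mapping.lookup f m)) *
      v (\<Prod>i\<in>UNIV. (x $ i) ^ Poly_Mapping.lookup m i))"
    unfolding mpoly_eval_def absolute_value_mult[OF v, symmetric] by (rule absolute_value_sum[OF v])
  also have "\<dots> \<le> (\<Sum>m\<in>Poly_Mapping.keys f. c * H ^ (2 - k))"
  proof (intro sum_mono mult_mono absolute_value_nonneg[OF v] absolute_value_monomial_le[OF f])
    fix m
    have "v (of_int (Poly_Mapping.lookup f m)) \<le> \<bar>of_int (Poly_Mapping.lookup f m)\<bar>"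
      by (rule absolute_value_of_int_le[OF v])
    also have "\<dots> \<le> c" using f by (simp add: derived_quadratic_def)
    finally show "v (of_int (Poly_Mapping.lookup f m)) \<le> c" .
    have "0 \<le> \<bar>real_of_int (Poly_Mapping.lookup f m)\<bar>" by simp
    also have "\<dots> \<le> c" using f by (simp add: derived_quadratic_def)
    finally show "0 \<le> c" .
  qed
  finally show ?thesis by simp
qed

text \<open>Integer coefficients have absolute value at most 1 and sums cost nothing. Hence
  constants enter the Liouville bound only at archimedean places.\<close>

lemma nonarchimedean_mpoly_eval_le:
  assumes "\<not> archimedean v" and f: "derived_quadratic k c f"
  shows "v (mpoly_eval f x) \<le> H ^ (2 - k)"
  unfolding mpoly_eval_def
proof (rule nonarchimedean_sum_le[OF v assms(1)])
  fix m assume m: "m \<in> Poly_Mapping.keys f"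
  have "v (of_int (Poly_Mapping.lookup f m)) * v (\<Prod>i\<in>UNIV. (x $ i) ^ Poly_Mapping.lookup m i) \<le> 1 * H ^ (2 - k)"
    by (intro mult_mono absolute_value_monomial_le[OF f m] absolute_value_nonneg[OF v]
        nonarchimedean_of_int_le_1[OF v assms(1)]) auto
  then show "v (of_int (Poly_Mapping.lookup f m) * (\<Prod>i\<in>UNIV. (x $ i) ^ Poly_Mapping.lookup m i)) \<le> H ^ (2 - k)"
    by (simp add: absolute_value_mult[OF v])
qed (use H in simp)

end

lemma absolute_value_matrix_det_le:
  fixes A :: "'k::field^'n^'n::finite"
  assumes v: "absolute_value v" and A: "\<And>i j. v (A $ i $ j) \<le> B"
  shows "v (Determinants.det A) \<le> fact CARD('n) * B ^ CARD('n)"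
    and "\<not> archimedean v \<Longrightarrow> v (Determinants.det A) \<le> B ^ CARD('n)"
proof -
  have B: "0 \<le> B" using A absolute_value_nonneg[OF v] order_trans by blast
  have "v (of_int (sign p)) = 1" for p :: "'n \<Rightarrow> 'n"
    by (simp add: sign_def absolute_value_1[OF v] absolute_value_minus[OF v])
  then have summand: "v (of_int (sign p) * (\<Prod>i\<in>UNIV. A $ i $ p i)) \<le> B ^ CARD('n)" for p
    unfolding absolute_value_mult[OF v] absolute_value_prod[OF v]
    using prod_mono[of UNIV "\<lambda>i. v (A $ i $ p i)" "\<lambda>_. B"] by (simp add: A absolute_value_nonneg[OF v])
  have "v (Determinants.det A) \<le> (\<Sum>p\<in>{p. p permutes (UNIV :: 'n set)}. v (of_int (sign p) * (\<Prod>i\<in>UNIV. A $ i $ p i)))"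
    unfolding Determinants.det_def by (rule absolute_value_sum[OF v])
  also have "\<dots> \<le> (\<Sum>p\<in>{p. p permutes (UNIV :: 'n set)}. B ^ CARD('n))" by (intro sum_mono summand)
  also have "\<dots> = fact CARD('n) * B ^ CARD('n)" by (simp add: card_permutations[OF refl])
  finally show "v (Determinants.det A) \<le> fact CARD('n) * B ^ CARD('n)" .
  assume na: "\<not> archimedean v"
  show "v (Determinants.det A) \<le> B ^ CARD('n)"
    unfolding Determinants.det_def using B by (intro nonarchimedean_sum_le[OF v na] summand) auto
qed

text \<open>Cramer's rule: the left side is the absolute value of a determinant in which column
  \<open>k\<close> of \<open>A\<close> is replaced by a unit vector, whose entries are covered by
  \<open>1 \<le> B\<close>.\<close>

lemma absolute_value_matrix_inv_le:
  fixes A :: "'k::field^'n^'n::finite"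
  assumes v: "absolute_value v" and A: "\<And>i j. v (A $ i $ j) \<le> B" and "1 \<le> B" and inv: "invertible A"
  shows "v (matrix_inv A $ k $ l) * v (Determinants.det A) \<le> fact CARD('n) * B ^ CARD('n)"
proof -
  have right: "A ** matrix_inv A = Finite_Cartesian_Product.mat 1"
    using inv unfolding invertible_def matrix_inv_def by (rule someI2_ex) simp
  define x where "x = (\<chi> k. matrix_inv A $ k $ l)"
  have Ax: "(A *v x) $ i = (if i = l then 1 else 0)" for i
    using arg_cong[OF right, of "\<lambda>M. M $ i $ l"]
    by (simp add: x_def matrix_vector_mult_def matrix_matrix_mult_def Finite_Cartesian_Product.mat_def)
  have "v ((\<chi> i j. if j = k then (A *v x) $ i else A $ i $ j) $ i $ j) \<le> B" for i j
    using A \<open>1 \<le> B\<close> by (auto simp: Ax absolute_value_1[OF v] absolute_value_0[OF v])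
  from absolute_value_matrix_det_le(1)[OF v this]
  show ?thesis
    unfolding cramer_lemma by (simp add: x_def absolute_value_mult[OF v])
qed

section \<open>Operator norms over a completion\<close>

context
  fixes v :: "'k::field_char_0 \<Rightarrow> real"
  assumes v: "absolute_value v"
begin

interpretation R: field "completion v"
  by (rule field_completion[OF v])

lemma completion_abs_le_vec_norm:
  fixes x :: "'n::finite \<Rightarrow> (nat \<Rightarrow> 'k) set"
  assumes "x \<in> completion_vecs v"
  shows "completion_abs v (x i) \<le> vec_norm v x"
proof (cases "archimedean v")
  case True
  have "completion_abs v (x i) = sqrt ((completion_abs v (x i))\<^sup>2)"
    using assms completion_abs_nonneg[OF v] by (auto simp: completion_vecs_def)
  also have "\<dots> \<le> sqrt (\<Sum>i\<in>UNIV. (completion_abs v (x i))\<^sup>2)"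
    by (intro real_sqrt_le_mono member_le_sum) auto
  finally show ?thesis using True by (simp add: vec_norm_def)
qed (simp add: vec_norm_def)

lemma vec_norm_nonneg:
  fixes x :: "'n::finite \<Rightarrow> (nat \<Rightarrow> 'k) set"
  assumes "x \<in> completion_vecs v" shows "0 \<le> vec_norm v x"
  using completion_abs_le_vec_norm[OF assms, of undefined] completion_abs_nonneg[OF v, of "x undefined"] assms
  by (auto simp: completion_vecs_def)

text \<open>Both the Hermitian and the maximum norm are at most the sum of the absolute values,
  which allows one estimate for all places.\<close>

lemma vec_norm_le:
  fixes x :: "'n::finite \<Rightarrow> (nat \<Rightarrow> 'k) set"
  assumes x: "x \<in> completion_vecs v" and B: "\<And>i. completion_abs v (x i) \<le> B"
  shows "vec_norm v x \<le> real CARD('n) * B"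
proof -
  have nn: "0 \<le> completion_abs v (x i)" for i
    using x completion_abs_nonneg[OF v] by (auto simp: completion_vecs_def)
  have sum: "(\<Sum>i\<in>UNIV. completion_abs v (x i)) \<le> real CARD('n) * B"
    using sum_mono[of UNIV "\<lambda>i. completion_abs v (x i)" "\<lambda>_. B"] B by simp
  show ?thesis
  proof (cases "archimedean v")
    case True
    have "vec_norm v x = L2_set (\<lambda>i. completion_abs v (x i)) UNIV"
      using True by (simp add: vec_norm_def L2_set_def)
    also have "\<dots> \<le> (\<Sum>i\<in>UNIV. completion_abs v (x i))" using nn by (rule L2_set_le_sum)
    finally show ?thesis using sum by simp
  next
    case False
    have "completion_abs v (x i) \<le> (\<Sum>i\<in>UNIV. completion_abs v (x i))" for i
      using nn by (intro member_le_sum) auto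
    then have "vec_norm v x \<le> (\<Sum>i\<in>UNIV. completion_abs v (x i))"
      using False by (simp add: vec_norm_def)
    then show ?thesis using sum by simp
  qed
qed

lemma completion_vecs_closed: "x \<in> completion_vecs v \<Longrightarrow> x i \<in> carrier (completion v)"
  by (simp add: completion_vecs_def)

lemma higher_deriv_closed:
  assumes "\<forall>m<k. u m \<in> completion_vecs v"
  shows "higher_deriv v k F x u \<in> completion_vecs v"
proof -
  have "u m i \<in> carrier (completion v)" if "m < k" for m i
    using assms that by (auto intro: completion_vecs_closed)
  then show ?thesis
    unfolding completion_vecs_def higher_deriv_def
    by (auto intro!: R.finsum_closed R.m_closed R.finprod_closed completion_embed_closed[OF v])
qed

lemma completion_matvec_closed:
  "y \<in> completion_vecs v \<Longrightarrow> completion_matvec v M y \<in> completion_vecs v"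
  unfolding completion_vecs_def completion_matvec_def
  by (auto intro!: R.finsum_closed R.m_closed completion_embed_closed[OF v])

lemma completion_scale_closed:
  "y \<in> completion_vecs v \<Longrightarrow> completion_scale v c y \<in> completion_vecs v"
  unfolding completion_vecs_def completion_scale_def
  by (auto intro!: R.m_closed completion_embed_closed[OF v])

text \<open>There are \<open>CARD('n) ^ k\<close> index tuples, and a component of a vector is at
  most the norm of the vector.\<close>

lemma completion_abs_higher_deriv_le:
  fixes F :: "'n::finite int_mpoly^'n"
  assumes u: "\<forall>m<k. u m \<in> completion_vecs v"
    and C: "\<And>is. length is = k \<Longrightarrow> v (mpoly_eval (fold mpoly_pderiv is (F $ j)) x) \<le> C"
  shows "completion_abs v (higher_deriv v k F x u j) \<le> real (CARD('n) ^ k) * (C * (\<Prod>m<k. vec_norm v (u m)))"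
proof -
  have fin: "finite {is :: 'n list. length is = k}" and card: "card {is :: 'n list. length is = k} = CARD('n) ^ k"
    using finite_lists_length_eq[of "UNIV :: 'n set" k] card_lists_length_eq[of "UNIV :: 'n set" k] by auto
  have prod_closed: "(\<Otimes>\<^bsub>completion v\<^esub>m\<in>{..<k}. u m (is ! m)) \<in> carrier (completion v)" for "is" :: "'n list"
  proof -
    have "u m i \<in> carrier (completion v)" if "m < k" for m i
      using u that by (auto intro: completion_vecs_closed)
    then show ?thesis by (auto intro!: R.finprod_closed)
  qed
  have "completion_abs v (higher_deriv v k F x u j) \<le> (\<Sum>is\<in>{is :: 'n list. length is = k}.
      completion_abs v (completion_embed v (mpoly_eval (fold mpoly_pderiv is (F $ j)) x) \<otimes>\<^bsub>completion v\<^esub>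
        (\<Otimes>\<^bsub>completion v\<^esub>m\<in>{..<k}. u m (is ! m))))"
    unfolding higher_deriv_def
    by (intro completion_abs_finsum[OF v] R.m_closed completion_embed_closed[OF v] prod_closed)
  also have "\<dots> \<le> (\<Sum>is\<in>{is :: 'n list. length is = k}. C * (\<Prod>m<k. vec_norm v (u m)))"
  proof (rule sum_mono)
    fix "is" :: "'n list" assume len: "is \<in> {is. length is = k}"
    have "completion_abs v (\<Otimes>\<^bsub>completion v\<^esub>m\<in>{..<k}. u m (is ! m)) = (\<Prod>m<k. completion_abs v (u m (is ! m)))"
      using u by (intro completion_abs_finprod[OF v]) (auto intro: completion_vecs_closed)
    also have "\<dots> \<le> (\<Prod>m<k. vec_norm v (u m))"
      using u by (intro prod_mono) (auto intro: completion_abs_le_vec_norm completion_abs_nonneg[OF v] completion_vecs_closed)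
    finally have prod: "completion_abs v (\<Otimes>\<^bsub>completion v\<^esub>m\<in>{..<k}. u m (is ! m)) \<le> (\<Prod>m<k. vec_norm v (u m))" .
    have "0 \<le> C" using C[of "is"] len absolute_value_nonneg[OF v, of "mpoly_eval (fold mpoly_pderiv is (F $ j)) x"] by simp
    then show "completion_abs v (completion_embed v (mpoly_eval (fold mpoly_pderiv is (F $ j)) x) \<otimes>\<^bsub>completion v\<^esub>
        (\<Otimes>\<^bsub>completion v\<^esub>m\<in>{..<k}. u m (is ! m))) \<le> C * (\<Prod>m<k. vec_norm v (u m))"
      using C[of "is"] len prod
      by (subst completion_abs_mult[OF v completion_embed_closed[OF v] prod_closed], subst completion_abs_embed[OF v])
        (intro mult_mono completion_abs_nonneg[OF v] prod_closed, auto)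
  qed
  also have "\<dots> = real (CARD('n) ^ k) * (C * (\<Prod>m<k. vec_norm v (u m)))" using card by simp
  finally show ?thesis .
qed

lemma completion_abs_matvec_le:
  fixes M :: "'k^'n^'n::finite"
  assumes y: "y \<in> completion_vecs v" and C: "\<And>l. completion_abs v (y l) \<le> C" and M: "\<And>j l. v (M $ j $ l) \<le> B"
  shows "completion_abs v (completion_matvec v M y j) \<le> real CARD('n) * (B * C)"
proof -
  have "completion_abs v (completion_matvec v M y j) \<le>
      (\<Sum>l\<in>UNIV. completion_abs v (completion_embed v (M $ j $ l) \<otimes>\<^bsub>completion v\<^esub> y l))"
    unfolding completion_matvec_def
    by (intro completion_abs_finsum[OF v] R.m_closed completion_embed_closed[OF v] completion_vecs_closed[OF y])
  also have "\<dots> \<le> (\<Sum>l\<in>(UNIV :: 'n set). B * C)"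
  proof (rule sum_mono)
    fix l
    have "0 \<le> B" using M absolute_value_nonneg[OF v] order_trans by blast
    then show "completion_abs v (completion_embed v (M $ j $ l) \<otimes>\<^bsub>completion v\<^esub> y l) \<le> B * C"
      unfolding completion_abs_mult[OF v completion_embed_closed[OF v] completion_vecs_closed[OF y]] completion_abs_embed[OF v]
      by (intro mult_mono M C completion_abs_nonneg[OF v] completion_vecs_closed[OF y])
  qed
  finally show ?thesis by simp
qed

lemma completion_abs_scale:
  "y \<in> completion_vecs v \<Longrightarrow> completion_abs v (completion_scale v c y j) = v c * completion_abs v (y j)"
  unfolding completion_scale_def
  by (simp add: completion_abs_mult[OF v] completion_embed_closed[OF v] completion_vecs_closed completion_abs_embed[OF v])

text \<open>A real supremum is meaningful only once the quotients are bounded, so nonnegativity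
  rests on the bound as well. The zero tuple shows that there are quotients at all; where the
  denominator vanishes, the quotient is 0.\<close>

lemma multilinear_onorm_le:
  assumes "0 \<le> B" and A: "\<And>u. \<forall>m<k. u m \<in> completion_vecs v \<Longrightarrow> vec_norm v (A u) \<le> B * (\<Prod>m<k. vec_norm v (u m))"
    and A0: "\<And>u. \<forall>m<k. u m \<in> completion_vecs v \<Longrightarrow> A u \<in> completion_vecs v"
  shows "0 \<le> multilinear_onorm v k A" "multilinear_onorm v k A \<le> B"
proof -
  have z: "(\<lambda>_. \<zero>\<^bsub>completion v\<^esub>) \<in> (completion_vecs v :: ('a \<Rightarrow> (nat \<Rightarrow> 'k) set) set)"
    by (simp add: completion_vecs_def)
  have zero: "(\<lambda>_ _. \<zero>\<^bsub>completion v\<^esub>) \<in> {u :: nat \<Rightarrow> 'a \<Rightarrow> (nat \<Rightarrow> 'k) set. \<forall>m<k. u m \<in> completion_vecs v}"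
    by (simp add: completion_vecs_def)
  have prod: "0 \<le> (\<Prod>m<k. vec_norm v (u m))" if "\<forall>m<k. u m \<in> completion_vecs v" for u :: "nat \<Rightarrow> 'a \<Rightarrow> (nat \<Rightarrow> 'k) set"
    using that by (intro prod_nonneg vec_norm_nonneg) auto
  have le: "vec_norm v (A u) / (\<Prod>m<k. vec_norm v (u m)) \<le> B" if u: "\<forall>m<k. u m \<in> completion_vecs v" for u
  proof (cases "(\<Prod>m<k. vec_norm v (u m)) = 0")
    case True
    then show ?thesis using \<open>0 \<le> B\<close> by (simp only: div_by_0)
  next
    case False
    then have "0 < (\<Prod>m<k. vec_norm v (u m))" using prod[OF u] by (simp only: order_le_less) auto
    then show ?thesis using A[OF u] by (simp add: divide_le_eq)
  qed
  show "multilinear_onorm v k A \<le> B"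
    unfolding multilinear_onorm_def using zero le by (intro cSUP_least) auto
  have "0 \<le> vec_norm v (A (\<lambda>_ _. \<zero>\<^bsub>completion v\<^esub>)) / (\<Prod>m<k. vec_norm v ((\<lambda>_ _. \<zero>\<^bsub>completion v\<^esub>) m :: 'a \<Rightarrow> (nat \<Rightarrow> 'k) set))"
    using z by (intro divide_nonneg_nonneg vec_norm_nonneg A0 prod_nonneg) auto
  also have "\<dots> \<le> multilinear_onorm v k A"
    unfolding multilinear_onorm_def
    by (rule cSUP_upper[OF zero]) (auto intro!: bdd_aboveI[of _ B] le)
  finally show "0 \<le> multilinear_onorm v k A" .
qed

text \<open>Only \<open>k = 2\<close> contributes, because the higher derivatives of a quadratic map vanish.\<close>

lemma gamma_number_le:
  fixes F :: "'n::finite int_mpoly^'n"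
  assumes F: "\<And>j. derived_quadratic 0 c (F $ j)" and "0 \<le> c"
    and M: "\<And>j l. v (matrix_inv (mpoly_jacobian F x) $ j $ l) \<le> M" and half: "v (1 / 2) \<le> 2"
  shows "0 \<le> gamma_number v F x" "gamma_number v F x \<le> 4 * real CARD('n) ^ 4 * c * M"
proof -
  define n where "n = real CARD('n)"
  define A where "A = (\<lambda>(k :: nat) u. completion_scale v (1 / fact k)
       (completion_matvec v (matrix_inv (mpoly_jacobian F x)) (higher_deriv v k F x u)))"
  \<comment> \<open>Bounds for the k-th partial derivatives; those of order above 2 vanish.\<close>
  define E where "E = (\<lambda>k :: nat. if k = 2 then 2 * c else 0)"
  \<comment> \<open>From the inside: the \<open>n ^ k\<close> index tuples, the matrix with its
    \<open>n\<close> summands, the factor of the factorial, and \<open>n\<close> for the vector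
    norm.\<close>
  define B where "B = (\<lambda>k. n * (v (1 / fact k) * (n * (M * (n ^ k * E k)))))"
  have M0: "0 \<le> M" using M absolute_value_nonneg[OF v] order_trans by blast
  have B0: "0 \<le> B k" for k
    using \<open>0 \<le> c\<close> M0 by (auto simp: B_def E_def n_def absolute_value_nonneg[OF v] intro!: mult_nonneg_nonneg)
  have deriv: "v (mpoly_eval (fold mpoly_pderiv is (F $ j)) x) \<le> E k"
    if k: "2 \<le> k" and len: "length is = k" for "is" j k
  proof -
    obtain i1 i2 is' where is_eq: "is = i1 # i2 # is'" using k len by (cases "is"; cases "tl is") auto
    have 2: "derived_quadratic 2 (2 * c) (mpoly_pderiv i2 (mpoly_pderiv i1 (F $ j)))"
      using derived_quadratic_pderiv[OF derived_quadratic_pderiv[OF F], of i2 i1 j] by (simp add: numeral_2_eq_2)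
    show ?thesis
    proof (cases is')
      case Nil
      define H where "H = Max (insert 1 (range (\<lambda>i. v (x $ i))))"
      have H: "1 \<le> H" "\<And>i. v (x $ i) \<le> H" unfolding H_def by (rule Max_ge; simp)+
      have "v (mpoly_eval (mpoly_pderiv i2 (mpoly_pderiv i1 (F $ j))) x) \<le>
          real (card (Poly_Mapping.keys (mpoly_pderiv i2 (mpoly_pderiv i1 (F $ j))))) * (2 * c)"
        using absolute_value_mpoly_eval_le[OF v H 2] by simp
      also have "\<dots> \<le> 1 * (2 * c)"
        using card_keys_derived_quadratic_2[OF 2] \<open>0 \<le> c\<close> by (intro mult_right_mono) auto
      finally show ?thesis using Nil is_eq len by (simp add: E_def)
    next
      case (Cons i3 is'')
      have "mpoly_pderiv i3 (mpoly_pderiv i2 (mpoly_pderiv i1 (F $ j))) = 0"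
        using derived_quadratic_pderiv[OF 2, of i3] by (intro derived_quadratic_eq_0) (simp add: numeral_2_eq_2)
      moreover have "fold mpoly_pderiv js 0 = (0 :: 'n int_mpoly)" for js
        by (induction js) (auto simp: mpoly_pderiv_def)
      ultimately have "fold mpoly_pderiv is (F $ j) = 0" by (simp add: is_eq Cons)
      then show ?thesis
        using \<open>0 \<le> c\<close> by (simp add: mpoly_eval_def absolute_value_0[OF v] E_def)
    qed
  qed
  have A_closed: "A k u \<in> completion_vecs v" if "\<forall>m<k. u m \<in> completion_vecs v" for k u
    using that unfolding A_def by (intro completion_scale_closed completion_matvec_closed higher_deriv_closed)
  have onorm: "0 \<le> multilinear_onorm v k (A k)" "multilinear_onorm v k (A k) \<le> B k" if k: "2 \<le> k" for k
  proof -
    have "vec_norm v (A k u) \<le> B k * (\<Prod>m<k. vec_norm v (u m))" if u: "\<forall>m<k. u m \<in> completion_vecs v" for u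
    proof -
      note hd = higher_deriv_closed[OF u, of F x]
      have "completion_abs v (higher_deriv v k F x u l) \<le> n ^ k * (E k * (\<Prod>m<k. vec_norm v (u m)))" for l
        using completion_abs_higher_deriv_le[OF u deriv[OF k]] by (simp add: n_def)
      then have "completion_abs v (completion_matvec v (matrix_inv (mpoly_jacobian F x)) (higher_deriv v k F x u) j)
          \<le> n * (M * (n ^ k * (E k * (\<Prod>m<k. vec_norm v (u m)))))" for j
        unfolding n_def by (rule completion_abs_matvec_le[OF hd _ M])
      then have "completion_abs v (A k u j) \<le> v (1 / fact k) * (n * (M * (n ^ k * (E k * (\<Prod>m<k. vec_norm v (u m))))))" for j
        unfolding A_def completion_abs_scale[OF completion_matvec_closed[OF hd]]
        by (intro mult_left_mono absolute_value_nonneg[OF v])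
      from vec_norm_le[OF A_closed[OF u] this] show ?thesis by (simp add: B_def n_def mult_ac)
    qed
    then show "0 \<le> multilinear_onorm v k (A k)" "multilinear_onorm v k (A k) \<le> B k"
      using multilinear_onorm_le[OF B0, of k "A k"] A_closed by blast+
  qed
  \<comment> \<open>The fourth power of \<open>n\<close> collects the vector norm, the matrix and
    the pairs of variables; the factor 4 below combines the 2 of a second derivative with the bound
    2 for \<open>v (1 / 2)\<close>.\<close>
  have "B 2 = 2 * v (1 / 2) * (n ^ 4 * c * M)" by (simp add: B_def E_def power2_eq_square power4_eq_xxxx mult_ac fact_2)
  also have "\<dots> \<le> 4 * (n ^ 4 * c * M)"
    using half \<open>0 \<le> c\<close> M0 by (intro mult_right_mono) (auto simp: n_def)
  finally have B2: "B 2 \<le> 4 * n ^ 4 * c * M" by simp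
  have summand: "multilinear_onorm v k (A k) powr (1 / (real k - 1)) \<le> 4 * n ^ 4 * c * M" if k: "2 \<le> k" for k
  proof (cases "k = 2")
    case True
    then show ?thesis using onorm[of 2] B2 by simp
  next
    case False
    then have "B k = 0" by (simp add: B_def E_def)
    then have "multilinear_onorm v k (A k) = 0" using onorm[OF k] by simp
    then show ?thesis using \<open>0 \<le> c\<close> M0 by (simp add: n_def)
  qed
  have gamma: "gamma_number v F x = (SUP k\<in>{2..}. multilinear_onorm v k (A k) powr (1 / (real k - 1)))"
    by (simp add: gamma_number_def A_def)
  show "gamma_number v F x \<le> 4 * real CARD('n) ^ 4 * c * M"
    unfolding gamma using summand by (intro cSUP_least) (auto simp: n_def)
  have "0 \<le> multilinear_onorm v 2 (A 2) powr (1 / (real 2 - 1))" by simp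
  also have "\<dots> \<le> gamma_number v F x"
    unfolding gamma by (rule cSUP_upper) (auto intro!: bdd_aboveI[of _ "4 * n ^ 4 * c * M"] summand)
  finally show "0 \<le> gamma_number v F x" .
qed

end

section \<open>The bound on the gamma number\<close>

definition max_abs :: "('k \<Rightarrow> real) \<Rightarrow> 'k^'n::finite \<Rightarrow> real" where
  "max_abs w x = Max (insert 1 (range (\<lambda>i. w (x $ i))))"

lemma max_abs_ge: "1 \<le> max_abs w x" "w (x $ i) \<le> max_abs w x"
  unfolding max_abs_def by (rule Max_ge; simp)+

text \<open>The infinite sum collapses to any finite \<open>T\<close> containing the places where
  some coordinate exceeds 1. The freedom in \<open>T\<close> permits one set for both the
  determinant and the height.\<close>

lemma (in rat_basis) weil_height_eq_sum:
  fixes x :: "'k^'n::finite"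
  assumes T: "finite T" "T \<subseteq> standard_absolute_values" "\<And>w i. w \<in> standard_absolute_values \<Longrightarrow> 1 < w (x $ i) \<Longrightarrow> w \<in> T"
  shows "real D * weil_height x = (\<Sum>w\<in>T. real (local_degree w) * ln (max_abs w x))"
proof -
  have "(\<Sum>\<^sub>\<infinity>w\<in>standard_absolute_values. real (local_degree w) * ln (Max (insert 1 (range (\<lambda>i. w (x $ i)))))) =
      (\<Sum>\<^sub>\<infinity>w\<in>T. real (local_degree w) * ln (Max (insert 1 (range (\<lambda>i. w (x $ i))))))"
  proof (rule infsum_cong_neutral)
    fix w assume "w \<in> standard_absolute_values - T"
    then have "Max (insert 1 (range (\<lambda>i. w (x $ i)))) = 1"
      using T(3) by (intro Max_eqI) (auto simp: not_less[symmetric])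
    then show "real (local_degree w) * ln (Max (insert 1 (range (\<lambda>i. w (x $ i))))) = 0" by simp
  qed (use T in auto)
  then show ?thesis
    using dimension_pos T(1) by (simp add: weil_height_def max_abs_def dimension_eq[symmetric])
qed

text \<open>Liouville's inequality for the determinant, whose size at each place is at most a power
  of \<open>max_abs w x\<close>, with a constant at the archimedean places only.\<close>

lemma (in rat_basis) neg_ln_det_le:
  fixes A :: "'k^'n^'n::finite" and x :: "'k^'n"
  assumes \<nu>: "\<nu> \<in> standard_absolute_values" and det: "Determinants.det A \<noteq> 0" and c: "1 \<le> c"
    and arch: "\<And>w i j. w \<in> standard_absolute_values \<Longrightarrow> w (A $ i $ j) \<le> c * max_abs w x"
    and nonarch: "\<And>w i j. w \<in> standard_absolute_values \<Longrightarrow> \<not> archimedean w \<Longrightarrow> w (A $ i $ j) \<le> max_abs w x"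
  shows "- ln (\<nu> (Determinants.det A)) \<le>
      real D * (ln (fact CARD('n) * c ^ CARD('n)) + real CARD('n) * weil_height x)"
    and "ln (max_abs \<nu> x) \<le> real D * weil_height x"
proof -
  define n where "n = CARD('n)"
  define d where "d = Determinants.det A"
  define L where "L = ln (fact n * c ^ n)"
  \<comment> \<open>All archimedean places are included, so that their local degrees sum to
    \<open>D\<close> exactly; \<nu> is included for the second claim.\<close>
  define T where "T = insert \<nu> (extensions rat_abs \<union> {w. w \<in> standard_absolute_values \<and> 1 < w d} \<union>
    (\<Union>i\<in>UNIV. {w. w \<in> standard_absolute_values \<and> 1 < w (x $ i)}))"
  have T: "finite T" "T \<subseteq> standard_absolute_values"
    using \<nu> finite_standard_gt_1 place_structure(1)[OF nontrivial_rat_abs]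
    by (auto simp: T_def) (auto simp: standard_absolute_values_eq)
  have ht: "real D * weil_height x = (\<Sum>w\<in>T. real (local_degree w) * ln (max_abs w x))"
    using T by (intro weil_height_eq_sum) (auto simp: T_def)
  have fc: "1 \<le> (fact n * c ^ n :: real)"
    using mult_mono[of 1 "fact n :: real" 1 "c ^ n"] c one_le_power[OF c, of n] by (simp add: fact_ge_1)
  have H0: "0 \<le> ln (max_abs w x)" for w using max_abs_ge(1)[of w x] by simp
  have local: "real (local_degree w) * ln (max 1 (w d)) \<le>
      (if w \<in> extensions rat_abs then real (local_degree w) * L else 0) + real n * (real (local_degree w) * ln (max_abs w x))"
    if w: "w \<in> T" for w
  proof -
    have std: "w \<in> standard_absolute_values" using w T by auto
    note av = standard_absolute_value_is_absolute_value[OF std]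
    have "ln (max 1 (w d)) \<le> (if w \<in> extensions rat_abs then L else 0) + real n * ln (max_abs w x)"
    proof (cases "w \<in> extensions rat_abs")
      case True
      have "w d \<le> fact n * (c * max_abs w x) ^ n"
        unfolding d_def n_def by (rule absolute_value_matrix_det_le(1)[OF av arch[OF std]])
      also have "\<dots> = (fact n * c ^ n) * max_abs w x ^ n" by (simp add: power_mult_distrib)
      finally have le: "w d \<le> (fact n * c ^ n) * max_abs w x ^ n" .
      have "1 * 1 \<le> (fact n * c ^ n) * max_abs w x ^ n"
        using fc one_le_power[OF max_abs_ge(1)[of w x], of n] by (intro mult_mono) auto
      then have "max 1 (w d) \<le> (fact n * c ^ n) * max_abs w x ^ n" using le by simp
      then have "ln (max 1 (w d)) \<le> ln ((fact n * c ^ n) * max_abs w x ^ n)" by (intro ln_mono) auto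
      also have "\<dots> = L + real n * ln (max_abs w x)"
        unfolding L_def using c max_abs_ge(1)[of w x] by (subst ln_mult) (auto simp: ln_realpow)
      finally show ?thesis using True by simp
    next
      case False
      then obtain p where "prime p" "w \<in> extensions (padic_abs p)" using std by (auto simp: standard_absolute_values_eq)
      then have na: "\<not> archimedean w" by (rule nonarchimedean_padic_extension)
      have "w d \<le> max_abs w x ^ n"
        unfolding d_def n_def by (rule absolute_value_matrix_det_le(2)[OF av nonarch[OF std na] na])
      then have "max 1 (w d) \<le> max_abs w x ^ n"
        using one_le_power[OF max_abs_ge(1)[of w x], of n] by simp
      then have "ln (max 1 (w d)) \<le> ln (max_abs w x ^ n)" by (intro ln_mono) auto
      then show ?thesis using False max_abs_ge(1)[of w x] by (simp add: ln_realpow)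
    qed
    then have "real (local_degree w) * ln (max 1 (w d)) \<le>
        real (local_degree w) * ((if w \<in> extensions rat_abs then L else 0) + real n * ln (max_abs w x))"
      by (intro mult_left_mono) auto
    then show ?thesis by (simp add: algebra_simps split: if_splits)
  qed
  have "- ln (\<nu> d) \<le> (\<Sum>w\<in>T. real (local_degree w) * ln (max 1 (w d)))"
    by (rule liouville_inequality[OF \<nu> _ T(1) _ T(2)]) (use det in \<open>auto simp: d_def T_def\<close>)
  also have "\<dots> \<le> (\<Sum>w\<in>T. (if w \<in> extensions rat_abs then real (local_degree w) * L else 0) + real n * (real (local_degree w) * ln (max_abs w x)))"
    by (intro sum_mono local)
  also have "\<dots> = (\<Sum>w\<in>T. if w \<in> extensions rat_abs then real (local_degree w) * L else 0) + real n * (real D * weil_height x)"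
    by (simp add: sum.distrib sum_distrib_left ht)
  \<comment> \<open>The same constant \<open>L\<close> occurs at every archimedean place, weighted
    by the local degree; the weights add up to \<open>D\<close>.\<close>
  also have "(\<Sum>w\<in>T. if w \<in> extensions rat_abs then real (local_degree w) * L else 0) =
      (\<Sum>w\<in>extensions rat_abs. real (local_degree (w :: 'k \<Rightarrow> real)) * L)"
    using T(1) by (intro sum.mono_neutral_cong_right) (auto simp: T_def)
  also have "\<dots> = real (\<Sum>w\<in>extensions rat_abs. local_degree (w :: 'k \<Rightarrow> real)) * L"
    by (simp add: sum_distrib_right)
  also have "\<dots> = real D * L" by (simp only: place_structure(2)[OF nontrivial_rat_abs])
  finally show "- ln (\<nu> (Determinants.det A)) \<le> real D * (ln (fact CARD('n) * c ^ CARD('n)) + real CARD('n) * weil_height x)"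
    by (simp add: d_def L_def n_def algebra_simps)
  \<comment> \<open>A single summand of the height sum, whose terms are all nonnegative, and whose
    local degree is at least 1.\<close>
  have "1 * ln (max_abs \<nu> x) \<le> real (local_degree \<nu>) * ln (max_abs \<nu> x)"
    using local_degree_pos[OF \<nu>] H0 by (intro mult_right_mono) auto
  also have "\<dots> \<le> (\<Sum>w\<in>T. real (local_degree w) * ln (max_abs w x))"
    using T(1) H0 by (intro member_le_sum) (auto simp: T_def)
  finally show "ln (max_abs \<nu> x) \<le> real D * weil_height x" by (simp add: ht)
qed

text \<open>The largest value, 2, belongs to the extensions of the 2-adic absolute value; elsewhere
  the value is 1 or \<open>1 / 2\<close>.\<close>

lemma standard_absolute_value_half_le:
  fixes w :: "'k::field_char_0 \<Rightarrow> real"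
  assumes w: "w \<in> standard_absolute_values" shows "w (1 / 2) \<le> 2"
proof (cases "w \<in> extensions rat_abs")
  case True
  have "w (of_rat (1 / 2)) = rat_abs (1 / 2)" by (rule extensionsD(2)[OF True])
  then show ?thesis by (simp add: of_rat_divide rat_abs_def)
next
  case False
  then obtain p where p: "prime p" "w \<in> extensions (padic_abs p)" using w by (auto simp: standard_absolute_values_eq)
  have "w (of_rat (1 / 2)) = padic_abs p (1 / 2)" by (rule extensionsD(2)[OF p(2)])
  moreover have "padic_abs p (1 / 2) \<le> 2"
  proof (cases "p = 2")
    case True
    have half: "padic_abs p 2 = 1 / 2" using padic_abs_self[OF p(1)] True by simp
    show ?thesis
      unfolding absolute_value_divide[OF absolute_value_padic_abs[OF p(1)]] absolute_value_1[OF absolute_value_padic_abs[OF p(1)]] half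
      by simp
  next
    case False
    then have "\<not> int p dvd 2" using p(1) primes_dvd_imp_eq[OF p(1), of 2]
      by (metis int_dvd_int_iff of_nat_numeral two_is_prime_nat)
    then have "padic_abs p 2 = 1" using padic_abs_of_int_coprime[OF p(1), of 2] by simp
    then show ?thesis
      by (simp add: absolute_value_divide[OF absolute_value_padic_abs[OF p(1)]] absolute_value_1[OF absolute_value_padic_abs[OF p(1)]])
  qed
  ultimately show ?thesis by (simp add: of_rat_divide)
qed

text \<open>The maximum runs over infinitely many exponent vectors but only finitely many values. A
  zero polynomial has height \<open>-\<infinity>\<close> and is treated apart from the
  logarithm.\<close>

lemma coefficient_le_exp_height:
  fixes f :: "'n::finite int_mpoly"
  assumes "mpoly_height f \<le> ereal h"
  shows "\<bar>of_int (Poly_Mapping.lookup f m)\<bar> \<le> exp h"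
proof -
  define M where "M = (MAX m. \<bar>Poly_Mapping.lookup f m\<bar>)"
  have "finite (range (\<lambda>m. \<bar>Poly_Mapping.lookup f m\<bar>))"
  proof (rule finite_subset)
    show "range (\<lambda>m. \<bar>Poly_Mapping.lookup f m\<bar>) \<subseteq> insert 0 ((\<lambda>m. \<bar>Poly_Mapping.lookup f m\<bar>) ` Poly_Mapping.keys f)"
      by (auto simp: in_keys_iff image_iff)
  qed simp
  then have le: "\<bar>Poly_Mapping.lookup f m\<bar> \<le> M" unfolding M_def by (intro Max_ge) auto
  have "real_of_int M \<le> exp h"
  proof (cases "M = 0")
    case False
    then have "M > 0" using le by linarith
    moreover have "log_ext (of_int M) \<le> ereal h" using assms by (simp add: mpoly_height_def M_def)
    ultimately have "ln (real_of_int M) \<le> h" by (simp add: log_ext_def)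
    then show ?thesis using \<open>M > 0\<close> by (metis exp_le_cancel_iff exp_ln of_int_0_less_iff)
  qed simp
  then show ?thesis using le by linarith
qed

lemma derived_quadraticI:
  fixes f :: "'n::finite int_mpoly"
  assumes "mpoly_degree f \<le> 2" "mpoly_height f \<le> ereal h"
  shows "derived_quadratic 0 (exp h) f"
proof -
  have "(\<Sum>i\<in>UNIV. Poly_Mapping.lookup m i) \<le> mpoly_degree f" if "m \<in> Poly_Mapping.keys f" for m
    unfolding mpoly_degree_def using that by (intro Max_ge) auto
  then show ?thesis
    using assms coefficient_le_exp_height[OF assms(2)] by (force simp: derived_quadratic_def)
qed

text \<open>A nonzero integer coefficient has absolute value at least 1.\<close>

lemma height_nonneg:
  fixes f :: "'n::finite int_mpoly"
  assumes "derived_quadratic k (exp h) f" "f \<noteq> 0" shows "0 \<le> h"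
proof -
  obtain m where "Poly_Mapping.lookup f m \<noteq> 0" using assms(2) by (metis poly_mapping_eqI lookup_zero)
  then have "1 \<le> \<bar>real_of_int (Poly_Mapping.lookup f m)\<bar>" by linarith
  also have "\<dots> \<le> exp h" using assms(1) by (simp add: derived_quadratic_def)
  finally show ?thesis by simp
qed

text \<open>\<open>\<delta>\<close> stands for the size of the determinant, \<open>H\<close> for
  \<open>max_abs\<close> at \<nu>, and \<open>t\<close> for the height of the zero. The coefficient
  3 of \<open>h\<close> is attained: Cramer's rule and Liouville's inequality each contribute
  \<open>n * h\<close> through \<open>c ^ n\<close>, and the second derivatives one more
  \<open>h\<close>, at most \<open>n * h\<close>.\<close>

lemma gamma_estimate:
  fixes n D :: nat and h t c \<delta> H :: real
  assumes n: "1 \<le> n" and D: "1 \<le> D" and h: "0 \<le> h" and t: "0 \<le> t" and \<delta>: "0 < \<delta>" and H: "1 \<le> H"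
    and c: "c = 2 * (real n + 1) * exp h"
    and lnH: "ln H \<le> real D * t" and lnd: "- ln \<delta> \<le> real D * (ln (fact n * c ^ n) + real n * t)"
  shows "ln (4 * real n ^ 4 * exp h * (fact n * (c * H) ^ n / \<delta>)) \<le>
    3 * real D * real n * ((real n)\<^sup>2 + 4 * ln (real n) + h + t + 3)"
proof -
  define l where "l = ln (real n)"
  have l: "0 \<le> l" using n by (simp add: l_def)
  have c0: "c > 0" using n by (simp add: c)
  have "ln (4::real) = 2 * ln 2" using ln_realpow[of 2 2] by simp
  \<comment> \<open>From \<open>ln 2 \<le> 25 / 36\<close>, since
    \<open>50 / 36 < 7 / 5\<close>.\<close>
  then have ln4: "ln (4::real) \<le> 7 / 5" using ln2_le_25_over_36 by simp
  have lnc: "ln c \<le> 7 / 5 + l + h"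
  proof -
    have "ln c = ln (2 * (real n + 1)) + h" unfolding c using n by (subst ln_mult) auto
    also have "ln (2 * (real n + 1)) \<le> ln (4 * real n)" using n by (intro ln_mono) auto
    also have "\<dots> = ln 4 + l" using n by (simp add: ln_mult l_def)
    finally show ?thesis using ln4 by simp
  qed
  have "ln (fact n :: real) \<le> ln (real n ^ n)"
    using n fact_le_power[of n, where 'a = real] by (intro ln_mono) auto
  then have lnf: "ln (fact n :: real) \<le> real n * l" using n by (simp add: ln_realpow l_def)
  define L where "L = real n * (2 * l + 7 / 5 + h)"
  have lnfc: "ln (fact n * c ^ n) \<le> L"
  proof -
    have "ln (fact n * c ^ n) = ln (fact n) + real n * ln c" using c0 by (simp add: ln_mult ln_realpow)
    also have "\<dots> \<le> real n * l + real n * (7 / 5 + l + h)" by (intro add_mono lnf mult_left_mono lnc) auto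
    finally show ?thesis by (simp add: L_def algebra_simps)
  qed
  have "4 * real n ^ 4 * exp h * (fact n * (c * H) ^ n / \<delta>) = (4 * real n ^ 4) * exp h * (fact n * c ^ n) * H ^ n / \<delta>"
    by (simp add: power_mult_distrib)
  also have "ln \<dots> = ln 4 + 4 * l + h + ln (fact n * c ^ n) + real n * ln H - ln \<delta>"
    using n c0 H \<delta> by (simp add: ln_div ln_mult ln_realpow l_def)
  also have "\<dots> \<le> 7 / 5 + 4 * l + h + L + real n * (real D * t) + real D * (L + real n * t)"
  proof -
    have "real D * (ln (fact n * c ^ n) + real n * t) \<le> real D * (L + real n * t)"
      using lnfc by (intro mult_left_mono) auto
    moreover have "real n * ln H \<le> real n * (real D * t)" using lnH by (intro mult_left_mono) auto
    ultimately show ?thesis using ln4 lnfc lnd by linarith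
  qed
  also have "\<dots> \<le> real D * (7 / 5 + 4 * l + h + 2 * L + 2 * (real n * t))"
  proof -
    have "7 / 5 + 4 * l + h + L \<le> real D * (7 / 5 + 4 * l + h + L)"
      using mult_right_mono[of 1 "real D" "7 / 5 + 4 * l + h + L"] D l h by (simp add: L_def)
    then show ?thesis by (simp add: algebra_simps)
  qed
  also have "\<dots> \<le> real D * (3 * real n * ((real n)\<^sup>2 + 4 * l + h + t + 3))"
  proof (rule mult_left_mono)
    have "7 / 5 + 4 * l + h \<le> real n * (7 / 5 + 4 * l + h)"
      using mult_right_mono[of 1 "real n" "7 / 5 + 4 * l + h"] n l h by simp
    \<comment> \<open>Here \<open>21 / 5\<close> is three times \<open>7 / 5\<close>, and
      \<open>8 * l\<close> combines the fourth power of \<open>n\<close> with the two copies of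
      \<open>L\<close>, which hold \<open>2 * l\<close> each per factor \<open>n\<close>.\<close>
    then have "7 / 5 + 4 * l + h + 2 * L + 2 * (real n * t) \<le> real n * (21 / 5 + 8 * l + 3 * h + 2 * t)"
      by (simp add: L_def algebra_simps)
    also have "\<dots> \<le> real n * (3 * ((real n)\<^sup>2 + 4 * l + h + t + 3))"
      using l t h by (intro mult_left_mono) (auto simp: algebra_simps)
    finally show "7 / 5 + 4 * l + h + 2 * L + 2 * (real n * t) \<le> 3 * real n * ((real n)\<^sup>2 + 4 * l + h + t + 3)"
      by (simp add: mult_ac)
  qed simp
  finally show ?thesis by (simp add: l_def mult_ac)
qed

theorem theorem11:
  fixes F :: "'n::finite int_mpoly^'n"
    and \<zeta> :: "'k::field_char_0^'n"
    and h :: real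
    and \<nu> :: "'k \<Rightarrow> real"
  assumes "number_field TYPE('k)"
    and "\<exists>x::'k. x\<^sup>2 = -1"
    and "(MAX i. mpoly_degree (F $ i)) \<le> 2"
    and "\<forall>i. mpoly_height (F $ i) \<le> ereal h"
    and "\<forall>i. mpoly_eval (F $ i) \<zeta> = 0"
    and "invertible (mpoly_jacobian F \<zeta>)"
    and "\<nu> \<in> standard_absolute_values"
  shows "log_ext (gamma_number \<nu> F \<zeta>) \<le>
    ereal (3 * real (field_degree TYPE('k)) * real CARD('n) *
      ((real CARD('n))\<^sup>2 + 4 * ln (real CARD('n)) + h + weil_height \<zeta> + 3))"
proof -
  obtain b crd where "rat_basis (field_degree TYPE('k)) (b :: nat \<Rightarrow> 'k) crd"
    using rat_basis_exists[OF assms(1)] by blast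
  then interpret rat_basis "field_degree TYPE('k)" b crd .
  define A where "A = mpoly_jacobian F \<zeta>"
  define n where "n = CARD('n)"
  \<comment> \<open>A first derivative has at most \<open>n + 1\<close> monomials, with coefficients
    at most \<open>2 * exp h\<close>.\<close>
  define c where "c = 2 * (real n + 1) * exp h"
  have n: "1 \<le> n" by (simp add: n_def Suc_le_eq)
  have det: "Determinants.det A \<noteq> 0" using assms(6) by (simp add: A_def invertible_det_nz)
  have "mpoly_degree (F $ i) \<le> 2" for i
    using assms(3) Max_ge[of "range (\<lambda>i. mpoly_degree (F $ i))" "mpoly_degree (F $ i)"] by simp
  then have F: "derived_quadratic 0 (exp h) (F $ i)" for i
    using assms(4) by (intro derived_quadraticI) auto
  have F1: "derived_quadratic 1 (2 * exp h) (mpoly_pderiv i (F $ j))" for i j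
    using derived_quadratic_pderiv[OF F, of i j] by simp
  \<comment> \<open>If all the polynomials were zero, the Jacobian would be singular; a nonzero one
    gives \<open>0 \<le> h\<close>.\<close>
  have "\<exists>i. F $ i \<noteq> 0"
  proof (rule ccontr)
    assume "\<not> ?thesis"
    then have "A $ j $ i = 0" for i j by (simp add: A_def mpoly_jacobian_def mpoly_pderiv_def mpoly_eval_def)
    then have "Determinants.det A = 0" by (simp add: Determinants.det_def power_0_left)
    then show False using det by simp
  qed
  then have h: "0 \<le> h" using height_nonneg[OF F] by blast
  have entries: "w (A $ j $ i) \<le> c * max_abs w \<zeta>" if w: "w \<in> standard_absolute_values" for w i j
  proof -
    note av = standard_absolute_value_is_absolute_value[OF w]
    have "w (A $ j $ i) \<le> real (card (Poly_Mapping.keys (mpoly_pderiv i (F $ j)))) * (2 * exp h * max_abs w \<zeta> ^ (2 - 1))"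
      unfolding A_def mpoly_jacobian_def using absolute_value_mpoly_eval_le[OF av max_abs_ge F1] by simp
    also have "\<dots> \<le> (real n + 1) * (2 * exp h * max_abs w \<zeta> ^ (2 - 1))"
      using card_keys_derived_quadratic_1[OF F1, of i j] max_abs_ge(1)[of w \<zeta>]
      by (intro mult_right_mono) (auto simp: n_def)
    also have "\<dots> = c * max_abs w \<zeta>" by (simp add: c_def)
    finally show ?thesis .
  qed
  have entries_nonarch: "w (A $ j $ i) \<le> max_abs w \<zeta>"
    if w: "w \<in> standard_absolute_values" "\<not> archimedean w" for w i j
    unfolding A_def mpoly_jacobian_def
    using nonarchimedean_mpoly_eval_le[OF standard_absolute_value_is_absolute_value[OF w(1)] max_abs_ge w(2) F1] by simp
  have c: "1 \<le> c"
    unfolding c_def using mult_mono[of 1 "2 * (real n + 1)" 1 "exp h"] h by simp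
  note bounds = neg_ln_det_le[OF assms(7) det c entries entries_nonarch]
  note av = standard_absolute_value_is_absolute_value[OF assms(7)]
  define \<delta> where "\<delta> = \<nu> (Determinants.det A)"
  define H where "H = max_abs \<nu> \<zeta>"
  have \<delta>: "\<delta> > 0" using absolute_value_pos[OF av det] by (simp add: \<delta>_def)
  have H: "1 \<le> H" by (simp add: H_def max_abs_ge)
  have cH: "1 \<le> c * H" using mult_mono[of 1 c 1 H] c H by simp
  have inv: "\<nu> (matrix_inv A $ k $ l) \<le> fact n * (c * H) ^ n / \<delta>" for k l
    using absolute_value_matrix_inv_le[OF av entries[OF assms(7), folded H_def] cH assms(6)[folded A_def], of k l] \<delta>
    by (simp add: n_def \<delta>_def pos_le_divide_eq)
  have gamma: "0 \<le> gamma_number \<nu> F \<zeta>"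
    "gamma_number \<nu> F \<zeta> \<le> 4 * real n ^ 4 * exp h * (fact n * (c * H) ^ n / \<delta>)"
    using gamma_number_le[OF av F _ inv[unfolded A_def] standard_absolute_value_half_le[OF assms(7)]]
    by (simp_all add: n_def)
  show ?thesis
  \<comment> \<open>For the value 0 the left side is \<open>-\<infinity>\<close>; otherwise the real
    logarithm is monotone.\<close>
  proof (cases "gamma_number \<nu> F \<zeta> = 0")
    case True
    then show ?thesis by (simp add: log_ext_def)
  next
    case False
    have t: "0 \<le> weil_height \<zeta>"
    proof -
      have "0 \<le> ln H" using H by simp
      also have "\<dots> \<le> real (field_degree TYPE('k)) * weil_height \<zeta>" unfolding H_def by (rule bounds(2))
      finally show ?thesis using dimension_pos by (simp add: zero_le_mult_iff)
    qed
    have "ln (gamma_number \<nu> F \<zeta>) \<le> ln (4 * real n ^ 4 * exp h * (fact n * (c * H) ^ n / \<delta>))"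
      using gamma False by (intro ln_mono) auto
    also have "\<dots> \<le> 3 * real (field_degree TYPE('k)) * real n * ((real n)\<^sup>2 + 4 * ln (real n) + h + weil_height \<zeta> + 3)"
    proof (rule gamma_estimate[OF n _ h t \<delta> H c_def])
      show "1 \<le> field_degree TYPE('k)" using dimension_pos by simp
      show "ln H \<le> real (field_degree TYPE('k)) * weil_height \<zeta>"
        unfolding H_def by (rule bounds(2))
      show "- ln \<delta> \<le> real (field_degree TYPE('k)) * (ln (fact n * c ^ n) + real n * weil_height \<zeta>)"
        unfolding \<delta>_def n_def by (rule bounds(1))
    qed
    finally show ?thesis using False by (simp add: log_ext_def n_def)
  qed
qed

end
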